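(* There is an absolute constant $C_0>2$ such that the following holds. Let $\Omega$ be the set of sufficiently large positive integers $M$ such that (i) $M$ is square-free; (ii) $0.9\log\log M<\omega(M)<1.1\log\log M$; (iii) $M=Am$ with $3\le A\le(\log M)^{0.1}$ and $P^-(m)>(\log M)^{C_0}$ (this representation is unique). Then for $M\in\Omega$, with $A$ as in (iii), $$S(R_M)=\frac{2M^2}{|R_M|}-MA|R_A|^{-1}+O\big(M(\log M)^{-0.4}\big).$$
   Context: $\omega(n)$ is the number of distinct prime divisors of $n$ and $P^-(n)$ its least prime divisor. $R_N=\{a^2:a\in\mathbb{Z}_N\}$ is the set of quadratic residues modulo $N$ (including $0$). For $U\subseteq\mathbb{Z}_n$ with $|U|=k\ge2$, write $U=\{u_1<\dots<u_k\}\subseteq\{0,\dots,n-1\}$, $s_i=u_{i+1}-u_i$ ($i<k$), $s_k=u_1+n-u_k$, and $S(U)=\sum_{i=1}^k s_i^2$. *)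

theory Defs
  imports Complex_Main "HOL-Computational_Algebra.Computational_Algebra"
begin

definition omega :: "nat \<Rightarrow> nat" where
  "omega n = card (prime_factors n)"

text \<open>Only meaningful for \<open>n \<ge> 2\<close>. The degenerate value at \<open>n = 1\<close> plays no role below:
  \<open>m = 1\<close> would force \<open>3 \<le> M = A \<le> (log M) powr 0.1\<close>, which is impossible.\<close>
definition least_prime_divisor :: "nat \<Rightarrow> nat" where
  "least_prime_divisor n = Min (prime_factors n)"

text \<open>Residue classes modulo \<open>N\<close> are represented by \<open>{0..<N}\<close>.\<close>
definition quad_residues :: "nat \<Rightarrow> nat set" where
  "quad_residues N = {a\<^sup>2 mod N | a. a \<in> {0..<N}}"

text \<open>\<open>cyclic_gap n U i\<close> is \<open>s\<^sub>i\<^sub>+\<^sub>1\<close> in one-based indexing; the last gap wraps around modulo \<open>n\<close>.\<close>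
definition cyclic_gap :: "nat \<Rightarrow> nat set \<Rightarrow> nat \<Rightarrow> int" where
  "cyclic_gap n U i =
     (let u = sorted_list_of_set U in
      if i + 1 < card U then int (u ! (i + 1)) - int (u ! i)
      else int (u ! 0) + int n - int (u ! i))"

definition gap_square_sum :: "nat \<Rightarrow> nat set \<Rightarrow> int" where
  "gap_square_sum n U = (\<Sum>i<card U. (cyclic_gap n U i)\<^sup>2)"

definition admissible_rep :: "real \<Rightarrow> nat \<Rightarrow> nat \<Rightarrow> nat \<Rightarrow> bool" where
  "admissible_rep C\<^sub>0 M A m \<longleftrightarrow>
     M = A * m \<and> 3 \<le> A \<and> real A \<le> ln (real M) powr 0.1 \<and>
     real (least_prime_divisor m) > ln (real M) powr C\<^sub>0"

text \<open>\<open>M\<^sub>0\<close> is the threshold for ``sufficiently large''.\<close>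
definition Omega_set :: "real \<Rightarrow> nat \<Rightarrow> nat set" where
  "Omega_set C\<^sub>0 M\<^sub>0 =
     {M. 0 < M \<and> M\<^sub>0 \<le> M \<and> squarefree M \<and>
         0.9 * ln (ln (real M)) < real (omega M) \<and>
         real (omega M) < 1.1 * ln (ln (real M)) \<and>
         (\<exists>A m. admissible_rep C\<^sub>0 M A m)}"

end

theory Submission
  imports "HOL-Number_Theory.Number_Theory" "HOL-Analysis.Convex" Defs
begin

text \<open>Write \<open>N\<^sub>h\<close> for the number of \<open>x\<close> modulo \<open>M\<close> such that \<open>x + 1, \<dots>, x + h\<close> are all
  non-residues; then \<open>S(R\<^sub>M) = 2 (N\<^sub>0 + N\<^sub>1 + \<dots>) - M\<close>.

  For \<open>h\<close> up to a power of \<open>log M\<close>, sieving one prime factor of \<open>m\<close> at a time and bounding the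
  complete character sums by Stepanov's method gives \<open>N\<^sub>h\<close> as \<open>M/A\<close> times the sum over \<open>y\<close> modulo \<open>A\<close>
  of \<open>(1 - 2\<^sup>-\<^sup>\<omega>\<^sup>(\<^sup>m\<^sup>))\<^sup>J\<close>, where \<open>J\<close> counts the residues modulo \<open>A\<close> in \<open>y + 1, \<dots>, y + h\<close>. No
  truncation is needed: the weights of the nontrivial character sums add up to at most one. The sum
  of these main terms over \<open>h\<close> is evaluated with the reflection \<open>h \<mapsto> A - h\<close>.

  For larger \<open>h\<close>, an interval without residues forces, for some \<open>d > 1\<close> dividing \<open>m\<close>, a sum of the
  real character modulo \<open>d\<close> over about \<open>h/A\<close> consecutive integers to be large. If \<open>h\<close> is below
  \<open>d\<^sup>1\<^sup>/\<^sup>2\<close> by a power of \<open>log M\<close>, the fourth moment shows that this is rare enough; otherwise it never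
  happens, by Burgess' shift argument.\<close>

section \<open>Polynomials modulo a prime\<close>

text \<open>Write L for log M. A second moment would make large character sums of length h rarer
  only like 1/h, and summing over h would lose a factor of order L; the fourth moment gives 1/h^2,
  so that starting at h = L^8 gains a power of L. Its second term, of order sqrt(d) h^4, spoils the
  gain once h comes close to sqrt(d). The Polya-Vinogradov inequality takes over only beyond sqrt(d)
  log d, and the window in between, a power of L wide, is what Burgess' argument closes. That
  argument gains a power of the number of multipliers, which must be units modulo d. Primes above
  L^400 leave room for multipliers of size L^64, and even when d is a single prime they keep the
  cost of the shifts, about L^64 d^(1/4), well below the length of the interval. This is the origin
  of the constant 400. Complete sums may lose a factor linear in the number of shifts: the sieve
  uses about L^9 shifts against sqrt(p) > L^200.\<close>

lemma pigeonhole_linear_system_mod: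
  fixes a :: "'r \<Rightarrow> 'c \<Rightarrow> int" and p :: nat
  assumes fin: "finite R" "finite C" and less: "card R < card C" and p: "p > 1"
  shows "\<exists>u. (\<exists>c\<in>C. \<not> int p dvd u c) \<and> (\<forall>r\<in>R. int p dvd (\<Sum>c\<in>C. u c * a r c))"
proof -
  \<comment> \<open>Counting replaces linear algebra over the field with p elements: two of the
    p^|C| coefficient vectors give the same residues in all equations, and their difference is the
    solution.\<close>
  let ?U = "C \<rightarrow>\<^sub>E {0..<int p}"
  let ?V = "R \<rightarrow>\<^sub>E {0..<int p}"
  define F where "F u = (\<lambda>r\<in>R. (\<Sum>c\<in>C. u c * a r c) mod int p)" for u
  have cU: "card ?U = p ^ card C" and cV: "card ?V = p ^ card R"
    using fin by (simp_all add: card_PiE)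
  have sub: "F ` ?U \<subseteq> ?V"
    using p by (auto simp: F_def)
  have "card ?V < card ?U"
    unfolding cU cV using less p by (rule power_strict_increasing)
  moreover have "finite ?V" using fin by (intro finite_PiE) auto
  ultimately have "\<not> inj_on F ?U"
    using card_inj_on_le[OF _ sub] by (meson leD)
  then obtain u v where uv: "u \<in> ?U" "v \<in> ?U" "F u = F v" "u \<noteq> v"
    by (auto simp: inj_on_def)
  from uv(4) obtain c where c: "u c \<noteq> v c" by auto
  with uv have cC: "c \<in> C" by (metis PiE_arb)
  have "\<not> int p dvd u c - v c"
  proof
    assume "int p dvd u c - v c"
    then have "u c mod int p = v c mod int p" by (simp add: mod_eq_dvd_iff)
    moreover have "u c \<in> {0..<int p}" "v c \<in> {0..<int p}" using uv cC by auto
    ultimately show False using c by simp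
  qed
  moreover have "int p dvd (\<Sum>c\<in>C. (u c - v c) * a r c)" if "r \<in> R" for r
  proof -
    have "F u r = F v r" using uv by simp
    then have "int p dvd (\<Sum>c\<in>C. u c * a r c) - (\<Sum>c\<in>C. v c * a r c)"
      using that by (simp add: F_def mod_eq_dvd_iff)
    then show ?thesis by (simp add: left_diff_distrib sum_subtractf)
  qed
  ultimately show ?thesis using cC by (intro exI[of _ "\<lambda>c. u c - v c"]) auto
qed

text \<open>Each step divides out one factor X - a by synthetic division, lowering both the degree
  and the multiplicity of a by one. Multiplicity is measured by ordinary derivatives; up to order p
  this is sound, since the factors k + 1 that appear stay below p. Polynomials over the field with p
  elements are represented by integer ones, with \<open>[:p:] dvd\<close> for being zero.\<close>

lemma root_multiplicity_bound_mod:
  fixes p :: int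
  assumes p: "prime p" and fin: "finite S" and S: "S \<subseteq> {0..<p}"
  shows "(\<And>a. a \<in> S \<Longrightarrow> \<mu> a \<le> nat p) \<Longrightarrow>
         (\<And>a k. a \<in> S \<Longrightarrow> k < \<mu> a \<Longrightarrow> p dvd poly ((pderiv ^^ k) Q) a) \<Longrightarrow>
         \<not> [:p:] dvd Q \<Longrightarrow> (\<Sum>a\<in>S. \<mu> a) \<le> degree Q"
proof (induction "\<Sum>a\<in>S. \<mu> a" arbitrary: Q \<mu>)
  case 0
  then show ?case by simp
next
  case (Suc n)
  note outer = Suc.prems(2)
  from Suc.hyps(2) obtain a where a: "a \<in> S" "\<mu> a > 0"
    by (metis Suc_neq_Zero gr0I sum.neutral)
  define G where "G = synthetic_div Q a"
  define c where "c = poly Q a"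
  have Q: "Q = [:-a, 1:] * G + [:c:]"
    unfolding G_def c_def by (rule synthetic_div_correct'[symmetric])
  have pc: "p dvd c" using Suc.prems(2)[OF a] by (simp add: c_def)
  have nG: "\<not> [:p:] dvd G"
  proof
    assume "[:p:] dvd G"
    then have "[:p:] dvd [:-a, 1:] * G + [:c:]"
      using pc by (intro dvd_add dvd_mult) auto
    then show False using Q Suc.prems(3) by simp
  qed
  have degQ: "degree Q > 0"
  proof (rule ccontr)
    assume "\<not> ?thesis"
    then have "G = 0" by (simp add: G_def synthetic_div_eq_0_iff)
    then show False using nG by simp
  qed
  have D: "(pderiv ^^ Suc k) Q = [:-a, 1:] * (pderiv ^^ Suc k) G + of_nat (Suc k) * (pderiv ^^ k) G" for k
  proof (induction k)
    case 0
    show ?case by (subst Q) (simp add: pderiv_add pderiv_diff pderiv_smult pderiv_pCons)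
  next
    case (Suc k)
    have "(pderiv ^^ Suc (Suc k)) Q = pderiv ((pderiv ^^ Suc k) Q)" by simp
    also have "\<dots> = [:-a, 1:] * (pderiv ^^ Suc (Suc k)) G + of_nat (Suc (Suc k)) * (pderiv ^^ Suc k) G"
      unfolding Suc.IH
      by (simp add: pderiv_add pderiv_diff pderiv_smult pderiv_mult pderiv_pCons pderiv_of_nat algebra_simps)
    finally show ?case .
  qed
  have Db: "poly ((pderiv ^^ Suc k) Q) b = (b - a) * poly ((pderiv ^^ Suc k) G) b
      + int (Suc k) * poly ((pderiv ^^ k) G) b" for k b
    unfolding D by (simp add: algebra_simps)
  define \<mu>' where "\<mu>' = \<mu>(a := \<mu> a - 1)"
  have sum': "(\<Sum>a\<in>S. \<mu> a) = Suc (\<Sum>a\<in>S. \<mu>' a)"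
  proof -
    have "(\<Sum>x\<in>S. \<mu> x) = \<mu> a + (\<Sum>x\<in>S-{a}. \<mu> x)" using fin a by (simp add: sum.remove)
    moreover have "(\<Sum>x\<in>S. \<mu>' x) = \<mu>' a + (\<Sum>x\<in>S-{a}. \<mu>' x)" using fin a by (simp add: sum.remove)
    moreover have "(\<Sum>x\<in>S-{a}. \<mu>' x) = (\<Sum>x\<in>S-{a}. \<mu> x)" by (rule sum.cong) (auto simp: \<mu>'_def)
    ultimately show ?thesis using a by (simp add: \<mu>'_def)
  qed
  have "(\<Sum>a\<in>S. \<mu>' a) \<le> degree G"
  proof (rule Suc.hyps(1)[OF _ _ _ nG])
    show "n = sum \<mu>' S" using Suc.hyps(2) sum' by simp
    show "\<mu>' b \<le> nat p" if "b \<in> S" for b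
      using Suc.prems(1)[OF that] by (auto simp: \<mu>'_def)
    show "p dvd poly ((pderiv ^^ k) G) b" if b: "b \<in> S" and k: "k < \<mu>' b" for b k
    proof (cases "b = a")
      case True
      with k have k': "Suc k < \<mu> a" by (simp add: \<mu>'_def)
      have "p dvd poly ((pderiv ^^ Suc k) Q) a" by (rule Suc.prems(2)[OF a(1) k'])
      then have "p dvd int (Suc k) * poly ((pderiv ^^ k) G) a" using Db[of k a] by simp
      moreover have "\<not> p dvd int (Suc k)"
        using Suc.prems(1)[OF a(1)] k' by (intro zdvd_not_zless) linarith+
      ultimately show ?thesis using p True by (simp add: prime_dvd_mult_iff)
    next
      case False
      have k': "k < \<mu> b" using k False by (simp add: \<mu>'_def)
      have nab: "\<not> p dvd b - a"
      proof
        assume "p dvd b - a"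
        then have "b mod p = a mod p" by (simp add: mod_eq_dvd_iff)
        moreover have "a \<in> {0..<p}" "b \<in> {0..<p}" using S a b by auto
        ultimately show False using False by simp
      qed
      \<comment> \<open>Now b - a is a unit modulo p, so the derivatives of \<open>G\<close> at b
        vanish one after another, each thanks to its predecessor.\<close>
      from k' show ?thesis
      proof (induction k)
        case 0
        have "p dvd poly Q b" using Suc.prems(2)[OF b, of 0] 0 by simp
        moreover have "poly Q b = (b - a) * poly G b + c" by (subst Q) (simp add: algebra_simps)
        ultimately have "p dvd (b - a) * poly G b" using pc by (metis dvd_add_left_iff)
        then show ?case using nab p by (simp add: prime_dvd_mult_iff)
      next
        case (Suc k)
        then have "p dvd poly ((pderiv ^^ k) G) b" by simp
        moreover have "p dvd poly ((pderiv ^^ Suc k) Q) b" by (rule outer[OF b Suc.prems])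
        ultimately have "p dvd (b - a) * poly ((pderiv ^^ Suc k) G) b"
          unfolding Db by (metis dvd_add_left_iff dvd_mult)
        then show ?case using nab p by (simp add: prime_dvd_mult_iff)
      qed
    qed
  qed
  moreover have "degree G = degree Q - 1" by (simp add: G_def degree_synthetic_div)
  ultimately show ?case using sum' degQ by simp
qed

lemma higher_pderiv_mult_mod:
  fixes p :: int
  assumes "[:p:] dvd pderiv Y"
  shows "[:p:] dvd (pderiv ^^ k) (F * Y) - (pderiv ^^ k) F * Y"
proof (induction k)
  case (Suc k)
  from Suc obtain Z where Z: "(pderiv ^^ k) (F * Y) = (pderiv ^^ k) F * Y + [:p:] * Z"
    by (metis dvdE add.commute diff_add_cancel)
  have "(pderiv ^^ Suc k) (F * Y) - (pderiv ^^ Suc k) F * Y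
      = (pderiv ^^ k) F * pderiv Y + [:p:] * pderiv Z"
    by (simp add: Z pderiv_add pderiv_mult pderiv_smult)
  also have "[:p:] dvd \<dots>" using assms by (intro dvd_add dvd_mult dvd_triv_left)
  finally show ?case .
qed simp

text \<open>The cofactor that remains when f^(n-k) is taken out of the k-th derivative of f^n s. Its
  degree grows with k but not with n; this is why vanishing to high order costs few linear
  conditions.\<close>

fun power_deriv_factor :: "int poly \<Rightarrow> nat \<Rightarrow> nat \<Rightarrow> int poly \<Rightarrow> int poly" where
  "power_deriv_factor f n 0 s = s"
| "power_deriv_factor f n (Suc k) s =
     smult (int n - int k) (pderiv f * power_deriv_factor f n k s) + f * pderiv (power_deriv_factor f n k s)"

lemma higher_pderiv_power_mult:
  "k \<le> n \<Longrightarrow> (pderiv ^^ k) (f ^ n * s) = f ^ (n - k) * power_deriv_factor f n k s"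
proof (induction k)
  case (Suc k)
  define m where "m = n - Suc k"
  have nk: "n - k = Suc m" and i: "int n - int k = int (Suc m)" using Suc.prems by (auto simp: m_def)
  have "(pderiv ^^ Suc k) (f ^ n * s) = pderiv (f ^ Suc m * power_deriv_factor f n k s)"
    using Suc nk by simp
  also have "\<dots> = f ^ m * power_deriv_factor f n (Suc k) s"
    unfolding power_deriv_factor.simps i
    by (simp add: pderiv_mult pderiv_power_Suc algebra_simps del: of_nat_Suc power_Suc) 
       (simp add: algebra_simps)
  finally show ?case by (simp add: m_def)
qed simp

lemma degree_power_deriv_factor:
  "degree (power_deriv_factor f n k s) \<le> degree s + k * degree f"
proof (induction k)
  case (Suc k)
  let ?W = "power_deriv_factor f n k s"
  have "degree (pderiv f * ?W) \<le> degree f + degree ?W"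
    using degree_mult_le[of "pderiv f" ?W] by (simp add: degree_pderiv)
  then have "degree (smult (int n - int k) (pderiv f * ?W)) \<le> degree f + degree ?W"
    using degree_smult_le le_trans by blast
  moreover have "degree (f * pderiv ?W) \<le> degree f + degree ?W"
    using degree_mult_le[of f "pderiv ?W"] by (simp add: degree_pderiv)
  ultimately have "degree (power_deriv_factor f n (Suc k) s) \<le> degree f + degree ?W"
    by (simp add: degree_add_le)
  then show ?case using Suc by simp
qed simp

lemma const_prime_dvd_mult:
  fixes p :: int
  assumes "prime p" "[:p:] dvd a * b"
  shows "[:p:] dvd a \<or> [:p:] dvd b"
  using assms by (meson prime_elem_const_poly_iff prime_elem_dvd_mult_iff prime_imp_prime_elem)

lemma const_prime_not_dvd_monic:
  fixes p :: int
  assumes "prime p" "lead_coeff f = 1"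
  shows "\<not> [:p:] dvd f"
  using assms by (metis const_poly_dvd_iff not_prime_unit)

text \<open>The order of vanishing at the simple root -j is odd on one side of r^2 f = e s^2 and
  even on the other. The proof is an infinite descent on the degree of s: first s, then r is
  divisible by X + j, and the quotients satisfy the same relation.\<close>

lemma square_relation_descent_mod:
  fixes p :: int
  assumes p: "prime p" and f1: "\<not> p dvd poly f1 (-j)" and e: "\<not> p dvd e"
  shows "[:p:] dvd r\<^sup>2 * ([:j, 1:] * f1) - smult e (s\<^sup>2) \<Longrightarrow> [:p:] dvd r \<and> [:p:] dvd s"
proof (induction "degree s" arbitrary: r s rule: less_induct)
  case less
  let ?X = "[:j, 1:] :: int poly"
  have nX: "\<not> [:p:] dvd ?X" using p by (intro const_prime_not_dvd_monic) auto
  have ev: "p dvd poly Q x" if "[:p:] dvd Q" for Q x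
    using that by (metis dvdE poly_mult poly_pCons poly_0 mult_zero_right add_0_right dvd_triv_left)
  have "p dvd poly (r\<^sup>2 * (?X * f1) - smult e (s\<^sup>2)) (-j)" using less.prems by (rule ev)
  then have "p dvd e * (poly s (-j))\<^sup>2" by (simp add: poly_power)
  then have s0: "p dvd poly s (-j)" using p e by (metis prime_dvd_mult_iff prime_dvd_power)
  define s1 where "s1 = synthetic_div s (-j)"
  define cs where "cs = poly s (-j)"
  have s: "s = ?X * s1 + [:cs:]" using synthetic_div_correct'[of "-j" s] by (simp add: s1_def cs_def)
  have cs: "[:p:] dvd [:cs:]" using s0 by (simp add: cs_def)
  have sm: "smult e Q = [:e:] * Q" for Q by simp
  have ring_id: "(X * S + C)\<^sup>2 - X\<^sup>2 * S\<^sup>2 = C * (2 * (X * S) + C)" for X S C :: "int poly"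
    by (simp add: power2_eq_square algebra_simps)
  show ?case
  proof (cases "degree s = 0")
    case True
    then have "s1 = 0" by (simp add: s1_def synthetic_div_eq_0_iff)
    then have ps: "[:p:] dvd s" using s cs by simp
    then have "[:p:] dvd smult e (s\<^sup>2)" by (metis dvd_smult dvd_mult power2_eq_square)
    then have "[:p:] dvd r\<^sup>2 * (?X * f1)" using less.prems by (metis dvd_diff_left_iff)
    moreover have "\<not> [:p:] dvd f1" using f1 ev by blast
    ultimately have "[:p:] dvd r\<^sup>2" using nX p by (meson const_prime_dvd_mult)
    then show ?thesis using p ps by (metis const_prime_dvd_mult power2_eq_square)
  next
    case False
    have sq: "[:p:] dvd s\<^sup>2 - ?X\<^sup>2 * s1\<^sup>2"
    proof -
      have "s\<^sup>2 - ?X\<^sup>2 * s1\<^sup>2 = [:cs:] * (2 * (?X * s1) + [:cs:])"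
        unfolding ring_id[symmetric] by (simp only: s[symmetric])
      then show ?thesis using cs by (metis dvd_mult2)
    qed
    have "[:p:] dvd (r\<^sup>2 * (?X * f1) - smult e (s\<^sup>2)) + smult e (s\<^sup>2 - ?X\<^sup>2 * s1\<^sup>2)"
      using less.prems sq by (intro dvd_add dvd_smult)
    also have "(r\<^sup>2 * (?X * f1) - smult e (s\<^sup>2)) + smult e (s\<^sup>2 - ?X\<^sup>2 * s1\<^sup>2)
        = ?X * (r\<^sup>2 * f1 - smult e (?X * s1\<^sup>2))"
      by (simp only: sm power2_eq_square algebra_simps)
    finally have h1: "[:p:] dvd r\<^sup>2 * f1 - smult e (?X * s1\<^sup>2)"
      using nX p const_prime_dvd_mult by blast
    from ev[OF this, of "-j"] have "p dvd (poly r (-j))\<^sup>2 * poly f1 (-j)" by (simp add: poly_power)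
    then have r0: "p dvd poly r (-j)" using p f1 by (metis prime_dvd_mult_iff prime_dvd_power)
    define r1 where "r1 = synthetic_div r (-j)"
    define cr where "cr = poly r (-j)"
    have r: "r = ?X * r1 + [:cr:]" using synthetic_div_correct'[of "-j" r] by (simp add: r1_def cr_def)
    have cr: "[:p:] dvd [:cr:]" using r0 by (simp add: cr_def)
    have rq: "[:p:] dvd ?X\<^sup>2 * r1\<^sup>2 - r\<^sup>2"
    proof -
      have "?X\<^sup>2 * r1\<^sup>2 - r\<^sup>2 = - ([:cr:] * (2 * (?X * r1) + [:cr:]))"
        unfolding ring_id[symmetric] by (simp only: r[symmetric] minus_diff_eq)
      then show ?thesis using cr by (metis dvd_mult2 dvd_minus_iff)
    qed
    have "[:p:] dvd (r\<^sup>2 * f1 - smult e (?X * s1\<^sup>2)) + f1 * (?X\<^sup>2 * r1\<^sup>2 - r\<^sup>2)"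
      using h1 rq by (intro dvd_add dvd_mult)
    also have "(r\<^sup>2 * f1 - smult e (?X * s1\<^sup>2)) + f1 * (?X\<^sup>2 * r1\<^sup>2 - r\<^sup>2)
        = ?X * (r1\<^sup>2 * (?X * f1) - smult e (s1\<^sup>2))"
      by (simp only: sm power2_eq_square algebra_simps)
    finally have "[:p:] dvd r1\<^sup>2 * (?X * f1) - smult e (s1\<^sup>2)"
      using nX p const_prime_dvd_mult by blast
    moreover have "degree s1 < degree s" using False by (simp add: s1_def degree_synthetic_div)
    ultimately have "[:p:] dvd r1 \<and> [:p:] dvd s1" using less.hyps by blast
    then show ?thesis using r s cr cs by (metis dvd_add dvd_mult)
  qed
qed

section \<open>Stepanov's method for products of Legendre symbols\<close>

text \<open>Frobenius turns f^p into the product of the X^p + j^p, and j^p = j by Fermat; below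
  degree p only the constant term is left.\<close>

lemma prod_linear_power_low_coeffs:
  fixes p :: nat
  assumes p: "prime p" and fin: "finite T"
  shows "i < p \<Longrightarrow> int p dvd coeff ((\<Prod>j\<in>T. [:j, 1:]) ^ p - [:\<Prod>j\<in>T. j:]) i"
  using fin
proof (induction T arbitrary: i rule: finite_induct)
  case empty
  then show ?case by (simp flip: one_pCons)
next
  case (insert x T)
  let ?F = "(\<Prod>j\<in>T. [:j, 1:]) ^ p :: int poly" and ?e = "\<Prod>j\<in>T. j"
  let ?X = "[:x, 1:] ^ p :: int poly"
  have X: "int p dvd coeff (?X - [:x:]) k" if "k < p" for k
  proof (cases "k = 0")
    case True
    have "[x ^ p = x] (mod int p)"
    proof (cases "int p dvd x")
      case True
      then show ?thesis using p by (simp add: cong_def mod_0_imp_dvd dvd_power prime_gt_0_nat dvd_trans[OF True])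
    next
      case False
      define y where "y = nat (x mod int p)"
      have y: "[x = int y] (mod int p)"
        using prime_gt_0_nat[OF p] by (simp add: y_def cong_def)
      then have "\<not> p dvd y" using False by (metis cong_dvd_iff int_dvd_int_iff cong_dvd_modulus dvd_refl cong_0_iff cong_trans)
      then have "[int (y ^ (p - 1)) = int 1] (mod int p)"
        using fermat_theorem[OF p] by (simp only: cong_int_iff)
      then have "[x ^ (p - 1) = 1] (mod int p)"
        using cong_trans[OF cong_pow[OF y]] by simp
      then have "[x * x ^ (p - 1) = x * 1] (mod int p)" by (rule cong_scalar_left)
      then show ?thesis using p prime_gt_0_nat[OF p] by (simp flip: power_Suc)
    qed
    moreover have "coeff ?X 0 = x ^ p" by (simp add: coeff_0_power)
    ultimately show ?thesis using True by (simp add: cong_iff_dvd_diff)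
  next
    case False
    have "coeff ?X k = of_nat (p choose k) * x ^ (p - k)"
      using coeff_linear_poly_power[of k p x 1] that by simp
    moreover have "p dvd p choose k"
      using p False that by (intro dvd_choose_prime) auto
    ultimately show ?thesis using False by (simp add: coeff_pCons split: nat.splits)
  qed
  have "(\<Prod>j\<in>insert x T. [:j, 1:]) ^ p - [:\<Prod>j\<in>insert x T. j:]
      = (?X - [:x:]) * ?F + [:x:] * (?F - [:?e:])"
  proof -
    have "(\<Prod>j\<in>insert x T. [:j, 1:]) = [:x, 1:] * (\<Prod>j\<in>T. [:j, 1:])"
      and "[:\<Prod>j\<in>insert x T. j:] = [:x:] * [:?e:]"
      using insert.hyps by simp_all
    then show ?thesis by (simp only: power_mult_distrib left_diff_distrib right_diff_distrib)
  qed
  moreover have "int p dvd coeff ((?X - [:x:]) * ?F) i"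
    unfolding coeff_mult using X insert.prems by (intro dvd_sum dvd_mult2) auto
  moreover have "int p dvd coeff ([:x:] * (?F - [:?e:])) i"
    using insert.IH[OF insert.prems] by simp
  ultimately show ?case by (metis coeff_add dvd_add)
qed

lemma pderiv_sum: "pderiv (\<Sum>x\<in>A. f x) = (\<Sum>x\<in>A. pderiv (f x))"
  by (induction A rule: infinite_finite_induct) (simp_all add: pderiv_add)

text \<open>The blocks X^(jp) (r_j + g s_j), with g = f^((p-1)/2), overlap because g has large
  degree. Still, the first block that does not vanish has only zero coefficients below degree p.
  Multiplying it by the conjugate r_j - g s_j and by f, and using g^2 f = f^p = e modulo X^p, gives
  r_j^2 f = e s_j^2 modulo X^p. By the choice of c both sides have degree below p, so the relation
  is exact, and the descent at a simple root of f applies.\<close>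

lemma stepanov_nonvanishing:
  fixes p :: nat and r s :: "nat \<Rightarrow> int poly"
  assumes p: "prime p" "odd p" and fin: "finite T" and t: "t0 \<in> T"
    and dist: "\<And>x y. x \<in> T \<Longrightarrow> y \<in> T \<Longrightarrow> int p dvd x - y \<Longrightarrow> x = y"
    and nz: "\<And>x. x \<in> T \<Longrightarrow> \<not> int p dvd x"
    and f: "f = (\<Prod>j\<in>T. [:j, 1:])"
    and deg: "\<And>j. j < J \<Longrightarrow> degree (r j) < c" "\<And>j. j < J \<Longrightarrow> degree (s j) < c"
    and c: "2 * c + card T \<le> p + 1"
    and dvd: "[:int p:] dvd f ^ l * (\<Sum>j<J. monom 1 (j * p) * (r j + f ^ ((p - 1) div 2) * s j))"
  shows "j < J \<Longrightarrow> [:int p:] dvd r j \<and> [:int p:] dvd s j"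
proof (induction j rule: less_induct)
  case (less j)
  define q where "q = int p"
  have q: "prime q" using p by (simp add: q_def)
  define g where "g = f ^ ((p - 1) div 2)"
  define P where "P i = r i + g * s i" for i
  have lf: "lead_coeff f = 1" unfolding f by (subst lead_coeff_prod) simp
  then have nf: "\<not> [:q:] dvd f ^ l" using q by (intro const_prime_not_dvd_monic) (auto simp: lead_coeff_power)
  have sum: "[:q:] dvd (\<Sum>i<J. monom 1 (i * p) * P i)"
    using dvd nf const_prime_dvd_mult[OF q] by (auto simp: q_def P_def g_def)
  have Plow: "[:q:] dvd P i" if "i < j" for i
    unfolding P_def q_def using less that by (auto intro!: dvd_add dvd_mult)
  \<comment> \<open>Coefficient j p + k of the sum: earlier blocks vanish by induction and later
    ones start at a higher degree, so coefficient k of \<open>P j\<close> is all that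
    contributes.\<close>
  have low: "q dvd coeff (P j) k" if "k < p" for k
  proof -
    have "q dvd coeff (\<Sum>i<J. monom 1 (i * p) * P i) (j * p + k)"
      using sum by (simp only: const_poly_dvd_iff)
    also have "coeff (\<Sum>i<J. monom 1 (i * p) * P i) (j * p + k)
        = (\<Sum>i<J. coeff (monom 1 (i * p) * P i) (j * p + k))" by (simp add: coeff_sum)
    also have "\<dots> = coeff (monom 1 (j * p) * P j) (j * p + k)
        + (\<Sum>i\<in>{..<J}-{j}. coeff (monom 1 (i * p) * P i) (j * p + k))"
      using less.prems by (subst sum.remove[of _ j]) auto
    finally have *: "q dvd \<dots>" .
    have "q dvd (\<Sum>i\<in>{..<J}-{j}. coeff (monom 1 (i * p) * P i) (j * p + k))"
    proof (rule dvd_sum)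
      fix i assume i: "i \<in> {..<J} - {j}"
      show "q dvd coeff (monom 1 (i * p) * P i) (j * p + k)"
      proof (cases "i < j")
        case True
        then show ?thesis using Plow by (auto simp: coeff_monom_mult const_poly_dvd_iff)
      next
        case False
        then have "Suc j \<le> i" using i by auto
        then have "Suc j * p \<le> i * p" by (rule mult_le_mono1)
        then show ?thesis using that by (simp add: coeff_monom_mult)
      qed
    qed
    then have "q dvd coeff (monom 1 (j * p) * P j) (j * p + k)" using * dvd_add_left_iff by blast
    then show ?thesis by (simp add: coeff_monom_mult)
  qed
  define e where "e = (\<Prod>j\<in>T. j)"
  have ne: "\<not> q dvd e"
    unfolding e_def using nz q fin by (auto simp: prime_dvd_prod_iff q_def)
  define R where "R = (r j)\<^sup>2 * f - smult e ((s j)\<^sup>2)"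
  have gp: "g\<^sup>2 * f = f ^ p"
  proof -
    have "Suc (2 * ((p - 1) div 2)) = p" using p by (auto elim!: oddE)
    then have "f ^ p = f ^ Suc (2 * ((p - 1) div 2))" by (simp only:)
    then show ?thesis unfolding g_def by (simp add: power_mult[symmetric] mult.commute)
  qed
  have "R = P j * ((r j - g * s j) * f) + (s j)\<^sup>2 * (f ^ p - [:e:])"
    unfolding R_def P_def gp[symmetric] by (simp add: power2_eq_square algebra_simps)
  moreover have "q dvd coeff (P j * ((r j - g * s j) * f)) k" if "k < p" for k
    unfolding coeff_mult[of "P j"] using low that by (intro dvd_sum dvd_mult2) auto
  moreover have "q dvd coeff ((s j)\<^sup>2 * (f ^ p - [:e:])) k" if "k < p" for k
    unfolding coeff_mult[of "(s j)\<^sup>2"] f e_def q_def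
    using prod_linear_power_low_coeffs[OF p(1) fin] that by (intro dvd_sum dvd_mult) auto
  ultimately have Rlow: "q dvd coeff R k" if "k < p" for k using that by (metis coeff_add dvd_add)
  have degf: "degree f = card T"
    unfolding f by (subst degree_prod_sum_eq) auto
  have "degree R < p"
  proof -
    have "degree ((r j)\<^sup>2 * f) \<le> degree (r j) + degree (r j) + card T"
      by (metis degf degree_mult_le power2_eq_square add_le_mono1 le_trans)
    moreover have "degree (smult e ((s j)\<^sup>2)) \<le> degree (s j) + degree (s j)"
      by (metis degree_mult_le power2_eq_square degree_smult_le le_trans)
    ultimately show ?thesis
      unfolding R_def using deg[OF less.prems] c
      by (intro le_less_trans[OF degree_diff_le_max]) linarith
  qed
  then have "[:q:] dvd R"
    unfolding const_poly_dvd_iff using Rlow by (metis coeff_eq_0 dvd_0_right not_le order.strict_trans2)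
  define f1 where "f1 = (\<Prod>j\<in>T-{t0}. [:j, 1:])"
  have ff: "f = [:t0, 1:] * f1" unfolding f f1_def using fin t by (simp add: prod.remove)
  have "\<not> q dvd poly f1 (- t0)"
  proof
    assume "q dvd poly f1 (- t0)"
    then obtain x where "x \<in> T - {t0}" "q dvd poly [:x, 1:] (- t0)"
      unfolding f1_def poly_prod using q fin by (auto simp: prime_dvd_prod_iff)
    then show False using dist[of x t0] t by (auto simp: q_def)
  qed
  from square_relation_descent_mod[OF q this ne, of "r j" "s j"] \<open>[:q:] dvd R\<close>
  show ?case unfolding R_def ff q_def by blast
qed

text \<open>The auxiliary polynomial is the product of \<open>f\<^sup>l\<close> and the sum over \<open>j < J\<close> of
  \<open>(r\<^sub>j + s\<^sub>j f\<^sup>(\<^sup>p\<^sup>-\<^sup>1\<^sup>)\<^sup>/\<^sup>2) X\<^sup>j\<^sup>p\<close>. The factor \<open>X\<^sup>j\<^sup>p\<close> is a constant for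
  differentiation modulo \<open>p\<close> and takes the value \<open>x\<^sup>j\<close>, so vanishing to order \<open>l\<close> wherever
  \<open>f\<^sup>(\<^sup>p\<^sup>-\<^sup>1\<^sup>)\<^sup>/\<^sup>2 = a\<close> costs few linear conditions.\<close>

lemma stepanov_count:
  fixes p :: nat
  assumes p: "prime p" "odd p" and fin: "finite T" and ne: "T \<noteq> {}"
    and dist: "\<And>x y. x \<in> T \<Longrightarrow> y \<in> T \<Longrightarrow> int p dvd x - y \<Longrightarrow> x = y"
    and nz: "\<And>x. x \<in> T \<Longrightarrow> \<not> int p dvd x"
    and f: "f = (\<Prod>j\<in>T. [:j, 1:])"
    and c: "c > 0" "2 * c + card T \<le> p + 1"
    and l: "l \<le> p" "l * (c + J + l * card T) < 2 * J * c"
  shows "l * card {x \<in> {0..<int p}. [poly f x ^ ((p - 1) div 2) = a] (mod int p)}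
      \<le> l * card T + card T * ((p - 1) div 2) + c + J * p"
proof -
  define q where "q = int p"
  have q: "prime q" using p by (simp add: q_def)
  define hp where "hp = (p - 1) div 2"
  define t where "t = card T"
  have degf: "degree f = t" unfolding f t_def by (subst degree_prod_sum_eq) auto
  \<comment> \<open>With the exponent l + e hp every derivative of order k < l keeps a factor
    f^(l-k), and f^(e hp) takes the value a^e at the points to be counted.\<close>
  define n where "n e = l + e * hp" for e :: nat
  define C where "C = {..<2::nat} \<times> {..<J} \<times> {..<c}"
  define R where "R = {..<l} \<times> {..<c + J + l * t}"
  \<comment> \<open>Up to the factor f(x)^(l-k), this is what the k-th derivative of a basis term
    becomes at a counted point, where x^(jp) = x^j. Its degree is below c + J + l t, so this is the
    number of linear conditions per order k, against 2 J c unknowns.\<close>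
  define K where "K k = (\<lambda>(e, j, b). [:a ^ e:] * (power_deriv_factor f (n e) k (monom 1 b) * monom 1 j))" for k
  have "card R < card C" using l by (simp add: R_def C_def t_def mult.assoc mult.left_commute)
  then obtain u where u: "\<exists>i\<in>C. \<not> q dvd u i"
    "\<And>k i. k < l \<Longrightarrow> i < c + J + l * t \<Longrightarrow> q dvd (\<Sum>x\<in>C. u x * coeff (K k x) i)"
    using pigeonhole_linear_system_mod[of R C p "\<lambda>(k, i) x. coeff (K k x) i"] prime_gt_1_nat[OF p(1)]
    by (auto simp: R_def C_def q_def)
  define E where "E = (\<lambda>(e, j, b). f ^ n e * monom 1 b * monom 1 (j * p) :: int poly)"
  define \<Phi> where "\<Phi> = (\<Sum>x\<in>C. smult (u x) (E x))"
  have dvd_poly: "q dvd poly Q x" if "[:q:] dvd Q" for Q x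
    using that by (metis dvdE poly_mult poly_pCons poly_0 mult_zero_right add_0_right dvd_triv_left)

  have vanish: "q dvd poly ((pderiv ^^ k) \<Phi>) x"
    if x: "[poly f x ^ hp = a] (mod q)" and k: "k < l" for x k
  proof -
    have E: "[poly ((pderiv ^^ k) (E i)) x = poly f x ^ (l - k) * poly (K k i) x] (mod q)" if "i \<in> C" for i
    proof -
      obtain e j b where i: "i = (e, j, b)" by (cases i)
      let ?W = "power_deriv_factor f (n e) k (monom 1 b)"
      have "pderiv (monom 1 (j * p) :: int poly) = monom (int (j * p)) (j * p - 1)"
        by (simp add: pderiv_monom)
      then have "[:q:] dvd pderiv (monom 1 (j * p) :: int poly)"
        by (simp add: const_poly_dvd_iff q_def)
      from higher_pderiv_mult_mod[OF this, of k "f ^ n e * monom 1 b"]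
      have "q dvd poly ((pderiv ^^ k) (E i) - (pderiv ^^ k) (f ^ n e * monom 1 b) * monom 1 (j * p)) x"
        by (intro dvd_poly) (simp add: E_def i)
      then have "[poly ((pderiv ^^ k) (E i)) x
          = poly ((pderiv ^^ k) (f ^ n e * monom 1 b)) x * x ^ (j * p)] (mod q)"
        by (simp add: cong_iff_dvd_diff poly_monom)
      also have "(pderiv ^^ k) (f ^ n e * monom 1 b) = f ^ (n e - k) * ?W"
        using k by (intro higher_pderiv_power_mult) (simp add: n_def)
      also have "n e - k = (l - k) + hp * e" using k by (simp add: n_def mult.commute)
      also have "poly (f ^ (l - k + hp * e) * ?W) x * x ^ (j * p)
          = (poly f x ^ (l - k) * poly ?W x) * ((poly f x ^ hp) ^ e * (x ^ p) ^ j)"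
        by (simp add: poly_power power_add power_mult mult.commute mult.left_commute mult.assoc)
           (simp add: power_mult[symmetric] mult.commute)
      also have "[\<dots> = (poly f x ^ (l - k) * poly ?W x) * (a ^ e * x ^ j)] (mod q)"
      proof (intro cong_mult cong_pow x cong_refl)
        \<comment> \<open>Fermat's theorem for integers, read off from the constant coefficient for
          a single linear factor.\<close>
        show "[x ^ p = x] (mod q)"
          using prod_linear_power_low_coeffs[OF p(1), of "{x}" 0] prime_gt_0_nat[OF p(1)]
          by (simp add: cong_iff_dvd_diff q_def coeff_0_power)
      qed
      also have "(poly f x ^ (l - k) * poly ?W x) * (a ^ e * x ^ j) = poly f x ^ (l - k) * poly (K k i) x"
        by (simp add: K_def i poly_monom)
      finally show ?thesis .
    qed
    have "(pderiv ^^ k) \<Phi> = (\<Sum>i\<in>C. smult (u i) ((pderiv ^^ k) (E i)))"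
      unfolding \<Phi>_def by (induction k) (auto simp: pderiv_sum pderiv_smult)
    then have "poly ((pderiv ^^ k) \<Phi>) x = (\<Sum>i\<in>C. u i * poly ((pderiv ^^ k) (E i)) x)"
      by (simp add: poly_sum)
    also have "[\<dots> = (\<Sum>i\<in>C. u i * (poly f x ^ (l - k) * poly (K k i) x))] (mod q)"
      by (intro cong_sum cong_mult E cong_refl)
    also have "(\<Sum>i\<in>C. u i * (poly f x ^ (l - k) * poly (K k i) x))
        = poly f x ^ (l - k) * poly (\<Sum>i\<in>C. smult (u i) (K k i)) x"
      by (simp add: poly_sum sum_distrib_left mult.commute mult.left_commute)
    also have "[\<dots> = poly f x ^ (l - k) * 0] (mod q)"
    proof (intro cong_mult cong_refl)
      have "[:q:] dvd (\<Sum>i\<in>C. smult (u i) (K k i))"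
        unfolding const_poly_dvd_iff
      proof
        fix m
        show "q dvd coeff (\<Sum>i\<in>C. smult (u i) (K k i)) m"
        proof (cases "m < c + J + l * t")
          case True
          then show ?thesis using u(2)[OF k True] by (simp add: coeff_sum)
        next
          case False
          have "coeff (K k i) m = 0" if "i \<in> C" for i
          proof (rule coeff_eq_0)
            obtain e j b where i: "i = (e, j, b)" by (cases i)
            with that have b: "b < c" "j < J" by (auto simp: C_def)
            let ?W = "power_deriv_factor f (n e) k (monom 1 b)"
            have "degree ?W \<le> b + k * t"
              using degree_power_deriv_factor[of f "n e" k "monom 1 b"] degf by (simp add: degree_monom_eq)
            moreover have "degree (?W * monom 1 j) \<le> degree ?W + j"
              by (metis degree_mult_le degree_monom_le add_left_mono le_trans)
            moreover have "degree (K k i) \<le> degree (?W * monom 1 j)"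
              using degree_mult_le[of "[:a ^ e:]" "?W * monom 1 j"] by (simp add: K_def i)
            moreover have "k * t \<le> l * t" using k by simp
            ultimately show "degree (K k i) < m" using b False by linarith
          qed
          then show ?thesis by (simp add: coeff_sum)
        qed
      qed
      then show "[poly (\<Sum>i\<in>C. smult (u i) (K k i)) x = 0] (mod q)"
        using dvd_poly by (simp add: cong_0_iff)
    qed
    finally show ?thesis by (simp add: cong_0_iff)
  qed

  define r where "r j = (\<Sum>b<c. monom (u (0, j, b)) b)" for j
  define s where "s j = (\<Sum>b<c. monom (u (1, j, b)) b)" for j
  have sumC: "(\<Sum>x\<in>C. F x) = (\<Sum>j<J. (\<Sum>b<c. F (0, j, b)) + (\<Sum>b<c. F (1, j, b)))" for F :: "nat \<times> nat \<times> nat \<Rightarrow> int poly"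
  proof -
    have "(\<Sum>x\<in>C. F x) = (\<Sum>e<2. \<Sum>j<J. \<Sum>b<c. F (e, j, b))"
      unfolding C_def by (simp add: sum.cartesian_product)
    also have "{..<2::nat} = {0, 1}" by auto
    finally show ?thesis by (simp add: sum.distrib)
  qed
  have \<Phi>: "\<Phi> = f ^ l * (\<Sum>j<J. monom 1 (j * p) * (r j + f ^ hp * s j))"
    unfolding \<Phi>_def sumC sum_distrib_left
  proof (rule sum.cong[OF refl])
    fix j
    have "(\<Sum>b<c. smult (u (e, j, b)) (E (e, j, b)))
        = f ^ l * (monom 1 (j * p) * (f ^ (e * hp) * (\<Sum>b<c. monom (u (e, j, b)) b)))" for e
      unfolding sum_distrib_left
    proof (rule sum.cong[OF refl])
      fix b
      have "monom (u (e, j, b)) b = [:u (e, j, b):] * monom 1 b" by (simp add: smult_monom)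
      then show "smult (u (e, j, b)) (E (e, j, b))
        = f ^ l * (monom 1 (j * p) * (f ^ (e * hp) * monom (u (e, j, b)) b))"
        by (simp add: E_def n_def power_add mult.commute mult.left_commute mult.assoc)
    qed
    from this[of 0] this[of 1]
    show "(\<Sum>b<c. smult (u (0, j, b)) (E (0, j, b))) + (\<Sum>b<c. smult (u (1, j, b)) (E (1, j, b)))
      = f ^ l * (monom 1 (j * p) * (r j + f ^ hp * s j))"
      by (simp add: r_def s_def distrib_left)
  qed
  have coeff_rs: "coeff (\<Sum>b<c. monom (v b) b) i = (if i < c then v i else 0)" for v :: "nat \<Rightarrow> int" and i
    by (simp add: coeff_sum if_distrib[of "\<lambda>x. x = _"] cong: if_cong)
  have degrs: "degree (\<Sum>b<c. monom (v b) b) < c" for v :: "nat \<Rightarrow> int"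
    using c(1) by (intro degree_lessI) (auto simp: coeff_rs simp del: coeff_sum)
  have nPhi: "\<not> [:q:] dvd \<Phi>"
  proof
    assume dv: "[:q:] dvd \<Phi>"
    obtain t0 where t0: "t0 \<in> T" using ne by auto
    have "[:q:] dvd r j \<and> [:q:] dvd s j" if "j < J" for j
      unfolding q_def
    proof (rule stepanov_nonvanishing[OF p fin t0 dist nz f _ _ c(2) _ that])
      show "[:int p:] dvd f ^ l * (\<Sum>j<J. monom 1 (j * p) * (r j + f ^ ((p - 1) div 2) * s j))"
        using dv unfolding \<Phi> q_def hp_def .
    qed (auto simp: r_def s_def degrs)
    then have rs: "q dvd coeff (r j) b" "q dvd coeff (s j) b" if "j < J" for j b
      using that by (auto simp only: const_poly_dvd_iff)
    obtain e j b where i: "(e, j, b) \<in> C" "\<not> q dvd u (e, j, b)" using u(1) by auto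
    have "q dvd u (0, j, b)" "q dvd u (1, j, b)"
      using rs[of j b] i by (auto simp: r_def s_def coeff_rs C_def simp del: coeff_sum)
    moreover have "e = 0 \<or> e = 1" using i by (auto simp: C_def)
    ultimately show False using i by auto
  qed
  have degPhi: "degree \<Phi> \<le> l * t + t * hp + c + J * p"
    unfolding \<Phi>_def
  proof (rule degree_sum_le)
    show "finite C" by (simp add: C_def)
    fix x assume "x \<in> C"
    obtain e j b where x: "x = (e, j, b)" by (cases x)
    with \<open>x \<in> C\<close> have b: "b < c" "j < J" "e \<le> 1" by (auto simp: C_def)
    have "degree (f ^ n e) \<le> t * n e" by (metis degree_power_le degf)
    moreover have "t * n e \<le> t * (l + 1 * hp)" unfolding n_def using b by (intro mult_le_mono2 add_left_mono mult_le_mono1)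
    moreover have "degree (E x) \<le> degree (f ^ n e) + b + j * p"
      unfolding E_def x prod.case
      by (intro order.trans[OF degree_mult_le] add_mono degree_monom_le order.refl)
    moreover have "j * p \<le> J * p" using b by simp
    moreover have "t * (l + 1 * hp) = l * t + t * hp" by (simp add: algebra_simps)
    ultimately have "degree (E x) \<le> l * t + t * hp + c + J * p" using b by linarith
    then show "degree (smult (u x) (E x)) \<le> l * t + t * hp + c + J * p"
      using degree_smult_le le_trans by blast
  qed
  let ?S = "{x \<in> {0..<q}. [poly f x ^ hp = a] (mod q)}"
  have "finite ?S" by (rule finite_subset[of _ "{0..<q}"]) auto
  then have "(\<Sum>x\<in>?S. l) \<le> degree \<Phi>"
    by (rule root_multiplicity_bound_mod[OF q _]) (use l vanish nPhi in \<open>auto simp: q_def\<close>)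
  then show ?thesis using degPhi by (simp add: q_def hp_def t_def mult.commute)
qed


section \<open>Legendre symbols and complete sums of their products\<close>

lemma abs_Legendre_le_1: "\<bar>Legendre a p\<bar> \<le> 1"
  by (simp add: Legendre_def)

lemma Legendre_cong:
  assumes "[a = b] (mod p)"
  shows "Legendre a p = Legendre b p"
proof -
  have "QuadRes p a = QuadRes p b" unfolding QuadRes_def using assms by (meson cong_sym cong_trans)
  moreover have "[a = 0] (mod p) = [b = 0] (mod p)" using assms by (meson cong_sym cong_trans)
  ultimately show ?thesis by (simp add: Legendre_def)
qed

lemma small_cong_imp_eq:
  assumes "[a = b] (mod int p)" "\<bar>a\<bar> \<le> 1" "\<bar>b\<bar> \<le> 1" "p > 2"
  shows "a = b"
proof (rule ccontr)
  assume "a \<noteq> b"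
  moreover have "int p dvd a - b" using assms by (simp add: cong_iff_dvd_diff)
  ultimately have "int p \<le> \<bar>a - b\<bar>" using zdvd_imp_le[of "int p" "\<bar>a - b\<bar>"] by simp
  then show False using assms by linarith
qed

lemma Legendre_mult:
  assumes "prime p" "p > 2"
  shows "Legendre (a * b) (int p) = Legendre a (int p) * Legendre b (int p)"
proof (rule small_cong_imp_eq[OF _ abs_Legendre_le_1 _ assms(2)])
  have "[Legendre (a * b) (int p) = (a * b) ^ ((p - 1) div 2)] (mod int p)"
    by (rule euler_criterion[OF assms])
  also have "(a * b) ^ ((p - 1) div 2) = a ^ ((p - 1) div 2) * b ^ ((p - 1) div 2)"
    by (rule power_mult_distrib)
  also have "[\<dots> = Legendre a (int p) * Legendre b (int p)] (mod int p)"
    by (intro cong_mult cong_sym[OF euler_criterion[OF assms]])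
  finally show "[Legendre (a * b) (int p) = Legendre a (int p) * Legendre b (int p)] (mod int p)" .
  show "\<bar>Legendre a (int p) * Legendre b (int p)\<bar> \<le> 1"
    using abs_Legendre_le_1 by (simp add: abs_mult mult_le_one)
qed

lemma Legendre_1: "p > 1 \<Longrightarrow> Legendre 1 (int p) = 1"
  by (auto simp: Legendre_def QuadRes_def cong_0_iff intro!: exI[of _ 1])

lemma Legendre_prod:
  assumes "prime p" "p > 2"
  shows "Legendre (\<Prod>j\<in>T. g j) (int p) = (\<Prod>j\<in>T. Legendre (g j) (int p))"
  using assms by (induction T rule: infinite_finite_induct) (simp_all add: Legendre_mult Legendre_1)

lemma sum_periodic_shift:
  fixes G :: "int \<Rightarrow> 'a::comm_monoid_add"
  assumes "n > 0" "\<And>x. G (x mod n) = G x"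
  shows "(\<Sum>x\<in>{0..<n}. G (x + e)) = (\<Sum>x\<in>{0..<n}. G x)"
proof (rule sum.reindex_bij_witness[of _ "\<lambda>x. (x - e) mod n" "\<lambda>x. (x + e) mod n"])
  fix x assume "x \<in> {0..<n}"
  then show "((x + e) mod n - e) mod n = x" "((x - e) mod n + e) mod n = x"
    by (simp_all add: mod_diff_left_eq mod_add_left_eq)
qed (use assms in auto)

text \<open>Stepanov's method only bounds from above how often the product equals 1, and likewise
  -1. As the two counts add up to p minus at most t zeros, each upper bound is also a lower bound
  for the other count. If t sqrt(p) is comparable with p, the trivial bound is enough.\<close>

lemma weil_bound_nonzero:
  fixes p :: nat
  assumes p: "prime p" "p > 2" and fin: "finite T" and ne: "T \<noteq> {}"
    and dist: "\<And>x y. x \<in> T \<Longrightarrow> y \<in> T \<Longrightarrow> int p dvd x - y \<Longrightarrow> x = y"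
    and nz: "\<And>x. x \<in> T \<Longrightarrow> \<not> int p dvd x"
  shows "\<bar>real_of_int (\<Sum>x\<in>{0..<int p}. \<Prod>j\<in>T. Legendre (x + j) (int p))\<bar>
      \<le> 17 * real (card T) * sqrt (real p)"
proof -
  define t where "t = card T"
  have t: "t \<ge> 1" using fin ne by (simp add: t_def Suc_le_eq card_gt_0_iff)
  define L where "L x = (\<Prod>j\<in>T. Legendre (x + j) (int p))" for x
  have absL: "\<bar>L x\<bar> \<le> 1" for x
    unfolding L_def abs_prod by (intro prod_le_1) (auto simp: abs_Legendre_le_1)
  show ?thesis
  proof (cases "17 * real t * sqrt p \<ge> p")
    case True
    have "\<bar>\<Sum>x\<in>{0..<int p}. L x\<bar> \<le> (\<Sum>x\<in>{0..<int p}. \<bar>L x\<bar>)" by (rule sum_abs)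
    also have "\<dots> \<le> (\<Sum>x\<in>{0..<int p}. 1)" using absL by (intro sum_mono)
    also have "\<dots> = int p" by simp
    finally have "\<bar>real_of_int (\<Sum>x\<in>{0..<int p}. L x)\<bar> \<le> real p" by linarith
    then show ?thesis using True by (simp add: L_def t_def)
  next
    case False
    define s where "s = sqrt (real p)"
    have s2: "s * s = real p" by (simp add: s_def)
    have s0: "s > 0" using p by (simp add: s_def)
    have "17 * real t * s < s * s" using False s2 by (simp add: s_def)
    then have ts: "17 * real t < s" using s0 by simp
    then have s17: "s > 17" using t by simp
    define f where "f = (\<Prod>j\<in>T. [:j, 1:])"
    have Lf: "L x = Legendre (poly f x) (int p)" for x
      unfolding L_def f_def poly_prod using p by (subst Legendre_prod) (auto simp: add.commute)
    define g where "g = nat \<lfloor>s / 2\<rfloor>"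
    have g: "real g \<le> s / 2" "s / 2 < real g + 1" using s0 by (simp_all add: g_def) linarith+
    have t_le: "real t \<le> s / 17" using ts by simp
    have sp: "17 * s \<le> real p" using s17 s2 s0 by (metis mult_right_mono less_imp_le)
    have tp: "t \<le> p" using t_le sp s0 by linarith
    \<comment> \<open>The largest value compatible with the degree condition 2c + t <= p + 1 of the
      nonvanishing argument.\<close>
    define c where "c = (p + 1 - t) div 2"
    have c: "2 * c + t \<le> p + 1" "2 * c + t \<ge> p" using tp by (auto simp: c_def)
    have cr: "2 * real c \<ge> real p - real t" "2 * real c \<le> real p + 1"
      using c by linarith+
    have odd: "odd p" using p prime_odd_nat by simp
    have gg: "2 * (real g * real g) \<le> real p / 2"
      using mult_mono[OF g(1) g(1)] s0 s2 by simp
    have E: "real (card {x \<in> {0..<int p}. [poly f x ^ ((p - 1) div 2) = a] (mod int p)})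
        \<le> real p / 2 + real t + 6 * real t * s" for a
    proof -
      let ?N = "card {x \<in> {0..<int p}. [poly f x ^ ((p - 1) div 2) = a] (mod int p)}"
      \<comment> \<open>The parameters are l = 2g, about sqrt(p), and J = g + 2t + 1. The leading
        term J p / l of the count is then p/2 plus a multiple of t sqrt(p), and in the dimension
        condition l (c + J + l t) < 2 J c the common factor 2t + 1 cancels and leaves g^2 + g <
        c.\<close>
      have "2 * g * ?N \<le> 2 * g * t + t * ((p - 1) div 2) + c + (g + 2 * t + 1) * p"
        unfolding t_def
      proof (rule stepanov_count[OF p(1) odd fin ne dist nz f_def])
        show "c > 0" using cr t_le sp s17 by linarith
        show "2 * c + card T \<le> p + 1" using c by (simp add: t_def)
        have "2 * real g \<le> real p" using g sp s0 by linarith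
        then show "2 * g \<le> p" by linarith
        have "2 * (real g * real g) + 2 * real g < 2 * real c"
          using gg g cr t_le sp s17 by linarith
        then have "(2 * real t + 1) * (2 * (real g * real g) + 2 * real g) < (2 * real t + 1) * (2 * real c)"
          by (intro mult_strict_left_mono) auto
        then have "real (2 * g * (c + (g + 2 * t + 1) + 2 * g * t)) < real (2 * (g + 2 * t + 1) * c)"
          by (simp add: algebra_simps)
        then show "2 * g * (c + (g + 2 * card T + 1) + 2 * g * card T) < 2 * (g + 2 * card T + 1) * c"
          unfolding t_def[symmetric] by linarith
      qed
      then have "real (2 * g * ?N) \<le> real (2 * g * t + t * ((p - 1) div 2) + c + (g + 2 * t + 1) * p)"
        by (simp only: of_nat_le_iff)
      also have "\<dots> \<le> 2 * real g * real t + real t * (real p / 2) + real p + (real g + 2 * real t + 1) * real p"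
      proof -
        have "real ((p - 1) div 2) \<le> real p / 2" by linarith
        then have "real t * real ((p - 1) div 2) \<le> real t * (real p / 2)" by (intro mult_left_mono) auto
        moreover have "real c \<le> real p" using cr p by linarith
        ultimately show ?thesis
          by (simp only: of_nat_add of_nat_mult of_nat_numeral of_nat_1 distrib_right)
      qed
      also have "\<dots> \<le> 2 * real g * (real p / 2 + real t) + 9 / 2 * (real t * real p)"
      proof -
        have "real p * 1 \<le> real p * real t" using t by (intro mult_left_mono) auto
        then show ?thesis by (simp add: algebra_simps)
      qed
      also have "9 / 2 * (real t * real p) \<le> 2 * real g * (6 * real t * s)"
      proof -
        have "3 / 4 * s \<le> 2 * real g" using g s17 by linarith
        then have "3 / 4 * s * (6 * real t * s) \<le> 2 * real g * (6 * real t * s)"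
          using s0 by (intro mult_right_mono) auto
        moreover have "3 / 4 * s * (6 * real t * s) = 9 / 2 * (real t * (s * s))" by simp
        ultimately show ?thesis by (simp only: s2)
      qed
      finally have "2 * real g * real ?N \<le> 2 * real g * (real p / 2 + real t + 6 * real t * s)"
        by (simp add: distrib_left)
      moreover have "2 * real g > 0" using g s17 by linarith
      ultimately show ?thesis by (simp only: mult_le_cancel_left_pos)
    qed
    define N where "N a = card {x \<in> {0..<int p}. L x = a}" for a
    have NE: "real (N a) \<le> real p / 2 + real t + 6 * real t * s" for a
    proof -
      have "N a \<le> card {x \<in> {0..<int p}. [poly f x ^ ((p - 1) div 2) = a] (mod int p)}"
        unfolding N_def using euler_criterion[OF p] 
        by (intro card_mono[OF finite_subset[of _ "{0..<int p}"]]) (auto simp: Lf cong_sym_eq)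
      then show ?thesis using E[of a] by linarith
    qed
    have N0: "N 0 \<le> t"
    proof -
      have "{x \<in> {0..<int p}. L x = 0} \<subseteq> (\<lambda>j. (- j) mod int p) ` T"
      proof
        fix x assume x: "x \<in> {x \<in> {0..<int p}. L x = 0}"
        then obtain j where j: "j \<in> T" "Legendre (x + j) (int p) = 0" using fin by (auto simp: L_def)
        then have "[x + j = 0] (mod int p)" by (auto simp: Legendre_def split: if_splits)
        then have "[x = - j] (mod int p)" by (simp add: cong_iff_dvd_diff)
        then have "x = (- j) mod int p" using x by (simp add: cong_def)
        then show "x \<in> (\<lambda>j. (- j) mod int p) ` T" using j by auto
      qed
      then have "N 0 \<le> card ((\<lambda>j. (- j) mod int p) ` T)" unfolding N_def using fin by (intro card_mono) auto
      then show ?thesis using card_image_le[OF fin] unfolding t_def by (rule order.trans)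
    qed
    have vals: "L x = 1 \<or> L x = -1 \<or> L x = 0" for x using absL[of x] by linarith
    have "(\<Sum>x\<in>{0..<int p}. L x) = (\<Sum>x\<in>{0..<int p}. of_bool (L x = 1) - of_bool (L x = -1))"
      (is "_ = (\<Sum>x\<in>_. ?F x)")
    proof (intro sum.cong refl)
      show "L x = ?F x" for x using vals[of x] by (elim disjE) simp_all
    qed
    also have "\<dots> = int (N 1) - int (N (-1))"
      by (simp add: sum_subtractf N_def Int_def)
    finally have S: "(\<Sum>x\<in>{0..<int p}. L x) = int (N 1) - int (N (-1))" .
    have "int p = (\<Sum>x\<in>{0..<int p}. 1)" by simp
    also have "\<dots> = (\<Sum>x\<in>{0..<int p}. of_bool (L x = 1) + of_bool (L x = -1) + of_bool (L x = 0))"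
      (is "_ = (\<Sum>x\<in>_. ?F x)")
    proof (intro sum.cong refl)
      show "1 = ?F x" for x using vals[of x] by (elim disjE) simp_all
    qed
    also have "\<dots> = int (N 1) + int (N (-1)) + int (N 0)"
      by (simp add: sum.distrib N_def Int_def)
    finally have "real p = real (N 1) + real (N (-1)) + real (N 0)" by linarith
    moreover have "\<bar>a - b\<bar> \<le> 2 * (y + z) + y"
      if "p = a + b + c" "a \<le> p / 2 + y + z" "b \<le> p / 2 + y + z" "c \<le> y" for a b c p y z :: real
      unfolding abs_le_iff using that by (auto simp: field_simps)
    ultimately have "\<bar>real (N 1) - real (N (-1))\<bar> \<le> 2 * (real t + 6 * real t * s) + real t"
      using NE[of 1] NE[of "-1"] of_nat_mono[OF N0, where 'a = real] by blast
    also have "\<dots> = 3 * real t + 12 * (real t * s)" by simp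
    also have "\<dots> \<le> 17 * (real t * s)"
      using mult_left_mono[of 1 s "real t"] s17 by linarith
    finally show ?thesis using S by (simp add: L_def t_def s_def)
  qed
qed

text \<open>A translation of the variable moves every shift away from 0 modulo p. A suitable
  translation exists as long as there are fewer than p shifts; otherwise the trivial bound p
  suffices.\<close>

lemma weil_bound:
  fixes p :: nat
  assumes p: "prime p" "p > 2" and fin: "finite T" and ne: "T \<noteq> {}"
    and dist: "\<And>x y. x \<in> T \<Longrightarrow> y \<in> T \<Longrightarrow> int p dvd x - y \<Longrightarrow> x = y"
  shows "\<bar>real_of_int (\<Sum>x\<in>{0..<int p}. \<Prod>j\<in>T. Legendre (x + j) (int p))\<bar>
      \<le> 17 * real (card T) * sqrt (real p)"
proof (cases "card T < p")
  case True
  define G where "G x = (\<Prod>j\<in>T. Legendre (x + j) (int p))" for x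
  have per: "G (x mod int p) = G x" for x
    unfolding G_def by (intro prod.cong refl Legendre_cong) (simp add: cong_def mod_add_left_eq)
  obtain e where e: "\<And>j. j \<in> T \<Longrightarrow> \<not> int p dvd j + e"
  proof -
    have "\<not> {0..<int p} \<subseteq> (\<lambda>j. (- j) mod int p) ` T"
    proof
      assume "{0..<int p} \<subseteq> (\<lambda>j. (- j) mod int p) ` T"
      then have "card {0..<int p} \<le> card ((\<lambda>j. (- j) mod int p) ` T)" using fin by (intro card_mono) auto
      then show False using card_image_le[OF fin, of "\<lambda>j. (- j) mod int p"] True by simp
    qed
    then obtain e where e: "e \<in> {0..<int p}" "\<And>j. j \<in> T \<Longrightarrow> e \<noteq> (- j) mod int p" by blast
    have "\<not> int p dvd j + e" if "j \<in> T" for j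
    proof
      assume "int p dvd j + e"
      then have "e mod int p = (- j) mod int p" by (simp add: mod_eq_dvd_iff add.commute)
      then show False using e(1) e(2)[OF that] by simp
    qed
    then show ?thesis using that by blast
  qed
  have inj: "inj_on (\<lambda>j. j + e) T" by (rule inj_onI) simp
  have "\<bar>real_of_int (\<Sum>x\<in>{0..<int p}. \<Prod>j\<in>(\<lambda>j. j + e) ` T. Legendre (x + j) (int p))\<bar>
      \<le> 17 * real (card ((\<lambda>j. j + e) ` T)) * sqrt (real p)"
    by (rule weil_bound_nonzero[OF p]) (use fin ne dist e in auto)
  also have "(\<Sum>x\<in>{0..<int p}. \<Prod>j\<in>(\<lambda>j. j + e) ` T. Legendre (x + j) (int p)) = (\<Sum>x\<in>{0..<int p}. G (x + e))"
    unfolding G_def by (intro sum.cong refl) (subst prod.reindex[OF inj], simp add: algebra_simps)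
  also have "\<dots> = (\<Sum>x\<in>{0..<int p}. G x)"
    by (rule sum_periodic_shift) (use p per in auto)
  finally show ?thesis by (simp add: G_def card_image[OF inj])
next
  case False
  define G where "G x = (\<Prod>j\<in>T. Legendre (x + j) (int p))" for x
  have "\<bar>\<Sum>x\<in>{0..<int p}. G x\<bar> \<le> (\<Sum>x\<in>{0..<int p}. \<bar>G x\<bar>)" by (rule sum_abs)
  also have "\<dots> \<le> (\<Sum>x\<in>{0..<int p}. 1)"
    unfolding G_def abs_prod by (intro sum_mono prod_le_1) (auto simp: abs_Legendre_le_1)
  finally have "\<bar>\<Sum>x\<in>{0..<int p}. G x\<bar> \<le> int p" by simp
  then have "\<bar>real_of_int (\<Sum>x\<in>{0..<int p}. G x)\<bar> \<le> real p * 1" by linarith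
  also have "\<dots> \<le> real (card T) * sqrt (real p)"
    using False p by (intro mult_mono) auto
  also have "\<dots> \<le> 17 * real (card T) * sqrt (real p)" by simp
  finally show ?thesis by (simp add: G_def)
qed

section \<open>Chinese remaindering and blocked residues\<close>

lemma crt_sum:
  fixes a b :: int
  assumes "coprime a b" "a > 0" "b > 0"
  shows "(\<Sum>x\<in>{0..<a*b}. F (x mod a) (x mod b)) = (\<Sum>y\<in>{0..<a}. \<Sum>z\<in>{0..<b}. F y z)"
proof -
  let ?h = "\<lambda>x. (x mod a, x mod b)"
  have inj: "inj_on ?h {0..<a*b}"
  proof (rule inj_onI)
    fix x y assume xy: "x \<in> {0..<a*b}" "y \<in> {0..<a*b}" "?h x = ?h y"
    then have "[x = y] (mod a)" "[x = y] (mod b)" by (simp_all add: cong_def)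
    then have "[x = y] (mod a * b)" using assms by (metis coprime_cong_mult)
    then show "x = y" using xy by (simp add: cong_def)
  qed
  have sub: "?h ` {0..<a*b} \<subseteq> {0..<a} \<times> {0..<b}" using assms by auto
  have "card (?h ` {0..<a*b}) = card ({0..<a} \<times> {0..<b})"
    using assms by (simp add: card_image[OF inj] nat_mult_distrib)
  then have "?h ` {0..<a*b} = {0..<a} \<times> {0..<b}" using sub by (intro card_subset_eq) auto
  then have bij: "bij_betw ?h {0..<a*b} ({0..<a} \<times> {0..<b})" using inj by (simp add: bij_betw_def)
  have "(\<Sum>y\<in>{0..<a}. \<Sum>z\<in>{0..<b}. F y z) = (\<Sum>p\<in>{0..<a} \<times> {0..<b}. F (fst p) (snd p))"
    by (simp add: sum.cartesian_product split_def)
  also have "\<dots> = (\<Sum>x\<in>{0..<a*b}. F (fst (?h x)) (snd (?h x)))"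
    by (rule sum.reindex_bij_betw[OF bij, symmetric])
  finally show ?thesis by simp
qed

lemma coprime_prod_primes:
  fixes P :: "nat set"
  assumes "finite P" "\<And>q. q \<in> P \<Longrightarrow> prime q" "prime p" "p \<notin> P"
  shows "coprime (int p) (int (\<Prod>P))"
proof -
  have "coprime p (\<Prod>q\<in>P. q)"
    using assms by (intro prod_coprime_right) (metis primes_coprime)
  then show ?thesis by (simp only: coprime_int_iff)
qed

lemma prod_primes_pos:
  fixes P :: "nat set"
  assumes "\<And>q. q \<in> P \<Longrightarrow> prime q"
  shows "\<Prod>P > 0"
  using assms by (intro prod_pos) (auto intro: prime_gt_0_nat)

lemma crt_prod:
  fixes P :: "nat set" and f :: "nat \<Rightarrow> int \<Rightarrow> 'a::comm_semiring_1"
  assumes "finite P" "\<And>q. q \<in> P \<Longrightarrow> prime q"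
  shows "(\<Sum>x\<in>{0..<int (\<Prod>P)}. \<Prod>p\<in>P. f p (x mod int p)) = (\<Prod>p\<in>P. \<Sum>y\<in>{0..<int p}. f p y)"
  using assms
proof (induction P rule: finite_induct)
  case (insert p P)
  define Q where "Q = int (\<Prod>P)"
  have cop: "coprime (int p) Q" unfolding Q_def using insert by (intro coprime_prod_primes) auto
  have pos: "int p > 0" "Q > 0"
    using insert.prems[of p] prod_primes_pos[of P] insert.prems by (auto simp: Q_def prime_gt_0_nat simp del: of_nat_prod)
  have "(\<Sum>x\<in>{0..<int (\<Prod>(insert p P))}. \<Prod>q\<in>insert p P. f q (x mod int q))
      = (\<Sum>x\<in>{0..<int p * Q}. f p (x mod int p) * (\<Prod>q\<in>P. f q (x mod Q mod int q)))"
  proof (rule sum.cong)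
    show "{0..<int (\<Prod>(insert p P))} = {0..<int p * Q}" using insert.hyps by (simp add: Q_def)
    fix x
    have "x mod Q mod int q = x mod int q" if "q \<in> P" for q
      using insert.hyps that by (intro mod_mod_cancel) (auto simp: Q_def int_dvd_int_iff dvd_prod_eqI simp del: of_nat_prod)
    then show "(\<Prod>q\<in>insert p P. f q (x mod int q)) = f p (x mod int p) * (\<Prod>q\<in>P. f q (x mod Q mod int q))"
      using insert.hyps by simp
  qed
  also have "\<dots> = (\<Sum>y\<in>{0..<int p}. \<Sum>z\<in>{0..<Q}. f p y * (\<Prod>q\<in>P. f q (z mod int q)))"
    by (rule crt_sum[OF cop pos])
  also have "\<dots> = (\<Sum>y\<in>{0..<int p}. f p y) * (\<Sum>z\<in>{0..<Q}. \<Prod>q\<in>P. f q (z mod int q))"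
    by (simp add: sum_product)
  also have "\<dots> = (\<Prod>p\<in>insert p P. \<Sum>y\<in>{0..<int p}. f p y)"
    using insert by (simp add: Q_def)
  finally show ?case .
qed simp

lemma QuadRes_cong:
  assumes "[a = b] (mod n)"
  shows "QuadRes n a \<longleftrightarrow> QuadRes n b"
  unfolding QuadRes_def using assms by (meson cong_sym cong_trans)

text \<open>The condition is stated prime by prime, instead of modulo the product, so that a single
  prime can be split off.\<close>

definition blocked :: "nat set \<Rightarrow> int set \<Rightarrow> int set" where
  "blocked P J = {x \<in> {0..<int (\<Prod>P)}. \<forall>j\<in>J. \<exists>p\<in>P. \<not> QuadRes (int p) (x + j)}"

lemma card_eq_sum_of_bool:
  assumes "finite A"
  shows "card {x \<in> A. Q x} = (\<Sum>x\<in>A. of_bool (Q x))"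
  using assms by (simp add: Int_def)

text \<open>Once y, the class of x modulo A, is fixed, only those shifts j for which y + j is a
  residue modulo A remain to be blocked by the primes of P. This is used both with a prime of m as
  A, in the sieve, and with the small modulus A itself.\<close>

lemma card_blocked_crt:
  fixes A :: nat
  assumes "finite P" "\<And>q. q \<in> P \<Longrightarrow> prime q" "coprime A (\<Prod>P)" "A > 0"
  shows "card {x \<in> {0..<int (A * \<Prod>P)}. \<forall>j\<in>J. \<not> (QuadRes (int A) (x + j) \<and> (\<forall>p\<in>P. QuadRes (int p) (x + j)))}
       = (\<Sum>y\<in>{0..<int A}. card (blocked P {j \<in> J. QuadRes (int A) (y + j)}))"
proof -
  define Q where "Q = int (\<Prod>P)"
  have cop: "coprime (int A) Q" using assms by (simp add: Q_def del: of_nat_prod)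
  have pos: "int A > 0" "Q > 0" using assms prod_primes_pos[of P] by (auto simp: Q_def simp del: of_nat_prod)
  define F where "F y z = (of_bool (\<forall>j\<in>J. \<not> (QuadRes (int A) (y + j) \<and> (\<forall>p\<in>P. QuadRes (int p) (z + j)))) :: nat)" for y z
  have "card {x \<in> {0..<int (A * \<Prod>P)}. \<forall>j\<in>J. \<not> (QuadRes (int A) (x + j) \<and> (\<forall>p\<in>P. QuadRes (int p) (x + j)))}
      = (\<Sum>x\<in>{0..<int A * Q}. F x x)"
    by (subst card_eq_sum_of_bool) (auto simp: Q_def F_def)
  also have "\<dots> = (\<Sum>x\<in>{0..<int A * Q}. F (x mod int A) (x mod Q))"
  proof (rule sum.cong[OF refl])
    fix x
    have "QuadRes (int A) (x mod int A + j) = QuadRes (int A) (x + j)" for j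
      by (rule QuadRes_cong) (simp add: cong_def mod_add_left_eq)
    moreover have "QuadRes (int p) (x mod Q + j) = QuadRes (int p) (x + j)" if "p \<in> P" for p j
    proof (rule QuadRes_cong)
      have "int p dvd Q" using assms(1) that by (auto simp: Q_def int_dvd_int_iff dvd_prod_eqI simp del: of_nat_prod)
      then have "[x mod Q = x] (mod int p)" by (simp add: cong_def mod_mod_cancel)
      then show "[x mod Q + j = x + j] (mod int p)" by (intro cong_add cong_refl)
    qed
    ultimately show "F x x = F (x mod int A) (x mod Q)" by (simp add: F_def)
  qed
  also have "\<dots> = (\<Sum>y\<in>{0..<int A}. \<Sum>z\<in>{0..<Q}. F y z)"
    by (rule crt_sum[OF cop pos])
  also have "\<dots> = (\<Sum>y\<in>{0..<int A}. card (blocked P {j \<in> J. QuadRes (int A) (y + j)}))"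
  proof (rule sum.cong[OF refl])
    fix y
    show "(\<Sum>z\<in>{0..<Q}. F y z) = card (blocked P {j \<in> J. QuadRes (int A) (y + j)})"
      unfolding blocked_def Q_def F_def
      by (subst card_eq_sum_of_bool[symmetric]) (auto intro!: arg_cong[where f = card])
  qed
  finally show ?thesis .
qed

text \<open>If each shift survived independently with probability 1/2, the average of
  (1-q)^survivors would be (1 - q/2)^|J|. Away from the zeros of the symbols, the factor of one
  shift is a + b chi with a = 1 - q/2 and b = -q/2; expanding the product leaves complete character
  sums with coefficients of total absolute value at most 1. In 18 = 17 + 1 the 17 comes from these
  sums and the 1 from the zeros.\<close>

lemma one_prime_average:
  fixes p :: nat and q :: real
  assumes p: "prime p" "p > 2" and fin: "finite J"
    and dist: "\<And>x y. x \<in> J \<Longrightarrow> y \<in> J \<Longrightarrow> int p dvd x - y \<Longrightarrow> x = y"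
    and q: "0 \<le> q" "q \<le> 1"
  shows "\<bar>(\<Sum>u\<in>{0..<int p}. (1 - q) ^ card {j \<in> J. QuadRes (int p) (u + j)}) - real p * (1 - q/2) ^ card J\<bar>
      \<le> 18 * real (card J) * sqrt (real p)"
proof -
  define \<chi> where "\<chi> u = real_of_int (Legendre u (int p))" for u
  define a where "a = 1 - q / 2"
  define b where "b = - (q / 2)"
  define F where "F u = (\<Prod>j\<in>J. 1 - q * of_bool (QuadRes (int p) (u + j)))" for u
  define G where "G u = (\<Prod>j\<in>J. b * \<chi> (u + j) + a)" for u
  \<comment> \<open>At these u some u + j is divisible by p: it counts as a residue, but its
    Legendre symbol is 0, so the linear expression for the indicator fails.\<close>
  define Z where "Z = {u \<in> {0..<int p}. \<exists>j\<in>J. int p dvd u + j}"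
  have F: "(1 - q) ^ card {j \<in> J. QuadRes (int p) (u + j)} = F u" for u
  proof -
    have "F u = (\<Prod>j\<in>J. if QuadRes (int p) (u + j) then 1 - q else 1)"
      unfolding F_def by (intro prod.cong) auto
    also have "\<dots> = (\<Prod>j\<in>{j \<in> J. QuadRes (int p) (u + j)}. 1 - q)"
      by (rule prod.inter_filter[OF fin, symmetric])
    finally show ?thesis by simp
  qed
  have \<chi>1: "\<bar>\<chi> u\<bar> \<le> 1" for u
    unfolding \<chi>_def using abs_Legendre_le_1[of u "int p"] by linarith
  have F01: "0 \<le> F u" "F u \<le> 1" for u
    unfolding F_def using q by (auto intro!: prod_nonneg prod_le_1)
  have G01: "0 \<le> G u" "G u \<le> 1" for u
  proof -
    have "0 \<le> b * \<chi> (u + j) + a \<and> b * \<chi> (u + j) + a \<le> 1" for j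
    proof -
      have "\<bar>b * \<chi> (u + j)\<bar> \<le> (q / 2) * 1"
        unfolding abs_mult b_def using \<chi>1 q by (intro mult_mono) auto
      then show ?thesis unfolding a_def abs_le_iff using q by linarith
    qed
    then show "0 \<le> G u" "G u \<le> 1" unfolding G_def by (auto intro!: prod_nonneg prod_le_1)
  qed
  have FG: "F u = G u" if "u \<in> {0..<int p} - Z" for u
    unfolding F_def G_def
  proof (rule prod.cong[OF refl])
    fix j assume "j \<in> J"
    then have "\<not> int p dvd u + j" using that by (auto simp: Z_def)
    then show "1 - q * of_bool (QuadRes (int p) (u + j)) = b * \<chi> (u + j) + a"
      by (simp add: \<chi>_def Legendre_def cong_0_iff a_def b_def)
  qed
  have finZ: "finite Z" unfolding Z_def by (rule finite_subset[of _ "{0..<int p}"]) auto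
  have cardZ: "card Z \<le> card J"
  proof -
    have "Z \<subseteq> (\<lambda>j. (- j) mod int p) ` J"
    proof
      fix u assume u: "u \<in> Z"
      then obtain j where j: "j \<in> J" "int p dvd u + j" by (auto simp: Z_def)
      then have "u mod int p = (- j) mod int p" by (simp add: mod_eq_dvd_iff)
      then show "u \<in> (\<lambda>j. (- j) mod int p) ` J" using u j by (auto simp: Z_def)
    qed
    then have "card Z \<le> card ((\<lambda>j. (- j) mod int p) ` J)" using fin by (intro card_mono) auto
    then show ?thesis using card_image_le[OF fin, of "\<lambda>j. (- j) mod int p"] by linarith
  qed
  have "\<bar>(\<Sum>u\<in>{0..<int p}. F u) - (\<Sum>u\<in>{0..<int p}. G u)\<bar> = \<bar>\<Sum>u\<in>{0..<int p}. F u - G u\<bar>"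
    by (simp add: sum_subtractf)
  also have "\<dots> \<le> (\<Sum>u\<in>{0..<int p}. \<bar>F u - G u\<bar>)" by (rule sum_abs)
  also have "\<dots> \<le> (\<Sum>u\<in>{0..<int p}. of_bool (u \<in> Z))"
  proof (rule sum_mono)
    fix u assume "u \<in> {0..<int p}"
    then show "\<bar>F u - G u\<bar> \<le> of_bool (u \<in> Z)"
      using FG[of u] F01[of u] G01[of u] by (cases "u \<in> Z") (auto simp: abs_le_iff)
  qed
  also have "\<dots> = real (card ({0..<int p} \<inter> Z))" by (simp add: Int_def)
  also have "\<dots> \<le> real (card J)"
    using cardZ finZ card_mono[of Z "{0..<int p} \<inter> Z"] by simp
  finally have e1: "\<bar>(\<Sum>u\<in>{0..<int p}. F u) - (\<Sum>u\<in>{0..<int p}. G u)\<bar> \<le> real (card J)" .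

  define w where "w B = (q / 2) ^ card B * a ^ card (J - B)" for B :: "int set"
  define C where "C B = (\<Sum>u\<in>{0..<int p}. \<Prod>j\<in>B. \<chi> (u + j))" for B
  \<comment> \<open>The binomial expansion of (q/2 + a)^|J| = 1; this is what avoids a factor 2^|J|
    in the error.\<close>
  have wsum: "(\<Sum>B\<in>Pow J. w B) = 1"
  proof -
    have "(\<Sum>B\<in>Pow J. w B) = (\<Prod>j\<in>J. q / 2 + a)"
      using fin by (subst prod_add) (auto simp: w_def)
    then show ?thesis by (simp add: a_def)
  qed
  have w0: "w B \<ge> 0" for B using q by (simp add: w_def a_def)
  have "(\<Sum>u\<in>{0..<int p}. G u) = (\<Sum>u\<in>{0..<int p}. \<Sum>B\<in>Pow J. (\<Prod>j\<in>B. b * \<chi> (u + j)) * (\<Prod>j\<in>J-B. a))"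
    unfolding G_def using fin by (simp only: prod_add)
  also have "\<dots> = (\<Sum>B\<in>Pow J. \<Sum>u\<in>{0..<int p}. (\<Prod>j\<in>B. b * \<chi> (u + j)) * (\<Prod>j\<in>J-B. a))"
    by (rule sum.swap)
  also have "\<dots> = (\<Sum>B\<in>Pow J. (-1) ^ card B * w B * C B)"
  proof (rule sum.cong[OF refl])
    fix B :: "int set"
    have "b ^ card B = (-1) ^ card B * (q / 2) ^ card B" by (simp add: b_def power_minus[of "q / 2"])
    then show "(\<Sum>u\<in>{0..<int p}. (\<Prod>j\<in>B. b * \<chi> (u + j)) * (\<Prod>j\<in>J-B. a)) = (-1) ^ card B * w B * C B"
      by (simp add: prod.distrib w_def C_def sum_distrib_left mult.assoc mult.left_commute mult.commute)
  qed
  also have "\<dots> = w {} * C {} + (\<Sum>B\<in>Pow J - {{}}. (-1) ^ card B * w B * C B)"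
    using fin by (subst sum.remove[of _ "{}"]) auto
  also have "w {} * C {} = real p * a ^ card J" by (simp add: w_def C_def)
  finally have "(\<Sum>u\<in>{0..<int p}. G u) - real p * a ^ card J = (\<Sum>B\<in>Pow J - {{}}. (-1) ^ card B * w B * C B)"
    by simp
  then have "\<bar>(\<Sum>u\<in>{0..<int p}. G u) - real p * a ^ card J\<bar> \<le> (\<Sum>B\<in>Pow J - {{}}. \<bar>(-1) ^ card B * w B * C B\<bar>)"
    by (simp only: sum_abs)
  also have "\<dots> \<le> (\<Sum>B\<in>Pow J - {{}}. w B * (17 * real (card J) * sqrt (real p)))"
  proof (rule sum_mono)
    fix B assume B: "B \<in> Pow J - {{}}"
    then have finB: "finite B" using fin finite_subset by auto
    have "C B = real_of_int (\<Sum>u\<in>{0..<int p}. \<Prod>j\<in>B. Legendre (u + j) (int p))"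
      by (simp add: C_def \<chi>_def)
    then have "\<bar>C B\<bar> \<le> 17 * real (card B) * sqrt (real p)"
      using weil_bound[OF p finB] B dist by auto
    also have "\<dots> \<le> 17 * real (card J) * sqrt (real p)"
      using B fin by (intro mult_right_mono mult_left_mono) (auto intro: card_mono)
    finally show "\<bar>(-1) ^ card B * w B * C B\<bar> \<le> w B * (17 * real (card J) * sqrt (real p))"
      using w0[of B] by (simp add: abs_mult power_abs mult_left_mono)
  qed
  also have "\<dots> \<le> (\<Sum>B\<in>Pow J. w B * (17 * real (card J) * sqrt (real p)))"
    using fin w0 by (intro sum_mono2) auto
  also have "\<dots> = 17 * real (card J) * sqrt (real p)"
    by (simp add: sum_distrib_right[symmetric] wsum)
  finally have e2: "\<bar>(\<Sum>u\<in>{0..<int p}. G u) - real p * a ^ card J\<bar> \<le> 17 * real (card J) * sqrt (real p)" .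
  have "real (card J) * 1 \<le> real (card J) * sqrt (real p)"
    using p by (intro mult_left_mono) auto
  then show ?thesis using e1 e2 unfolding F a_def[symmetric] by linarith
qed

text \<open>With q = 2^(-|P|), the induction hypothesis for each class y modulo the new prime has
  main term (1-q)^(number of surviving shifts), and averaging over y replaces q by q/2. The errors
  merely add up because the number of shifts never increases.\<close>

lemma blocked_count:
  fixes P :: "nat set"
  assumes "finite P" "\<And>p. p \<in> P \<Longrightarrow> prime p \<and> p > 2" "finite J"
    and "\<And>p x y. p \<in> P \<Longrightarrow> x \<in> J \<Longrightarrow> y \<in> J \<Longrightarrow> int p dvd x - y \<Longrightarrow> x = y"
  shows "\<bar>real (card (blocked P J)) / real (\<Prod>P) - (1 - (1/2) ^ card P) ^ card J\<bar>
      \<le> (\<Sum>p\<in>P. 18 * real (card J) / sqrt (real p))"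
  using assms
proof (induction P arbitrary: J rule: finite_induct)
  \<comment> \<open>Modulo 1 everything is a residue, so only the empty set of shifts is blocked;
    accordingly the main term is 0 to the power |J|.\<close>
  case empty
  show ?case
  proof (cases "J = {}")
    case True
    have "{0..<1} = {0::int}" by auto
    then show ?thesis using True by (simp add: blocked_def)
  next
    case False
    then have "blocked {} J = {}" by (auto simp: blocked_def)
    moreover have "card J > 0" using False empty by (simp add: card_gt_0_iff)
    ultimately show ?thesis by (simp add: power_0_left)
  qed
next
  case (insert p P)
  define Q where "Q = real (\<Prod>P)"
  define Jy where "Jy y = {j \<in> J. QuadRes (int p) (y + j)}" for y
  define q where "q = (1/2 :: real) ^ card P"
  have p: "prime p" "p > 2" using insert.prems by auto
  have Q0: "Q > 0" using prod_primes_pos[of P] insert.prems by (simp add: Q_def del: of_nat_prod)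
  have cop: "coprime p (\<Prod>P)"
    using coprime_prod_primes[of P p] insert by (simp del: of_nat_prod)
  have "blocked (insert p P) J = {x \<in> {0..<int (p * \<Prod>P)}. \<forall>j\<in>J. \<not> (QuadRes (int p) (x + j) \<and> (\<forall>p\<in>P. QuadRes (int p) (x + j)))}"
    using insert.hyps by (auto simp: blocked_def)
  then have card: "card (blocked (insert p P) J) = (\<Sum>y\<in>{0..<int p}. card (blocked P (Jy y)))"
    using card_blocked_crt[of P p J] insert cop p by (simp add: Jy_def)
  define E where "E = (\<Sum>p\<in>P. 18 * real (card J) / sqrt (real p))"
  have IH: "\<bar>real (card (blocked P (Jy y))) / Q - (1 - q) ^ card (Jy y)\<bar> \<le> E" for y
  proof -
    have "\<bar>real (card (blocked P (Jy y))) / Q - (1 - q) ^ card (Jy y)\<bar>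
        \<le> (\<Sum>p\<in>P. 18 * real (card (Jy y)) / sqrt (real p))"
      unfolding Q_def q_def using insert.prems by (intro insert.IH) (auto simp: Jy_def)
    also have "\<dots> \<le> E"
      unfolding E_def Jy_def using insert.prems
      by (intro sum_mono divide_right_mono mult_left_mono) (auto intro!: card_mono)
    finally show ?thesis .
  qed
  have "\<bar>(\<Sum>y\<in>{0..<int p}. real (card (blocked P (Jy y))) / Q) - (\<Sum>y\<in>{0..<int p}. (1 - q) ^ card (Jy y))\<bar>
      \<le> (\<Sum>y\<in>{0..<int p}. \<bar>real (card (blocked P (Jy y))) / Q - (1 - q) ^ card (Jy y)\<bar>)"
    unfolding sum_subtractf[symmetric] by (rule sum_abs)
  also have "\<dots> \<le> (\<Sum>y\<in>{0..<int p}. E)" by (intro sum_mono IH)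
  finally have e1: "\<bar>(\<Sum>y\<in>{0..<int p}. real (card (blocked P (Jy y))) / Q) - (\<Sum>y\<in>{0..<int p}. (1 - q) ^ card (Jy y))\<bar>
      \<le> real p * E" by simp
  have e2: "\<bar>(\<Sum>y\<in>{0..<int p}. (1 - q) ^ card (Jy y)) - real p * (1 - q / 2) ^ card J\<bar>
      \<le> 18 * real (card J) * sqrt (real p)"
    unfolding Jy_def using insert.prems p by (intro one_prime_average) (auto simp: q_def power_le_one)
  have e3: "18 * real (card J) * sqrt (real p) = real p * (18 * real (card J) / sqrt (real p))"
  proof -
    have "real p / sqrt (real p) = sqrt (real p)" by (rule real_div_sqrt) simp
    then show ?thesis by (metis times_divide_eq_right times_divide_eq_left mult.commute)
  qed
  define X where "X = real (card (blocked (insert p P) J)) / real (\<Prod>(insert p P)) - (1 - (1/2) ^ card (insert p P)) ^ card J"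
  have "real p * X = (\<Sum>y\<in>{0..<int p}. real (card (blocked P (Jy y))) / Q) - real p * (1 - q / 2) ^ card J"
    unfolding X_def card using insert.hyps p Q0
    by (simp add: Q_def q_def right_diff_distrib sum_divide_distrib[symmetric] del: of_nat_prod)
  then have "real p * \<bar>X\<bar> = \<bar>(\<Sum>y\<in>{0..<int p}. real (card (blocked P (Jy y))) / Q) - real p * (1 - q / 2) ^ card J\<bar>"
    by (metis abs_mult abs_of_nat)
  also have "\<dots> \<le> real p * E + real p * (18 * real (card J) / sqrt (real p))"
    using e1 e2 e3 by linarith
  finally have "real p * \<bar>X\<bar> \<le> real p * (E + 18 * real (card J) / sqrt (real p))" by (simp add: distrib_left)
  then have "\<bar>X\<bar> \<le> E + 18 * real (card J) / sqrt (real p)" using p by simp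
  then show ?case unfolding X_def E_def using insert.hyps by simp
qed

section \<open>The fourth moment of short character sums\<close>

text \<open>The real character modulo the product d of the primes in S; a divisor d of the
  squarefree m is encoded by its set of primes.\<close>

definition chi :: "nat set \<Rightarrow> int \<Rightarrow> int" where
  "chi S n = (\<Prod>p\<in>S. Legendre n (int p))"

definition char_sum :: "nat set \<Rightarrow> nat \<Rightarrow> int \<Rightarrow> int" where
  "char_sum S h x = (\<Sum>j\<in>{1..int h}. chi S (x + j))"

lemma abs_chi_le_1: "\<bar>chi S n\<bar> \<le> 1"
  unfolding chi_def abs_prod by (intro prod_le_1) (auto simp: abs_Legendre_le_1)

lemma chi_mod:
  assumes "finite S"
  shows "chi S (n mod int (\<Prod>S)) = chi S n"
  unfolding chi_def
proof (intro prod.cong refl Legendre_cong)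
  fix p assume "p \<in> S"
  then have "int p dvd int (\<Prod>S)" using assms by (auto simp: int_dvd_int_iff dvd_prod_eqI simp del: of_nat_prod)
  then show "[n mod int (\<Prod>S) = n] (mod int p)" by (simp add: cong_def mod_mod_cancel)
qed

lemma chi_cong:
  assumes "finite S" "[a = b] (mod int (\<Prod>S))"
  shows "chi S a = chi S b"
  using chi_mod[OF assms(1), of a] chi_mod[OF assms(1), of b] assms(2) by (simp add: cong_def)

lemma Legendre_square:
  "Legendre a p * Legendre a p = (if p dvd a then 0 else 1)"
  by (auto simp: Legendre_def cong_0_iff)

text \<open>The two equal factors give a square, which is 1 except at one point; what remains is a
  sum of two symbols with distinct shifts, plus an error of at most 1.\<close>

lemma four_Legendre_paired:
  fixes p :: nat
  assumes p: "prime p" "p > 2" and ab: "\<not> int p dvd a - b" and cd: "int p dvd c - d"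
  shows "\<bar>real_of_int (\<Sum>x\<in>{0..<int p}. Legendre (x + a) p * Legendre (x + b) p * Legendre (x + c) p * Legendre (x + d) p)\<bar>
    \<le> 68 * sqrt (real p)"
proof -
  let ?L = "\<lambda>x. Legendre x (int p)"
  have eq: "?L (x + a) * ?L (x + b) * ?L (x + c) * ?L (x + d)
      = ?L (x + a) * ?L (x + b) - ?L (x + a) * ?L (x + b) * of_bool (int p dvd x + c)" for x
  proof -
    have "?L (x + d) = ?L (x + c)"
      using cd by (intro Legendre_cong) (simp add: cong_iff_dvd_diff dvd_diff_commute)
    then show ?thesis using Legendre_square[of "x + c" "int p"] by (simp add: mult.assoc)
  qed
  have ne: "a \<noteq> b" using ab by auto
  have "\<bar>real_of_int (\<Sum>x\<in>{0..<int p}. \<Prod>j\<in>{a, b}. ?L (x + j))\<bar> \<le> 17 * real (card {a, b}) * sqrt (real p)"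
    using p ab by (intro weil_bound) (auto simp: dvd_diff_commute)
  then have 1: "\<bar>real_of_int (\<Sum>x\<in>{0..<int p}. ?L (x + a) * ?L (x + b))\<bar> \<le> 34 * sqrt (real p)"
    using ne by simp
  have "\<bar>\<Sum>x\<in>{0..<int p}. ?L (x + a) * ?L (x + b) * of_bool (int p dvd x + c)\<bar>
      \<le> (\<Sum>x\<in>{0..<int p}. \<bar>?L (x + a) * ?L (x + b) * of_bool (int p dvd x + c)\<bar>)" by (rule sum_abs)
  also have "\<dots> \<le> (\<Sum>x\<in>{0..<int p}. of_bool (int p dvd x + c))"
    by (intro sum_mono) (auto simp: abs_mult abs_Legendre_le_1 mult_le_one)
  also have "\<dots> = int (card {x \<in> {0..<int p}. int p dvd x + c})"
    by (subst card_eq_sum_of_bool) auto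
  also have "\<dots> \<le> int (card {(- c) mod int p})"
  proof -
    have "{x \<in> {0..<int p}. int p dvd x + c} \<subseteq> {(- c) mod int p}"
    proof
      fix x assume x: "x \<in> {x \<in> {0..<int p}. int p dvd x + c}"
      then have "x mod int p = (- c) mod int p" by (subst mod_eq_dvd_iff) simp
      then show "x \<in> {(- c) mod int p}" using x by simp
    qed
    from card_mono[OF _ this] show ?thesis by simp
  qed
  finally have "\<bar>\<Sum>x\<in>{0..<int p}. ?L (x + a) * ?L (x + b) * of_bool (int p dvd x + c)\<bar> \<le> 1"
    by simp
  then have 2: "\<bar>real_of_int (\<Sum>x\<in>{0..<int p}. ?L (x + a) * ?L (x + b) * of_bool (int p dvd x + c))\<bar> \<le> 1"
    by linarith
  have "sqrt (real p) \<ge> 1" using p by simp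
  then show ?thesis using 1 2 unfolding eq sum_subtractf of_int_diff by linarith
qed

text \<open>As a differs from the other three shifts modulo p, the product cannot be a square, even
  if some of b, c, d coincide: either two of them pair off, or all four are distinct and 68 = 17 *
  4.\<close>

lemma four_Legendre_bound:
  fixes p :: nat
  assumes p: "prime p" "p > 2" and ab: "\<not> int p dvd a - b" and ac: "\<not> int p dvd a - c" and ad: "\<not> int p dvd a - d"
  shows "\<bar>real_of_int (\<Sum>x\<in>{0..<int p}. Legendre (x + a) p * Legendre (x + b) p * Legendre (x + c) p * Legendre (x + d) p)\<bar>
    \<le> 68 * sqrt (real p)"
proof -
  consider "int p dvd c - d" | "int p dvd b - d" | "int p dvd b - c"
    | "\<not> int p dvd c - d" "\<not> int p dvd b - d" "\<not> int p dvd b - c" by blast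
  then show ?thesis
  proof cases
    case 1 then show ?thesis using four_Legendre_paired[OF p ab] by blast
  next
    case 2 then show ?thesis using four_Legendre_paired[OF p ac, of b d] by (simp add: mult.assoc mult.left_commute mult.commute)
  next
    case 3 then show ?thesis using four_Legendre_paired[OF p ad, of b c] by (simp add: mult.assoc mult.left_commute mult.commute)
  next
    case 4
    have ne: "a \<noteq> b" "a \<noteq> c" "a \<noteq> d" "b \<noteq> c" "b \<noteq> d" "c \<noteq> d" using 4 ab ac ad by auto
    have "\<bar>real_of_int (\<Sum>x\<in>{0..<int p}. \<Prod>j\<in>{a, b, c, d}. Legendre (x + j) p)\<bar> \<le> 17 * real (card {a, b, c, d}) * sqrt (real p)"
      using p 4 ab ac ad by (intro weil_bound) (auto simp: dvd_diff_commute)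
    then show ?thesis using ne by (simp add: mult.assoc)
  qed
qed

lemma prod_gcd_le:
  fixes S :: "nat set"
  assumes "finite S" "\<And>p. p \<in> S \<Longrightarrow> prime p"
  shows "(\<Prod>p\<in>S. gcd (int p) n) \<le> gcd (int (\<Prod>S)) n"
proof -
  have "(\<Prod>p\<in>S. gcd (int p) n) dvd gcd (int (\<Prod>S)) n"
    using assms
  proof (induction S rule: finite_induct)
    case (insert p S)
    have cop: "coprime (int p) (int (\<Prod>S))" using insert by (intro coprime_prod_primes) auto
    have "gcd (int p) n * gcd (int (\<Prod>S)) n dvd gcd (int p * int (\<Prod>S)) n"
    proof (rule gcd_greatest)
      show "gcd (int p) n * gcd (int (\<Prod>S)) n dvd int p * int (\<Prod>S)" by (intro mult_dvd_mono) auto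
      show "gcd (int p) n * gcd (int (\<Prod>S)) n dvd n"
        by (rule divides_mult) (use cop in \<open>auto intro: coprime_divisors[OF gcd_dvd1 gcd_dvd1]\<close>)
    qed
    moreover have "gcd (int p) n * (\<Prod>p\<in>S. gcd (int p) n) dvd gcd (int p) n * gcd (int (\<Prod>S)) n"
      using insert by (intro mult_dvd_mono) auto
    ultimately have "gcd (int p) n * (\<Prod>p\<in>S. gcd (int p) n) dvd gcd (int p * int (\<Prod>S)) n"
      by (rule dvd_trans[rotated])
    then show ?case using insert.hyps by simp
  qed simp
  moreover have "\<Prod>S > 0" using prod_primes_pos[of S] assms by auto
  ultimately show ?thesis by (intro zdvd_imp_le) (auto simp del: of_nat_prod)
qed

text \<open>The sum factors over the primes of S. Where a collides with another shift only the
  trivial bound p is available, and one of the gcd factors pays for it; every other prime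
  contributes 68 sqrt(p).\<close>

lemma complete_sum_four:
  fixes S :: "nat set"
  assumes S: "finite S" "\<And>p. p \<in> S \<Longrightarrow> prime p \<and> p > 2"
  shows "\<bar>real_of_int (\<Sum>x\<in>{0..<int (\<Prod>S)}. chi S (x + a) * chi S (x + b) * chi S (x + c) * chi S (x + d))\<bar>
    \<le> 68 ^ card S * sqrt (real (\<Prod>S)) * (real_of_int (gcd (int (\<Prod>S)) (a - b)) *
        real_of_int (gcd (int (\<Prod>S)) (a - c)) * real_of_int (gcd (int (\<Prod>S)) (a - d)))"
proof -
  define f where "f p y = Legendre (y + a) (int p) * Legendre (y + b) (int p) * Legendre (y + c) (int p) * Legendre (y + d) (int p)" for p y
  have fmod: "f p (x mod int p) = f p x" for p x
  proof -
    have "Legendre (x mod int p + e) (int p) = Legendre (x + e) (int p)" for e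
      by (intro Legendre_cong) (simp add: cong_def mod_add_left_eq)
    then show ?thesis by (simp add: f_def)
  qed
  have "(\<Sum>x\<in>{0..<int (\<Prod>S)}. chi S (x + a) * chi S (x + b) * chi S (x + c) * chi S (x + d))
      = (\<Sum>x\<in>{0..<int (\<Prod>S)}. \<Prod>p\<in>S. f p (x mod int p))"
    unfolding fmod by (simp add: chi_def f_def prod.distrib)
  also have "\<dots> = (\<Prod>p\<in>S. \<Sum>y\<in>{0..<int p}. f p y)" using S by (intro crt_prod) auto
  finally have eq: "\<bar>real_of_int (\<Sum>x\<in>{0..<int (\<Prod>S)}. chi S (x + a) * chi S (x + b) * chi S (x + c) * chi S (x + d))\<bar>
    = (\<Prod>p\<in>S. \<bar>real_of_int (\<Sum>y\<in>{0..<int p}. f p y)\<bar>)"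
    by (simp add: abs_prod)
  define g where "g p n = real_of_int (gcd (int p) n)" for p n
  have g1: "g p n \<ge> 1" if "p \<in> S" for p n
    using S(2)[OF that] by (simp add: g_def int_one_le_iff_zero_less)
  have "(\<Prod>p\<in>S. \<bar>real_of_int (\<Sum>y\<in>{0..<int p}. f p y)\<bar>)
      \<le> (\<Prod>p\<in>S. 68 * sqrt (real p) * (g p (a - b) * g p (a - c) * g p (a - d)))"
  proof (intro prod_mono conjI)
    fix p assume pS: "p \<in> S"
    then have p: "prime p" "p > 2" using S by auto
    let ?g = "g p (a - b) * g p (a - c) * g p (a - d)"
    have s1: "sqrt (real p) \<ge> 1" using p by simp
    show "\<bar>real_of_int (\<Sum>y\<in>{0..<int p}. f p y)\<bar> \<le> 68 * sqrt (real p) * ?g"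
    proof (cases "int p dvd a - b \<or> int p dvd a - c \<or> int p dvd a - d")
      case True
      have gp: "g p n = real p" if "int p dvd n" for n using that by (simp add: g_def gcd_proj1_iff[THEN iffD2])
      note g' = g1[OF pS, of "a - b"] g1[OF pS, of "a - c"] g1[OF pS, of "a - d"]
      have "real p \<le> ?g"
        using True
      proof (elim disjE)
        assume "int p dvd a - b"
        then show ?thesis using gp[of "a - b"] mult_mono[of 1 "g p (a - c)" 1 "g p (a - d)"] g'
          mult_left_mono[of 1 "g p (a - c) * g p (a - d)" "real p"] by (simp add: mult.assoc)
      next
        assume "int p dvd a - c"
        then show ?thesis using gp[of "a - c"] mult_mono[of 1 "g p (a - b)" 1 "g p (a - d)"] g'
          mult_left_mono[of 1 "g p (a - b) * g p (a - d)" "real p"] by (simp add: mult.assoc mult.left_commute)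
      next
        assume "int p dvd a - d"
        then show ?thesis using gp[of "a - d"] mult_mono[of 1 "g p (a - b)" 1 "g p (a - c)"] g'
          mult_left_mono[of 1 "g p (a - b) * g p (a - c)" "real p"] by (simp add: mult.assoc mult.left_commute mult.commute)
      qed
      also have "?g \<le> 68 * sqrt (real p) * ?g"
      proof -
        have "?g \<ge> 0" using g' by (intro mult_nonneg_nonneg) linarith+
        then show ?thesis using mult_right_mono[of 1 "68 * sqrt (real p)" ?g] s1 by linarith
      qed
      finally have "real p \<le> 68 * sqrt (real p) * ?g" .
      moreover have "\<bar>\<Sum>y\<in>{0..<int p}. f p y\<bar> \<le> (\<Sum>y\<in>{0..<int p}. 1)"
        by (intro order.trans[OF sum_abs] sum_mono) (auto simp: f_def abs_mult abs_Legendre_le_1 intro!: mult_le_one)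
      ultimately show ?thesis by (simp del: of_int_sum)
    next
      case False
      then have "\<bar>real_of_int (\<Sum>y\<in>{0..<int p}. f p y)\<bar> \<le> 68 * sqrt (real p) * 1"
        unfolding f_def using four_Legendre_bound[OF p] by simp
      also have "\<dots> \<le> 68 * sqrt (real p) * ?g"
      proof (intro mult_left_mono)
        have ge1: "1 \<le> x * y" if "1 \<le> x" "1 \<le> y" for x y :: real using mult_mono[of 1 x 1 y] that by simp
        show "1 \<le> ?g" by (intro ge1 g1[OF pS])
      qed simp
      finally show ?thesis .
    qed
  qed simp
  also have "\<dots> = 68 ^ card S * sqrt (real (\<Prod>S)) * ((\<Prod>p\<in>S. g p (a - b)) * (\<Prod>p\<in>S. g p (a - c)) * (\<Prod>p\<in>S. g p (a - d)))"
  proof -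
    have "sqrt (real (\<Prod>S)) = (\<Prod>p\<in>S. sqrt (real p))"
      using S(1) by (induction S rule: finite_induct) (auto simp: real_sqrt_mult)
    then show ?thesis by (simp add: prod.distrib)
  qed
  also have "\<dots> \<le> 68 ^ card S * sqrt (real (\<Prod>S)) * (real_of_int (gcd (int (\<Prod>S)) (a - b)) *
        real_of_int (gcd (int (\<Prod>S)) (a - c)) * real_of_int (gcd (int (\<Prod>S)) (a - d)))"
  proof -
    have le: "(\<Prod>p\<in>S. g p n) \<le> real_of_int (gcd (int (\<Prod>S)) n)" for n
    proof -
      have "(\<Prod>p\<in>S. g p n) = real_of_int (\<Prod>p\<in>S. gcd (int p) n)" by (simp add: g_def)
      then show ?thesis using prod_gcd_le[of S n] S by (simp del: of_int_prod of_nat_prod)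
    qed
    have nn: "(\<Prod>p\<in>S. g p n) \<ge> 0" for n using g1 by (intro prod_nonneg) (auto intro: order.trans[OF zero_le_one])
    show ?thesis by (intro mult_left_mono mult_mono le mult_nonneg_nonneg nn) (auto simp del: of_nat_prod)
  qed
  finally show ?thesis using eq by simp
qed

text \<open>Estimate gcd(n, k) by the sum of all common divisors and sum over k first: a divisor e
  contributes e times the number of its multiples, hence at most N.\<close>

lemma sum_gcd_le:
  fixes n :: nat
  assumes "n > 0"
  shows "(\<Sum>k\<in>{1..N}. gcd n k) \<le> N * card {e. e dvd n}"
proof -
  let ?D = "{e. e dvd n}"
  have fin: "finite ?D" using assms by simp
  have "(\<Sum>k\<in>{1..N}. gcd n k) \<le> (\<Sum>k\<in>{1..N}. \<Sum>e\<in>?D. if e dvd k then e else 0)"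
  proof (rule sum_mono)
    fix k
    have "gcd n k = (if gcd n k dvd k then gcd n k else 0)" by simp
    also have "\<dots> \<le> (\<Sum>e\<in>?D. if e dvd k then e else 0)"
      using fin by (intro member_le_sum) auto
    finally show "gcd n k \<le> (\<Sum>e\<in>?D. if e dvd k then e else 0)" .
  qed
  also have "\<dots> = (\<Sum>e\<in>?D. \<Sum>k\<in>{1..N}. if e dvd k then e else 0)" by (rule sum.swap)
  also have "\<dots> \<le> (\<Sum>e\<in>?D. N)"
  proof (rule sum_mono)
    fix e assume "e \<in> ?D"
    then have e: "e > 0" using assms by (auto intro: gr0I)
    have "(\<Sum>k\<in>{1..N}. if e dvd k then e else 0) = card {k \<in> {1..N}. e dvd k} * e"
      by (simp add: sum.inter_filter[symmetric])
    also have "card {k \<in> {1..N}. e dvd k} \<le> card ((\<lambda>i. e * i) ` {1..N div e})"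
    proof (rule card_mono)
      show "{k \<in> {1..N}. e dvd k} \<subseteq> (\<lambda>i. e * i) ` {1..N div e}"
      proof
        fix k assume k: "k \<in> {k \<in> {1..N}. e dvd k}"
        then obtain i where i: "k = e * i" by auto
        then have "i \<in> {1..N div e}" using k e by (auto simp: less_eq_div_iff_mult_less_eq mult.commute Suc_le_eq)
        then show "k \<in> (\<lambda>i. e * i) ` {1..N div e}" using i by auto
      qed
    qed simp
    also have "card ((\<lambda>i. e * i) ` {1..N div e}) \<le> N div e" using card_image_le[of "{1..N div e}"] by simp
    finally have "(\<Sum>k\<in>{1..N}. if e dvd k then e else 0) \<le> N div e * e" by simp
    then show "(\<Sum>k\<in>{1..N}. if e dvd k then e else 0) \<le> N"
      using div_times_less_eq_dividend le_trans by blast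
  qed
  finally show ?thesis by (simp add: mult.commute)
qed

lemma card_divisors_prod_primes:
  fixes S :: "nat set"
  assumes "finite S" "\<And>p. p \<in> S \<Longrightarrow> prime p"
  shows "card {e. e dvd \<Prod>S} \<le> 2 ^ card S"
  using assms
proof (induction S rule: finite_induct)
  case (insert p S)
  let ?D = "{e. e dvd \<Prod>S}"
  have pos: "\<Prod>S > 0" using insert prod_primes_pos[of S] by auto
  have fin: "finite ?D" using pos by simp
  have "{e. e dvd p * \<Prod>S} \<subseteq> ?D \<union> (\<lambda>e. p * e) ` ?D"
  proof
    fix e assume e: "e \<in> {e. e dvd p * \<Prod>S}"
    show "e \<in> ?D \<union> (\<lambda>e. p * e) ` ?D"
    proof (cases "p dvd e")
      case True
      then obtain e' where e': "e = p * e'" by auto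
      then have "e' dvd \<Prod>S" using e insert.prems[of p] by (auto simp: prime_gt_0_nat)
      then show ?thesis using e' by auto
    next
      case False
      then have "coprime e p" using insert.prems[of p] by (metis coprime_commute insertI1 prime_imp_coprime)
      then show ?thesis using e by (simp add: coprime_dvd_mult_right_iff)
    qed
  qed
  then have "card {e. e dvd p * \<Prod>S} \<le> card (?D \<union> (\<lambda>e. p * e) ` ?D)" using fin by (intro card_mono) auto
  also have "\<dots> \<le> card ?D + card ((\<lambda>e. p * e) ` ?D)" by (rule card_Un_le)
  also have "\<dots> \<le> card ?D + card ?D" using card_image_le[OF fin] by simp
  finally show ?case using insert by simp
qed simp

lemma sum_gcd_shift_le:
  fixes S :: "nat set"
  assumes S: "finite S" "\<And>p. p \<in> S \<Longrightarrow> prime p" and i: "i \<in> {1..int h}"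
  shows "(\<Sum>j\<in>{1..int h}. if i = j then 0 else real_of_int (gcd (int (\<Prod>S)) (i - j))) \<le> 2 * real h * 2 ^ card S"
proof -
  define n where "n = \<Prod>S"
  have n: "n > 0" unfolding n_def using prod_primes_pos[of S] S by auto
  let ?G = "\<lambda>k. real_of_int (gcd (int n) k)"
  have half: "(\<Sum>k\<in>{1..int h}. ?G k) \<le> real h * 2 ^ card S"
  proof -
    have "(\<Sum>k\<in>{1..int h}. ?G k) = (\<Sum>k\<in>{1..h}. real (gcd n k))"
      by (rule sum.reindex_bij_witness[of _ int nat]) (auto simp: gcd_int_def)
    also have "\<dots> = real (\<Sum>k\<in>{1..h}. gcd n k)" by simp
    also have "\<dots> \<le> real (h * card {e. e dvd n})" using sum_gcd_le[OF n, of h] by (simp only: of_nat_le_iff)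
    also have "\<dots> \<le> real (h * 2 ^ card S)"
      using card_divisors_prod_primes[of S] S by (simp only: of_nat_le_iff n_def mult_le_mono2)
    finally show ?thesis by simp
  qed
  have "(\<Sum>j\<in>{1..int h}. if i = j then 0 else ?G (i - j)) = (\<Sum>j\<in>{1..<i}. ?G (i - j)) + (\<Sum>j\<in>{i<..int h}. ?G (i - j))"
  proof -
    have "{1..int h} = insert i ({1..<i} \<union> {i<..int h})" using i by auto
    then have "(\<Sum>j\<in>{1..int h}. if i = j then 0 else ?G (i - j)) = (\<Sum>j\<in>{1..<i} \<union> {i<..int h}. if i = j then 0 else ?G (i - j))"
      by simp
    also have "\<dots> = (\<Sum>j\<in>{1..<i}. if i = j then 0 else ?G (i - j)) + (\<Sum>j\<in>{i<..int h}. if i = j then 0 else ?G (i - j))"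
      by (rule sum.union_disjoint) auto
    also have "\<dots> = (\<Sum>j\<in>{1..<i}. ?G (i - j)) + (\<Sum>j\<in>{i<..int h}. ?G (i - j))"
      by (intro arg_cong2[where f = "(+)"] sum.cong) auto
    finally show ?thesis .
  qed
  also have "(\<Sum>j\<in>{1..<i}. ?G (i - j)) = (\<Sum>k\<in>{1..<i}. ?G k)"
    by (rule sum.reindex_bij_witness[of _ "\<lambda>k. i - k" "\<lambda>k. i - k"]) auto
  also have "\<dots> \<le> (\<Sum>k\<in>{1..int h}. ?G k)" using i by (intro sum_mono2) auto
  also have "(\<Sum>j\<in>{i<..int h}. ?G (i - j)) = (\<Sum>k\<in>{1..int h - i}. ?G k)"
  proof (rule sum.reindex_bij_witness[of _ "\<lambda>k. i + k" "\<lambda>k. k - i"])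
    show "?G (j - i) = ?G (i - j)" for j by (metis gcd_neg2_int minus_diff_eq)
  qed auto
  also have "\<dots> \<le> (\<Sum>k\<in>{1..int h}. ?G k)" using i by (intro sum_mono2) auto
  finally show ?thesis using half unfolding n_def by linarith
qed


lemma sum_power4:
  fixes f :: "'a \<Rightarrow> real"
  shows "(\<Sum>a\<in>J. f a) ^ 4 = (\<Sum>a\<in>J. \<Sum>b\<in>J. \<Sum>c\<in>J. \<Sum>d\<in>J. f a * f b * f c * f d)"
proof -
  have "(\<Sum>a\<in>J. f a) ^ 4 = (\<Sum>a\<in>J. f a * (\<Sum>b\<in>J. f b * (\<Sum>c\<in>J. f c * (\<Sum>d\<in>J. f d))))"
    by (simp only: power4_eq_xxxx mult.assoc sum_distrib_right)
  then show ?thesis by (simp only: sum_distrib_left mult.assoc)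
qed

lemma sum_power3:
  fixes f :: "'a \<Rightarrow> real"
  shows "(\<Sum>a\<in>J. f a) ^ 3 = (\<Sum>a\<in>J. \<Sum>b\<in>J. \<Sum>c\<in>J. f a * f b * f c)"
proof -
  have "(\<Sum>a\<in>J. f a) ^ 3 = (\<Sum>a\<in>J. f a * (\<Sum>b\<in>J. f b * (\<Sum>c\<in>J. f c)))"
    by (simp only: power3_eq_cube mult.assoc sum_distrib_right)
  then show ?thesis by (simp only: sum_distrib_left mult.assoc)
qed

text \<open>Among four shifts either one differs from the other three, and the complete sum is
  small, or they form two equal pairs, which happens for at most 3 h^2 quadruples. In the first case
  summing the three gcd factors costs (2 h 2^|S|)^3; with four choices of the isolated shift this
  yields 32 = 4 * 8 and 544 = 68 * 8.\<close>

lemma fourth_moment: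
  fixes S :: "nat set"
  assumes S: "finite S" "\<And>p. p \<in> S \<Longrightarrow> prime p \<and> p > 2"
  shows "(\<Sum>x\<in>{0..<int (\<Prod>S)}. real_of_int (char_sum S h x) ^ 4)
    \<le> 3 * real (\<Prod>S) * real h ^ 2 + 32 * 544 ^ card S * sqrt (real (\<Prod>S)) * real h ^ 4"
proof -
  define J where "J = {1..int h}"
  define D where "D = real (\<Prod>S)"
  define K where "K = 68 ^ card S * sqrt D"
  define X where "X = {0..<int (\<Prod>S)}"
  define f where "f x a = real_of_int (chi S (x + a))" for x a
  define E where "E a b c d = (\<Sum>x\<in>X. f x a * f x b * f x c * f x d)" for a b c d
  define \<delta> where "\<delta> a b = (of_bool (a = b) :: real)" for a b :: int
  \<comment> \<open>The value 0 on the diagonal lets the sums below run over all quadruples, whether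
    or not a shift is isolated in them.\<close>
  define \<gamma> where "\<gamma> a b = (if a = b then 0 else real_of_int (gcd (int (\<Prod>S)) (a - b)))" for a b
  have D0: "D \<ge> 0" "K \<ge> 0" by (simp_all add: D_def K_def del: of_nat_prod)
  have \<delta>0: "\<delta> a b \<ge> 0" for a b by (simp add: \<delta>_def)
  have \<gamma>0: "\<gamma> a b \<ge> 0" for a b by (simp add: \<gamma>_def)
  have ED: "E a b c d \<le> D" for a b c d
  proof -
    have f1: "\<bar>f x a\<bar> \<le> 1" for x a
      unfolding f_def using abs_chi_le_1[of S "x + a"] by linarith
    have "\<bar>f x a * f x b * f x c * f x d\<bar> \<le> 1" for x
      unfolding abs_mult by (intro mult_le_one mult_nonneg_nonneg abs_ge_zero f1)
    then have "f x a * f x b * f x c * f x d \<le> 1" for x using abs_le_D1 by blast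
    then have "E a b c d \<le> (\<Sum>x\<in>X. 1)" unfolding E_def by (intro sum_mono)
    also have "\<dots> = D" by (simp add: X_def D_def del: of_nat_prod)
    finally show ?thesis .
  qed
  have EK: "E a b c d \<le> K * (\<gamma> a b * \<gamma> a c * \<gamma> a d)" if "a \<noteq> b" "a \<noteq> c" "a \<noteq> d" for a b c d
  proof -
    have "E a b c d = real_of_int (\<Sum>x\<in>X. chi S (x + a) * chi S (x + b) * chi S (x + c) * chi S (x + d))"
      by (simp add: E_def f_def)
    also have "\<dots> \<le> K * (\<gamma> a b * \<gamma> a c * \<gamma> a d)"
    proof -
      have "\<bar>real_of_int (\<Sum>x\<in>X. chi S (x + a) * chi S (x + b) * chi S (x + c) * chi S (x + d))\<bar>
          \<le> K * (\<gamma> a b * \<gamma> a c * \<gamma> a d)"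
        unfolding X_def K_def D_def \<gamma>_def if_not_P[OF that(1)] if_not_P[OF that(2)] if_not_P[OF that(3)]
        by (rule complete_sum_four) (use S in auto)
      then show ?thesis by (rule abs_le_D1)
    qed
    finally show ?thesis .
  qed
  have E_bound: "E a b c d \<le> D * (\<delta> a b * \<delta> c d + \<delta> a c * \<delta> b d + \<delta> a d * \<delta> b c)
      + K * (\<gamma> a b * \<gamma> a c * \<gamma> a d + \<gamma> b a * \<gamma> b c * \<gamma> b d + \<gamma> c a * \<gamma> c b * \<gamma> c d + \<gamma> d a * \<gamma> d b * \<gamma> d c)"
    (is "_ \<le> D * ?P + K * ?G") for a b c d
  proof -
    have P0: "?P \<ge> 0" using \<delta>0 by simp
    have G4: "\<gamma> a b * \<gamma> a c * \<gamma> a d \<ge> 0" "\<gamma> b a * \<gamma> b c * \<gamma> b d \<ge> 0"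
      "\<gamma> c a * \<gamma> c b * \<gamma> c d \<ge> 0" "\<gamma> d a * \<gamma> d b * \<gamma> d c \<ge> 0" using \<gamma>0 by simp_all
    have via: "E a b c d \<le> D * ?P + K * ?G" if "E a b c d \<le> K * g" "g \<le> ?G" for g
      using that mult_left_mono[OF that(2) D0(2)] mult_nonneg_nonneg[OF D0(1) P0] by linarith
    consider "a \<noteq> b" "a \<noteq> c" "a \<noteq> d" | "b \<noteq> a" "b \<noteq> c" "b \<noteq> d" | "c \<noteq> a" "c \<noteq> b" "c \<noteq> d"
      | "d \<noteq> a" "d \<noteq> b" "d \<noteq> c" | "a = b" "c = d" | "a = c" "b = d" | "a = d" "b = c"
      by metis
    then show ?thesis
    proof cases
      case 1 show ?thesis by (rule via[OF EK[OF 1]]) (use G4 in linarith)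
    next
      case 2
      have "E a b c d = E b a c d" by (simp add: E_def mult.commute)
      then show ?thesis using EK[OF 2] G4 by (intro via) auto
    next
      case 3
      have "E a b c d = E c a b d" by (simp add: E_def mult.commute mult.left_commute)
      then show ?thesis using EK[OF 3] G4 by (intro via) auto
    next
      case 4
      have "E a b c d = E d a b c" by (simp add: E_def mult.commute mult.left_commute)
      then show ?thesis using EK[OF 4] G4 by (intro via) auto
    next
      case 5
      then have "1 \<le> ?P" by (simp add: \<delta>_def)
      from mult_left_mono[OF this D0(1)] show ?thesis using ED[of a b c d] mult_nonneg_nonneg[OF D0(2), of ?G] G4 by linarith
    next
      case 6
      then have "1 \<le> ?P" by (simp add: \<delta>_def)
      from mult_left_mono[OF this D0(1)] show ?thesis using ED[of a b c d] mult_nonneg_nonneg[OF D0(2), of ?G] G4 by linarith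
    next
      case 7
      then have "1 \<le> ?P" by (simp add: \<delta>_def)
      from mult_left_mono[OF this D0(1)] show ?thesis using ED[of a b c d] mult_nonneg_nonneg[OF D0(2), of ?G] G4 by linarith
    qed
  qed
  let ?S4 = "\<lambda>F :: int \<Rightarrow> int \<Rightarrow> int \<Rightarrow> int \<Rightarrow> real. \<Sum>a\<in>J. \<Sum>b\<in>J. \<Sum>c\<in>J. \<Sum>d\<in>J. F a b c d"
  have "(\<Sum>x\<in>X. real_of_int (char_sum S h x) ^ 4) = (\<Sum>x\<in>X. ?S4 (\<lambda>a b c d. f x a * f x b * f x c * f x d))"
    by (simp add: char_sum_def f_def J_def sum_power4[symmetric])
  also have "\<dots> = ?S4 E"
    unfolding E_def
    by (subst sum.swap, rule sum.cong[OF refl], subst sum.swap, rule sum.cong[OF refl],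
        subst sum.swap, rule sum.cong[OF refl], subst sum.swap, rule refl)
  also have "\<dots> \<le> ?S4 (\<lambda>a b c d. D * (\<delta> a b * \<delta> c d + \<delta> a c * \<delta> b d + \<delta> a d * \<delta> b c)
      + K * (\<gamma> a b * \<gamma> a c * \<gamma> a d + \<gamma> b a * \<gamma> b c * \<gamma> b d + \<gamma> c a * \<gamma> c b * \<gamma> c d + \<gamma> d a * \<gamma> d b * \<gamma> d c))"
    by (intro sum_mono E_bound)
  also have "\<dots> = D * (?S4 (\<lambda>a b c d. \<delta> a b * \<delta> c d) + ?S4 (\<lambda>a b c d. \<delta> a c * \<delta> b d) + ?S4 (\<lambda>a b c d. \<delta> a d * \<delta> b c))
      + K * (?S4 (\<lambda>a b c d. \<gamma> a b * \<gamma> a c * \<gamma> a d) + ?S4 (\<lambda>a b c d. \<gamma> b a * \<gamma> b c * \<gamma> b d)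
        + ?S4 (\<lambda>a b c d. \<gamma> c a * \<gamma> c b * \<gamma> c d) + ?S4 (\<lambda>a b c d. \<gamma> d a * \<gamma> d b * \<gamma> d c))"
    by (simp only: sum.distrib sum_distrib_left[symmetric])
  also have "\<dots> = D * (3 * real h ^ 2) + K * (4 * (\<Sum>a\<in>J. (\<Sum>b\<in>J. \<gamma> a b) ^ 3))"
  proof -
    have d1: "(\<Sum>b\<in>J. \<delta> a b) = 1" if "a \<in> J" for a
    proof -
      have "(\<Sum>b\<in>J. \<delta> a b) = (\<Sum>b\<in>J. if a = b then 1 else 0)" unfolding \<delta>_def by (intro sum.cong) auto
      then show ?thesis using that by (simp add: J_def)
    qed
    have cJ: "(\<Sum>a\<in>J. 1) = real h" by (simp add: J_def)
    have d2: "(\<Sum>a\<in>J. \<Sum>b\<in>J. \<delta> a b) = real h" using cJ by (simp add: d1)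
    have A1: "?S4 (\<lambda>a b c d. \<delta> a b * \<delta> c d) = real h ^ 2"
    proof -
      have "real h ^ 2 = (\<Sum>a\<in>J. \<Sum>b\<in>J. \<delta> a b * (\<Sum>c\<in>J. \<Sum>d\<in>J. \<delta> c d))"
        by (simp only: power2_eq_square d2 sum_distrib_right[symmetric])
      then show ?thesis by (simp only: sum_distrib_left)
    qed
    have A2: "?S4 (\<lambda>a b c d. \<delta> a c * \<delta> b d) = real h ^ 2"
    proof -
      have "?S4 (\<lambda>a b c d. \<delta> a c * \<delta> b d) = (\<Sum>a\<in>J. \<Sum>b\<in>J. (\<Sum>c\<in>J. \<delta> a c) * (\<Sum>d\<in>J. \<delta> b d))"
        by (simp only: sum_product)
      also have "\<dots> = (\<Sum>a\<in>J. \<Sum>b\<in>J. 1)" by (intro sum.cong refl) (simp add: d1)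
      finally show ?thesis by (simp add: J_def power2_eq_square)
    qed
    have A3: "?S4 (\<lambda>a b c d. \<delta> a d * \<delta> b c) = real h ^ 2"
    proof -
      have "?S4 (\<lambda>a b c d. \<delta> a d * \<delta> b c) = ?S4 (\<lambda>a b c d. \<delta> a c * \<delta> b d)"
        by (rule sum.cong[OF refl], rule sum.cong[OF refl], rule sum.swap)
      then show ?thesis using A2 by simp
    qed
    have B1: "?S4 (\<lambda>a b c d. \<gamma> a b * \<gamma> a c * \<gamma> a d) = (\<Sum>a\<in>J. (\<Sum>b\<in>J. \<gamma> a b) ^ 3)"
      by (simp only: sum_power3)
    have B2: "?S4 (\<lambda>a b c d. \<gamma> b a * \<gamma> b c * \<gamma> b d) = ?S4 (\<lambda>a b c d. \<gamma> a b * \<gamma> a c * \<gamma> a d)"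
      by (rule sum.swap)
    have B3: "?S4 (\<lambda>a b c d. \<gamma> c a * \<gamma> c b * \<gamma> c d) = ?S4 (\<lambda>a b c d. \<gamma> b a * \<gamma> b c * \<gamma> b d)"
      by (rule sum.cong[OF refl], rule sum.swap)
    have B4: "?S4 (\<lambda>a b c d. \<gamma> d a * \<gamma> d b * \<gamma> d c) = ?S4 (\<lambda>a b c d. \<gamma> c a * \<gamma> c b * \<gamma> c d)"
      by (rule sum.cong[OF refl], rule sum.cong[OF refl], rule sum.swap)
    show ?thesis unfolding A1 A2 A3 B4 B3 B2 B1 by simp
  qed
  also have "(\<Sum>a\<in>J. (\<Sum>b\<in>J. \<gamma> a b) ^ 3) \<le> (\<Sum>a\<in>J. (2 * real h * 2 ^ card S) ^ 3)"
  proof (intro sum_mono power_mono)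
    fix a assume "a \<in> J"
    then show "(\<Sum>b\<in>J. \<gamma> a b) \<le> 2 * real h * 2 ^ card S"
      unfolding J_def \<gamma>_def using sum_gcd_shift_le[of S a h] S by blast
    show "0 \<le> (\<Sum>b\<in>J. \<gamma> a b)" by (intro sum_nonneg \<gamma>0)
  qed
  also have "(\<Sum>a\<in>J. (2 * real h * 2 ^ card S) ^ 3) = 8 * 8 ^ card S * real h ^ 4"
  proof -
    have "((2::real) ^ card S) ^ 3 = 8 ^ card S" 
    proof -
      have "((2::real) ^ card S) ^ 3 = (2 ^ 3) ^ card S" by (simp only: power_mult[symmetric] mult.commute)
      then show ?thesis by simp
    qed
    then show ?thesis by (simp add: J_def power_mult_distrib power4_eq_xxxx power3_eq_cube)
  qed
  finally have "(\<Sum>x\<in>X. real_of_int (char_sum S h x) ^ 4)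
     \<le> D * (3 * real h ^ 2) + K * (4 * (8 * 8 ^ card S * real h ^ 4))"
    using D0 by (simp add: mult_left_mono)
  also have "\<dots> = 3 * D * real h ^ 2 + 32 * 544 ^ card S * sqrt D * real h ^ 4"
  proof -
    have "(544::real) ^ card S = 68 ^ card S * 8 ^ card S" by (simp add: power_mult_distrib[symmetric])
    then show ?thesis by (simp add: K_def)
  qed
  finally show ?thesis by (simp add: X_def D_def del: of_nat_prod)
qed

section \<open>The shift argument of Burgess\<close>

lemma chi_mult:
  assumes "\<And>p. p \<in> S \<Longrightarrow> prime p \<and> p > 2"
  shows "chi S (a * b) = chi S a * chi S b"
  unfolding chi_def prod.distrib[symmetric]
  by (rule prod.cong[OF refl]) (use assms Legendre_mult in blast)

lemma char_sum_Suc: "char_sum S (Suc h) x = char_sum S h x + chi S (x + int h + 1)"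
proof -
  have "{1..int (Suc h)} = insert (int h + 1) {1..int h}" by auto
  then show ?thesis by (simp add: char_sum_def add.assoc)
qed

lemma char_sum_shift_1:
  "char_sum S h (x + 1) = char_sum S h x + chi S (x + int h + 1) - chi S (x + 1)"
proof (induction h)
  case 0
  show ?case by (simp add: char_sum_def)
next
  case (Suc h)
  have "x + 1 + int h + 1 = x + int (Suc h) + 1" by simp
  then show ?case unfolding char_sum_Suc Suc by simp
qed

lemma char_sum_shift:
  "\<bar>char_sum S h (x + int k) - char_sum S h x\<bar> \<le> 2 * int k"
proof (induction k)
  case (Suc k)
  have "char_sum S h (x + int (Suc k)) = char_sum S h (x + int k) + chi S (x + int k + int h + 1) - chi S (x + int k + 1)"
  proof -
    have "x + int (Suc k) = x + int k + 1" by simp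
    then show ?thesis by (simp only: char_sum_shift_1)
  qed
  then show ?case
    using Suc abs_chi_le_1[of S "x + int k + int h + 1"] abs_chi_le_1[of S "x + int k + 1"] by simp
qed simp

lemma card_divisors_le_sqrt:
  fixes n :: nat
  assumes "n > 0"
  shows "real (card {e. e dvd n}) \<le> 2 * sqrt (real n)"
proof -
  define s where "s = nat \<lfloor>sqrt (real n)\<rfloor>"
  have s: "real s \<le> sqrt (real n)" by (simp add: s_def)
  have small: "e \<le> s" if "real e \<le> sqrt (real n)" for e
    using that by (simp add: s_def le_nat_iff le_floor_iff)
  have "{e. e dvd n} \<subseteq> {1..s} \<union> (\<lambda>e. n div e) ` {1..s}"
  proof
    fix e assume "e \<in> {e. e dvd n}"
    then obtain k where k: "n = e * k" by auto
    have pos: "e > 0" "k > 0" using assms k by auto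
    show "e \<in> {1..s} \<union> (\<lambda>e. n div e) ` {1..s}"
    proof (cases "real e \<le> sqrt (real n)")
      case True
      then show ?thesis using small pos by (auto simp: Suc_le_eq)
    next
      case False
      have "real k \<le> sqrt (real n)"
      proof (rule ccontr)
        assume "\<not> ?thesis"
        then have "sqrt (real n) * sqrt (real n) < real e * real k"
          using False pos by (intro mult_strict_mono) auto
        then show False using k by simp
      qed
      then have "k \<in> {1..s}" using small pos by (auto simp: Suc_le_eq)
      moreover have "e = n div k" using k pos by simp
      ultimately show ?thesis by blast
    qed
  qed
  then have "card {e. e dvd n} \<le> card ({1..s} \<union> (\<lambda>e. n div e) ` {1..s})" by (intro card_mono) auto
  also have "\<dots> \<le> card {1..s} + card ((\<lambda>e. n div e) ` {1..s})" by (rule card_Un_le)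
  also have "\<dots> \<le> s + s" using card_image_le[of "{1..s}" "\<lambda>e. n div e"] by simp
  finally show ?thesis using s by linarith
qed

lemma card_residue_class_le:
  fixes C :: "int set" and k :: int
  assumes k: "k > 0" and C: "C \<subseteq> {1..int h}" and dv: "\<And>x y. x \<in> C \<Longrightarrow> y \<in> C \<Longrightarrow> k dvd x - y"
  shows "real (card C) \<le> real h / real_of_int k + 1"
proof -
  have inj: "inj_on (\<lambda>c. c div k) C"
  proof (rule inj_onI)
    fix x y assume xy: "x \<in> C" "y \<in> C" "x div k = y div k"
    then have "x mod k = y mod k" using dv by (simp add: mod_eq_dvd_iff)
    then show "x = y" using xy(3) by (metis div_mult_mod_eq)
  qed
  have "(\<lambda>c. c div k) ` C \<subseteq> {0..int h div k}"
    using C k by (auto simp: pos_imp_zdiv_nonneg_iff intro!: zdiv_mono1)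
  then have "card ((\<lambda>c. c div k) ` C) \<le> card {0..int h div k}" by (intro card_mono) auto
  then have "int (card C) \<le> int h div k + 1"
  proof -
    have "int h div k \<ge> 0" using k by (simp add: pos_imp_zdiv_nonneg_iff)
    moreover have "card {0..int h div k} = nat (int h div k + 1)" by simp
    ultimately show ?thesis using \<open>card ((\<lambda>c. c div k) ` C) \<le> card {0..int h div k}\<close> card_image[OF inj] by linarith
  qed
  moreover have "real_of_int (int h div k) \<le> real h / real_of_int k"
    by (metis floor_divide_of_int_eq of_int_floor_le of_int_of_nat_eq)
  ultimately show ?thesis by linarith
qed

text \<open>A coincidence (x + j)/a = (x + j')/a' modulo d is linear in j and j'. Subtracting two
  solutions eliminates x, and since 4 \<open>A\<^sub>0\<close> h <= d the resulting congruence a'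
  (j1 - j2) = a (j1' - j2') is an equality of integers. Hence j' is determined by j, and all j lie
  in one residue class modulo a / gcd(a, a').\<close>

lemma burgess_solution_count:
  fixes d :: int and a a' h A\<^sub>0 :: nat and u u' :: "int \<Rightarrow> int"
  assumes a: "A\<^sub>0 < a" "a \<le> 2 * A\<^sub>0" and a': "A\<^sub>0 < a'" "a' \<le> 2 * A\<^sub>0"
    and d: "4 * int A\<^sub>0 * int h \<le> d"
    and u: "\<And>j. [int a * u j = x + j] (mod d)" "\<And>j. [int a' * u' j = x + j] (mod d)"
  shows "real (card {(j, j'). j \<in> {1..int h} \<and> j' \<in> {1..int h} \<and> u j = u' j'})
    \<le> real h * real (gcd a a') / real A\<^sub>0 + 1"
proof -
  define Sol where "Sol = {(j, j'). j \<in> {1..int h} \<and> j' \<in> {1..int h} \<and> u j = u' j'}"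
  have A0: "A\<^sub>0 > 0" using a by auto
  have key: "int a' * (j1 - j2) = int a * (j1' - j2')" if s: "(j1, j1') \<in> Sol" "(j2, j2') \<in> Sol" for j1 j1' j2 j2'
  proof -
    have lin: "[int a' * (x + j) = int a * (x + j')] (mod d)" if "(j, j') \<in> Sol" for j j'
    proof -
      have e: "u j = u' j'" using that by (simp add: Sol_def)
      have "[int a' * (x + j) = int a' * (int a * u j)] (mod d)" by (intro cong_mult cong_refl cong_sym[OF u(1)])
      also have "int a' * (int a * u j) = int a * (int a' * u' j')" using e by simp
      also have "[int a * (int a' * u' j') = int a * (x + j')] (mod d)" by (intro cong_mult cong_refl u(2))
      finally show ?thesis .
    qed
    have "[int a' * (x + j1) - int a' * (x + j2) = int a * (x + j1') - int a * (x + j2')] (mod d)"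
      by (intro cong_diff lin s)
    then have dv: "d dvd int a' * (j1 - j2) - int a * (j1' - j2')"
      by (simp add: cong_iff_dvd_diff algebra_simps)
    have h: "\<bar>j1 - j2\<bar> < int h" "\<bar>j1' - j2'\<bar> < int h" using s by (auto simp: Sol_def)
    have b: "\<bar>int e * y\<bar> < 2 * int A\<^sub>0 * int h" if "e \<le> 2 * A\<^sub>0" "\<bar>y\<bar> < int h" for e y
    proof -
      have "\<bar>int e * y\<bar> = int e * \<bar>y\<bar>" by (simp add: abs_mult)
      also have "\<dots> \<le> 2 * int A\<^sub>0 * \<bar>y\<bar>" using that by (intro mult_right_mono) auto
      also have "\<dots> < 2 * int A\<^sub>0 * int h" using that A0 by (intro mult_strict_left_mono) auto
      finally show ?thesis .
    qed
    have "\<bar>int a' * (j1 - j2) - int a * (j1' - j2')\<bar> < d"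
      using b[OF a'(2) h(1)] b[OF a(2) h(2)] d by linarith
    then have "int a' * (j1 - j2) - int a * (j1' - j2') = 0"
      using dv dvd_imp_le_int[of "int a' * (j1 - j2) - int a * (j1' - j2')" d] by linarith
    then show ?thesis by simp
  qed
  have inj: "inj_on fst Sol"
  proof (rule inj_onI, clarsimp)
    fix j j' j2' assume s: "(j, j') \<in> Sol" "(j, j2') \<in> Sol"
    from key[OF this] have "int a * (j' - j2') = 0" by simp
    then show "j' = j2'" using a by simp
  qed
  define g where "g = gcd a a'"
  have g0: "g > 0" using a by (simp add: g_def)
  obtain k k' where k: "a = k * g" "a' = k' * g" "coprime k k'"
    using gcd_coprime_exists[of a a'] g0 unfolding g_def by auto
  have k0: "k > 0" using k a by (cases k) auto
  have "real (card (fst ` Sol)) \<le> real h / real_of_int (int k) + 1"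
  proof (rule card_residue_class_le)
    show "int k > 0" using k0 by simp
    show "fst ` Sol \<subseteq> {1..int h}" by (auto simp: Sol_def)
    fix j1 j2 assume "j1 \<in> fst ` Sol" "j2 \<in> fst ` Sol"
    then obtain j1' j2' where s: "(j1, j1') \<in> Sol" "(j2, j2') \<in> Sol" by auto
    from key[OF s] have "int g * (int k' * (j1 - j2)) = int g * (int k * (j1' - j2'))"
      by (simp add: k mult.assoc mult.left_commute mult.commute)
    then have "int k' * (j1 - j2) = int k * (j1' - j2')" using g0 by simp
    then have "int k dvd int k' * (j1 - j2)" by simp
    moreover have "coprime (int k) (int k')" using k by simp
    ultimately show "int k dvd j1 - j2" by (simp add: coprime_dvd_mult_right_iff)
  qed
  also have "card (fst ` Sol) = card Sol" by (rule card_image[OF inj])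
  also have "real h / real_of_int (int k) \<le> real h * real g / real A\<^sub>0"
  proof -
    have "real A\<^sub>0 \<le> real k * real g" using a(1) k(1) by (metis of_nat_le_iff of_nat_mult less_imp_le)
    then have "real h * real A\<^sub>0 \<le> real h * (real k * real g)" by (intro mult_left_mono) auto
    then show ?thesis using k0 A0 by (simp add: divide_simps mult.assoc mult.left_commute mult.commute)
  qed
  finally show ?thesis by (simp add: Sol_def g_def)
qed

text \<open>The crude divisor bound 2 sqrt(a) gives away a factor sqrt(\<open>A\<^sub>0\<close>)
  compared with the diagonal-free heuristic; the remaining saving of sqrt(\<open>A\<^sub>0\<close>)
  is enough because \<open>A\<^sub>0\<close> will be a large power of L.\<close>

lemma sum_gcd_dyadic:
  assumes "A\<^sub>0 > 0"
  shows "(\<Sum>a\<in>{A\<^sub>0<..2*A\<^sub>0}. \<Sum>a'\<in>{A\<^sub>0<..2*A\<^sub>0}. real (gcd a a')) \<le> 6 * real A\<^sub>0 ^ 2 * sqrt (real A\<^sub>0)"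
proof -
  have s2: "sqrt (real (2 * A\<^sub>0)) \<le> 3 / 2 * sqrt (real A\<^sub>0)"
  proof -
    have "sqrt 2 \<le> 3 / 2" by (rule real_le_lsqrt) (auto simp: power2_eq_square)
    then have "sqrt 2 * sqrt (real A\<^sub>0) \<le> 3 / 2 * sqrt (real A\<^sub>0)" by (intro mult_right_mono) auto
    then show ?thesis by (simp add: real_sqrt_mult)
  qed
  have "(\<Sum>a'\<in>{A\<^sub>0<..2*A\<^sub>0}. real (gcd a a')) \<le> 6 * real A\<^sub>0 * sqrt (real A\<^sub>0)" if a: "a \<in> {A\<^sub>0<..2*A\<^sub>0}" for a
  proof -
    have a0: "a > 0" using a by auto
    have "(\<Sum>a'\<in>{A\<^sub>0<..2*A\<^sub>0}. real (gcd a a')) \<le> (\<Sum>a'\<in>{1..2*A\<^sub>0}. real (gcd a a'))"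
      by (intro sum_mono2) auto
    also have "\<dots> = real (\<Sum>a'\<in>{1..2*A\<^sub>0}. gcd a a')" by simp
    also have "\<dots> \<le> real (2 * A\<^sub>0 * card {e. e dvd a})" using sum_gcd_le[OF a0] by (simp only: of_nat_le_iff)
    also have "\<dots> \<le> 2 * real A\<^sub>0 * (2 * sqrt (real a))"
      using mult_left_mono[OF card_divisors_le_sqrt[OF a0], of "2 * real A\<^sub>0"] by simp
    also have "\<dots> \<le> 2 * real A\<^sub>0 * (2 * (3 / 2 * sqrt (real A\<^sub>0)))"
    proof (intro mult_left_mono)
      have "sqrt (real a) \<le> sqrt (real (2 * A\<^sub>0))" using a by (intro real_sqrt_le_mono) auto
      then show "sqrt (real a) \<le> 3 / 2 * sqrt (real A\<^sub>0)" using s2 by linarith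
    qed auto
    finally show ?thesis by simp
  qed
  then have "(\<Sum>a\<in>{A\<^sub>0<..2*A\<^sub>0}. \<Sum>a'\<in>{A\<^sub>0<..2*A\<^sub>0}. real (gcd a a'))
    \<le> (\<Sum>a\<in>{A\<^sub>0<..2*A\<^sub>0}. 6 * real A\<^sub>0 * sqrt (real A\<^sub>0))" by (rule sum_mono)
  also have "\<dots> = 6 * real A\<^sub>0 ^ 2 * sqrt (real A\<^sub>0)" by (simp add: power2_eq_square)
  finally show ?thesis .
qed

text \<open>Averaging over the shifted intervals x + a b turns one character sum of length h into
  many sums of length \<open>B\<^sub>0\<close>, whose starting points (x + j)/a rarely coincide.
  They can therefore be estimated by the fourth moment over all starting points modulo d. The term 4
  (\<open>A\<^sub>0\<close> \<open>B\<^sub>0\<close>)^2 is the price of the shifts.\<close>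

lemma burgess_inequality:
  fixes S :: "nat set" and h A\<^sub>0 B\<^sub>0 :: nat
  assumes S: "finite S" "\<And>p. p \<in> S \<Longrightarrow> prime p \<and> p > 2 \<and> p > 2 * A\<^sub>0"
    and A0: "A\<^sub>0 > 0" "A\<^sub>0 \<le> h" and d: "4 * A\<^sub>0 * h \<le> \<Prod>S"
  shows "\<exists>X\<ge>0. real A\<^sub>0 * real B\<^sub>0 * \<bar>real_of_int (char_sum S h x)\<bar> \<le> X + 4 * (real A\<^sub>0 * real B\<^sub>0) ^ 2 \<and>
    X ^ 4 \<le> (real A\<^sub>0 * real h) ^ 2 * (7 * real h * real A\<^sub>0 * sqrt (real A\<^sub>0)) *
      (3 * real (\<Prod>S) * real B\<^sub>0 ^ 2 + 32 * 544 ^ card S * sqrt (real (\<Prod>S)) * real B\<^sub>0 ^ 4)"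
proof -
  define D where "D = \<Prod>S"
  have Sp: "\<And>p. p \<in> S \<Longrightarrow> prime p \<and> p > 2" using S by blast
  have D0: "D > 0" unfolding D_def using prod_primes_pos[of S] S by blast
  define AA where "AA = {A\<^sub>0<..2*A\<^sub>0}"
  define JJ where "JJ = {1..int h}"
  have cAA: "card AA = A\<^sub>0" by (simp add: AA_def)
  have fin: "finite AA" "finite JJ" by (auto simp: AA_def JJ_def)
  \<comment> \<open>The multipliers are at most 2 \<open>A\<^sub>0\<close>, hence smaller than every
    prime of S and invertible modulo d.\<close>
  have "\<exists>i. [int a * i = 1] (mod int D)" if "a \<in> AA" for a
  proof -
    have "coprime a p" if "p \<in> S" for p
    proof -
      have "\<not> p dvd a" using S(2)[OF \<open>p \<in> S\<close>] \<open>a \<in> AA\<close> by (auto simp: AA_def dest!: dvd_imp_le)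
      then show ?thesis using S(2)[OF \<open>p \<in> S\<close>] by (metis coprime_commute prime_imp_coprime)
    qed
    then have "coprime a D" unfolding D_def by (rule prod_coprime_right)
    then have "coprime (int a) (int D)" by simp
    then show ?thesis by (rule cong_solve_coprime_int)
  qed
  then obtain iv where iv: "\<And>a. a \<in> AA \<Longrightarrow> [int a * iv a = 1] (mod int D)" by metis
  define u where "u a j = (iv a * (x + j)) mod int D" for a j
  have au: "[int a * u a j = x + j] (mod int D)" if "a \<in> AA" for a j
  proof -
    have "[int a * u a j = int a * (iv a * (x + j))] (mod int D)"
      unfolding u_def by (intro cong_mult cong_refl) (simp add: cong_def)
    also have "int a * (iv a * (x + j)) = int a * iv a * (x + j)" by simp
    also have "[int a * iv a * (x + j) = 1 * (x + j)] (mod int D)" by (intro cong_mult iv that cong_refl)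
    finally show ?thesis by simp
  qed
  define Z where "Z y = real_of_int (char_sum S B\<^sub>0 y)" for y
  define V where "V = char_sum S h x"
  define I where "I = AA \<times> JJ"
  define uu where "uu i = u (fst i) (snd i)" for i
  define X where "X = (\<Sum>i\<in>I. \<bar>Z (uu i)\<bar>)"
  have finI: "finite I" and cI: "card I = A\<^sub>0 * h" using fin cAA by (auto simp: I_def JJ_def)

  \<comment> \<open>With u = (x + j)/a modulo d, x + a b + j is congruent to a (u + b); for fixed a
    and j the sum over b is a character sum of length \<open>B\<^sub>0\<close> starting at
    u.\<close>
  have split: "(\<Sum>b\<in>{1..int B\<^sub>0}. chi S (x + int a * b + j)) = chi S (int a) * char_sum S B\<^sub>0 (u a j)"
    if "a \<in> AA" for a j
  proof -
    have "chi S (x + int a * b + j) = chi S (int a) * chi S (u a j + b)" for b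
    proof -
      have "[x + j + int a * b = int a * u a j + int a * b] (mod int D)"
        by (intro cong_add cong_refl cong_sym[OF au[OF that]])
      then have "[x + int a * b + j = int a * (u a j + b)] (mod int (\<Prod>S))"
        by (simp add: D_def algebra_simps del: of_nat_prod)
      from chi_cong[OF S(1) this] show ?thesis using chi_mult[OF Sp] by simp
    qed
    then show ?thesis by (simp add: char_sum_def sum_distrib_left)
  qed
  have "real A\<^sub>0 * real B\<^sub>0 * \<bar>real_of_int V\<bar> \<le> X + 4 * (real A\<^sub>0 * real B\<^sub>0) ^ 2"
  proof -
    define W where "W a b = char_sum S h (x + int a * b)" for a b
    have "\<bar>\<Sum>a\<in>AA. \<Sum>b\<in>{1..int B\<^sub>0}. W a b\<bar> = \<bar>\<Sum>a\<in>AA. \<Sum>j\<in>JJ. \<Sum>b\<in>{1..int B\<^sub>0}. chi S (x + int a * b + j)\<bar>"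
      unfolding W_def char_sum_def JJ_def[symmetric] by (subst sum.swap) (rule refl)
    also have "\<dots> = \<bar>\<Sum>a\<in>AA. \<Sum>j\<in>JJ. chi S (int a) * char_sum S B\<^sub>0 (u a j)\<bar>"
      by (simp add: split)
    also have "\<dots> \<le> (\<Sum>a\<in>AA. \<bar>\<Sum>j\<in>JJ. chi S (int a) * char_sum S B\<^sub>0 (u a j)\<bar>)" by (rule sum_abs)
    also have "\<dots> \<le> (\<Sum>a\<in>AA. \<Sum>j\<in>JJ. \<bar>char_sum S B\<^sub>0 (u a j)\<bar>)"
    proof (intro sum_mono order.trans[OF sum_abs])
      fix a j
      show "\<bar>chi S (int a) * char_sum S B\<^sub>0 (u a j)\<bar> \<le> \<bar>char_sum S B\<^sub>0 (u a j)\<bar>"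
        unfolding abs_mult using abs_chi_le_1[of S "int a"] by (simp add: mult_left_le_one_le)
    qed
    finally have 1: "\<bar>real_of_int (\<Sum>a\<in>AA. \<Sum>b\<in>{1..int B\<^sub>0}. W a b)\<bar> \<le> X"
    proof -
      assume "\<bar>\<Sum>a\<in>AA. \<Sum>b\<in>{1..int B\<^sub>0}. W a b\<bar> \<le> (\<Sum>a\<in>AA. \<Sum>j\<in>JJ. \<bar>char_sum S B\<^sub>0 (u a j)\<bar>)"
      then have "\<bar>real_of_int (\<Sum>a\<in>AA. \<Sum>b\<in>{1..int B\<^sub>0}. W a b)\<bar> \<le> real_of_int (\<Sum>a\<in>AA. \<Sum>j\<in>JJ. \<bar>char_sum S B\<^sub>0 (u a j)\<bar>)"
        by linarith
      also have "\<dots> = X" by (simp add: X_def I_def sum.cartesian_product split_def Z_def uu_def)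
      finally show ?thesis .
    qed
    have "\<bar>(\<Sum>a\<in>AA. \<Sum>b\<in>{1..int B\<^sub>0}. V) - (\<Sum>a\<in>AA. \<Sum>b\<in>{1..int B\<^sub>0}. W a b)\<bar> = \<bar>\<Sum>a\<in>AA. \<Sum>b\<in>{1..int B\<^sub>0}. V - W a b\<bar>"
      by (simp only: sum_subtractf)
    also have "\<dots> \<le> (\<Sum>a\<in>AA. \<Sum>b\<in>{1..int B\<^sub>0}. 4 * int A\<^sub>0 * int B\<^sub>0)"
    proof (intro order.trans[OF sum_abs] sum_mono)
      \<comment> \<open>Moving an interval by a b, at most 2 \<open>A\<^sub>0\<close>
        \<open>B\<^sub>0\<close>, changes its character sum by at most twice that amount.\<close>
      fix a b assume ab: "a \<in> AA" "b \<in> {1..int B\<^sub>0}"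
      then have e: "int a * b = int (a * nat b)" by simp
      have "\<bar>W a b - V\<bar> \<le> 2 * int (a * nat b)" unfolding W_def V_def e by (rule char_sum_shift)
      also have "\<dots> = 2 * (int a * b)" by (simp only: e)
      also have "int a * b \<le> (2 * int A\<^sub>0) * int B\<^sub>0" using ab by (intro mult_mono) (auto simp: AA_def)
      finally show "\<bar>V - W a b\<bar> \<le> 4 * int A\<^sub>0 * int B\<^sub>0" by linarith
    qed
    also have "\<dots> = int A\<^sub>0 * int B\<^sub>0 * (4 * int A\<^sub>0 * int B\<^sub>0)" by (simp add: cAA)
    finally have 2: "\<bar>int A\<^sub>0 * int B\<^sub>0 * V - (\<Sum>a\<in>AA. \<Sum>b\<in>{1..int B\<^sub>0}. W a b)\<bar> \<le> int A\<^sub>0 * int B\<^sub>0 * (4 * int A\<^sub>0 * int B\<^sub>0)"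
      by (simp add: cAA)
    have "\<bar>real_of_int (int A\<^sub>0 * int B\<^sub>0 * V) - real_of_int (\<Sum>a\<in>AA. \<Sum>b\<in>{1..int B\<^sub>0}. W a b)\<bar>
        \<le> real_of_int (int A\<^sub>0 * int B\<^sub>0 * (4 * int A\<^sub>0 * int B\<^sub>0))"
      using 2 by linarith
    then have "\<bar>real_of_int (int A\<^sub>0 * int B\<^sub>0 * V)\<bar> \<le> X + real_of_int (int A\<^sub>0 * int B\<^sub>0 * (4 * int A\<^sub>0 * int B\<^sub>0))"
      using 1 by linarith
    then show ?thesis by (simp add: abs_mult power2_eq_square)
  qed
  moreover have "X ^ 4 \<le> (real A\<^sub>0 * real h) ^ 2 * (7 * real h * real A\<^sub>0 * sqrt (real A\<^sub>0)) *
      (3 * real D * real B\<^sub>0 ^ 2 + 32 * 544 ^ card S * sqrt (real D) * real B\<^sub>0 ^ 4)"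
  proof -
    define Y where "Y = {0..<int D}"
    define \<nu> where "\<nu> y = real (card {i \<in> I. uu i = y})" for y
    have img: "uu ` I \<subseteq> Y" using D0 by (auto simp: uu_def u_def Y_def)
    have finY: "finite Y" by (simp add: Y_def)
    have group: "(\<Sum>i\<in>I. g (uu i)) = (\<Sum>y\<in>Y. \<nu> y * g y)" for g :: "int \<Rightarrow> real"
    proof -
      have "(\<Sum>i\<in>I. g (uu i)) = (\<Sum>y\<in>Y. \<Sum>i\<in>{i \<in> I. uu i = y}. g (uu i))"
        by (rule sum.group[OF finI finY img, symmetric])
      also have "\<dots> = (\<Sum>y\<in>Y. \<nu> y * g y)" by (intro sum.cong refl) (simp add: \<nu>_def)
      finally show ?thesis .
    qed
    \<comment> \<open>Two applications of Cauchy-Schwarz serve as Hoelder's inequality: X^4 is at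
      most |I|^2 times the second moment of the multiplicities nu times the fourth moment of
      Z.\<close>
    have "X ^ 2 = (\<Sum>i\<in>I. 1 * \<bar>Z (uu i)\<bar>) ^ 2" by (simp add: X_def)
    also have "\<dots> \<le> (\<Sum>i\<in>I. 1 ^ 2) * (\<Sum>i\<in>I. \<bar>Z (uu i)\<bar> ^ 2)" by (rule Cauchy_Schwarz_ineq_sum)
    also have "\<dots> = real (A\<^sub>0 * h) * (\<Sum>y\<in>Y. \<nu> y * Z y ^ 2)"
      using group[of "\<lambda>y. Z y ^ 2"] by (simp add: cI)
    finally have "(X ^ 2) ^ 2 \<le> (real (A\<^sub>0 * h) * (\<Sum>y\<in>Y. \<nu> y * Z y ^ 2)) ^ 2"
      by (intro power_mono) auto
    also have "\<dots> = (real A\<^sub>0 * real h) ^ 2 * (\<Sum>y\<in>Y. \<nu> y * Z y ^ 2) ^ 2" by (simp add: power_mult_distrib)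
    also have "(\<Sum>y\<in>Y. \<nu> y * Z y ^ 2) ^ 2 \<le> (\<Sum>y\<in>Y. \<nu> y ^ 2) * (\<Sum>y\<in>Y. (Z y ^ 2) ^ 2)"
      by (rule Cauchy_Schwarz_ineq_sum)
    also have "(\<Sum>y\<in>Y. (Z y ^ 2) ^ 2) = (\<Sum>y\<in>Y. Z y ^ 4)" by (simp add: power_mult[symmetric])
    finally have main: "(X ^ 2) ^ 2 \<le> (real A\<^sub>0 * real h) ^ 2 * ((\<Sum>y\<in>Y. \<nu> y ^ 2) * (\<Sum>y\<in>Y. Z y ^ 4))"
      by (simp add: mult_left_mono)
    have Z4: "(\<Sum>y\<in>Y. Z y ^ 4) \<le> 3 * real D * real B\<^sub>0 ^ 2 + 32 * 544 ^ card S * sqrt (real D) * real B\<^sub>0 ^ 4"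
      unfolding Y_def Z_def D_def by (rule fourth_moment) (use S in auto)
    \<comment> \<open>The second moment of nu counts coincidences u(a, j) = u(a', j'), which are
      estimated for each pair a, a'. In 7 = 6 + 1 the 6 belongs to the gcd sum, and the 1 to the
      summand 1 per pair, by \<open>A\<^sub>0\<close> <= h.\<close>
    have \<nu>2: "(\<Sum>y\<in>Y. \<nu> y ^ 2) \<le> 7 * real h * real A\<^sub>0 * sqrt (real A\<^sub>0)"
    proof -
      have "(\<Sum>y\<in>Y. \<nu> y ^ 2) = (\<Sum>i\<in>I. \<nu> (uu i))" using group[of \<nu>] by (simp add: power2_eq_square)
      also have "\<dots> = (\<Sum>i\<in>I. \<Sum>i'\<in>I. of_bool (uu i' = uu i))"
        unfolding \<nu>_def using finI by (intro sum.cong refl) (simp add: Int_def)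
      also have "\<dots> = (\<Sum>a\<in>AA. \<Sum>j\<in>JJ. \<Sum>a'\<in>AA. \<Sum>j'\<in>JJ. of_bool (u a' j' = u a j))"
      proof -
        have carI: "(\<Sum>i\<in>I. F (uu i)) = (\<Sum>a\<in>AA. \<Sum>j\<in>JJ. F (u a j))" for F :: "int \<Rightarrow> real"
          by (simp add: I_def sum.cartesian_product uu_def split_def)
        have "(\<Sum>i'\<in>I. of_bool (uu i' = y)) = (\<Sum>a'\<in>AA. \<Sum>j'\<in>JJ. (of_bool (u a' j' = y) :: real))" for y
          by (rule carI[where F = "\<lambda>v. of_bool (v = y)"])
        then show ?thesis using carI[where F = "\<lambda>y. \<Sum>a'\<in>AA. \<Sum>j'\<in>JJ. of_bool (u a' j' = y)"] by simp
      qed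
      also have "\<dots> = (\<Sum>a\<in>AA. \<Sum>a'\<in>AA. \<Sum>j\<in>JJ. \<Sum>j'\<in>JJ. of_bool (u a' j' = u a j))"
        by (rule sum.cong[OF refl], rule sum.swap)
      also have "\<dots> = (\<Sum>a\<in>AA. \<Sum>a'\<in>AA. real (card {(j, j'). j \<in> {1..int h} \<and> j' \<in> {1..int h} \<and> u a j = u a' j'}))"
      proof (intro sum.cong refl)
        fix a a'
        have "(\<Sum>j\<in>JJ. \<Sum>j'\<in>JJ. (of_bool (u a' j' = u a j) :: real)) = (\<Sum>z\<in>JJ \<times> JJ. of_bool (u a' (snd z) = u a (fst z)))"
          by (simp add: sum.cartesian_product split_def)
        also have "\<dots> = real (card ((JJ \<times> JJ) \<inter> {z. u a' (snd z) = u a (fst z)}))" using fin by simp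
        also have "(JJ \<times> JJ) \<inter> {z. u a' (snd z) = u a (fst z)} = {(j, j'). j \<in> {1..int h} \<and> j' \<in> {1..int h} \<and> u a j = u a' j'}"
          by (auto simp: JJ_def)
        finally show "(\<Sum>j\<in>JJ. \<Sum>j'\<in>JJ. (of_bool (u a' j' = u a j) :: real))
          = real (card {(j, j'). j \<in> {1..int h} \<and> j' \<in> {1..int h} \<and> u a j = u a' j'})" .
      qed
      also have "\<dots> \<le> (\<Sum>a\<in>AA. \<Sum>a'\<in>AA. real h * real (gcd a a') / real A\<^sub>0 + 1)"
      proof (intro sum_mono)
        fix a a' assume aa: "a \<in> AA" "a' \<in> AA"
        have "4 * int A\<^sub>0 * int h \<le> int D" using d unfolding D_def by (metis of_nat_le_iff of_nat_mult of_nat_numeral)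
        then show "real (card {(j, j'). j \<in> {1..int h} \<and> j' \<in> {1..int h} \<and> u a j = u a' j'}) \<le> real h * real (gcd a a') / real A\<^sub>0 + 1"
          using aa au by (intro burgess_solution_count[where d = "int D" and x = x]) (auto simp: AA_def)
      qed
      also have "\<dots> = real h / real A\<^sub>0 * (\<Sum>a\<in>AA. \<Sum>a'\<in>AA. real (gcd a a')) + real A\<^sub>0 * real A\<^sub>0"
        by (simp add: sum.distrib sum_distrib_left cAA)
      also have "\<dots> \<le> real h / real A\<^sub>0 * (6 * real A\<^sub>0 ^ 2 * sqrt (real A\<^sub>0)) + real h * real A\<^sub>0 * sqrt (real A\<^sub>0)"
      proof (intro add_mono mult_left_mono)
        show "(\<Sum>a\<in>AA. \<Sum>a'\<in>AA. real (gcd a a')) \<le> 6 * real A\<^sub>0 ^ 2 * sqrt (real A\<^sub>0)"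
          unfolding AA_def by (rule sum_gcd_dyadic[OF A0(1)])
        have "real A\<^sub>0 * real A\<^sub>0 \<le> real h * real A\<^sub>0" using A0 by (intro mult_right_mono) auto
        also have "real h * real A\<^sub>0 * 1 \<le> real h * real A\<^sub>0 * sqrt (real A\<^sub>0)" using A0 by (intro mult_left_mono) auto
        finally show "real A\<^sub>0 * real A\<^sub>0 \<le> real h * real A\<^sub>0 * sqrt (real A\<^sub>0)" by simp
      qed simp
      also have "\<dots> = 7 * real h * real A\<^sub>0 * sqrt (real A\<^sub>0)"
        using A0 by (simp add: power2_eq_square)
      finally show ?thesis .
    qed
    have "(\<Sum>y\<in>Y. \<nu> y ^ 2) * (\<Sum>y\<in>Y. Z y ^ 4) \<le> 7 * real h * real A\<^sub>0 * sqrt (real A\<^sub>0) *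
        (3 * real D * real B\<^sub>0 ^ 2 + 32 * 544 ^ card S * sqrt (real D) * real B\<^sub>0 ^ 4)"
      by (intro mult_mono \<nu>2 Z4) (auto intro!: sum_nonneg)
    then have "(real A\<^sub>0 * real h) ^ 2 * ((\<Sum>y\<in>Y. \<nu> y ^ 2) * (\<Sum>y\<in>Y. Z y ^ 4)) \<le> (real A\<^sub>0 * real h) ^ 2 * (7 * real h * real A\<^sub>0 * sqrt (real A\<^sub>0) *
        (3 * real D * real B\<^sub>0 ^ 2 + 32 * 544 ^ card S * sqrt (real D) * real B\<^sub>0 ^ 4))"
      by (intro mult_left_mono) auto
    moreover have "(X ^ 2) ^ 2 = X ^ 4" by (simp add: power_mult[symmetric])
    ultimately show ?thesis using main by (simp add: mult.assoc)
  qed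
  moreover have "X \<ge> 0" by (simp add: X_def sum_nonneg)
  ultimately show ?thesis unfolding V_def D_def by blast
qed

lemma char_sum_add: "char_sum S (h + k) x = char_sum S h x + char_sum S k (x + int h)"
  by (induction k) (simp_all add: char_sum_Suc add.assoc add.commute add.left_commute, simp add: char_sum_def)

lemma abs_char_sum_le: "\<bar>char_sum S h x\<bar> \<le> int h"
proof -
  have "\<bar>char_sum S h x\<bar> \<le> (\<Sum>j\<in>{1..int h}. 1)"
    unfolding char_sum_def by (intro order.trans[OF sum_abs] sum_mono abs_chi_le_1)
  then show ?thesis by simp
qed

lemma char_sum_blocks:
  assumes "\<And>x. \<bar>real_of_int (char_sum S h\<^sub>0 x)\<bar> \<le> c"
  shows "\<bar>real_of_int (char_sum S (k * h\<^sub>0 + r) x)\<bar> \<le> real k * c + real r"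
proof (induction k arbitrary: x)
  case 0
  have "\<bar>char_sum S r x\<bar> \<le> int r" by (rule abs_char_sum_le)
  then show ?case by simp
next
  case (Suc k)
  have "char_sum S (Suc k * h\<^sub>0 + r) x = char_sum S h\<^sub>0 x + char_sum S (k * h\<^sub>0 + r) (x + int h\<^sub>0)"
    using char_sum_add[of S h\<^sub>0 "k * h\<^sub>0 + r" x] by (simp add: add.assoc)
  then have "\<bar>real_of_int (char_sum S (Suc k * h\<^sub>0 + r) x)\<bar>
      \<le> \<bar>real_of_int (char_sum S h\<^sub>0 x)\<bar> + \<bar>real_of_int (char_sum S (k * h\<^sub>0 + r) (x + int h\<^sub>0))\<bar>"
    by simp
  also have "\<dots> \<le> c + (real k * c + real r)" by (intro add_mono assms Suc)
  finally show ?case by (simp add: algebra_simps)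
qed

lemma nat_ceiling_bounds:
  fixes y :: real
  assumes "y \<ge> 1"
  shows "y \<le> real (nat \<lceil>y\<rceil>)" "real (nat \<lceil>y\<rceil>) \<le> 2 * y"
  using assms by linarith+

lemma prod_ge_member:
  fixes S :: "nat set"
  assumes "finite S" "\<And>p. p \<in> S \<Longrightarrow> prime p" "p \<in> S"
  shows "p \<le> \<Prod>S"
  using assms prod_primes_pos[of S] by (intro dvd_imp_le dvd_prod_eqI) auto

text \<open>Burgess' shift argument at length about \<open>d\<^sup>1\<^sup>/\<^sup>2\<close>: the family of multipliers of size
  \<open>L\<^sup>6\<^sup>4\<close> beats every power of \<open>L\<close> lost elsewhere.\<close>

lemma char_sum_small:
  fixes S :: "nat set" and L :: real
  assumes L: "L \<ge> 100" and S: "finite S" "S \<noteq> {}" "\<And>p. p \<in> S \<Longrightarrow> prime p \<and> real p > L ^ 400"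
    and c: "544 ^ card S \<le> L ^ 7" and h: "real h \<ge> sqrt (real (\<Prod>S)) / L ^ 15"
  shows "\<bar>real_of_int (char_sum S h x)\<bar> < real h / (2 * L)"
proof -
  define d where "d = \<Prod>S"
  define D where "D = sqrt (real d)"
  define R where "R = sqrt D"
  have L1: "L \<ge> 1" "L > 0" using L by auto
  have Lpow: "1 \<le> L ^ n" for n using L1 by simp
  have p2: "p > 2" if "p \<in> S" for p
  proof -
    have "L ^ 1 \<le> L ^ 400" using L1 by (intro power_increasing) auto
    then show ?thesis using S(3)[OF that] L by simp
  qed
  obtain p where p: "p \<in> S" using S by auto
  have "real p \<le> real d" unfolding d_def using prod_ge_member[of S p] S p by (auto simp del: of_nat_prod)
  then have dL: "real d \<ge> L ^ 400" using S(3)[OF p] by linarith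
  have DL: "D \<ge> L ^ 200"
  proof -
    show ?thesis unfolding D_def by (rule real_le_rsqrt) (use dL in \<open>simp flip: power_mult\<close>)
  qed
  have RL: "R \<ge> L ^ 100"
  proof -
    show ?thesis unfolding R_def by (rule real_le_rsqrt) (use DL in \<open>simp flip: power_mult\<close>)
  qed
  have D0: "D > 0" "R > 0" using DL RL Lpow[of 200] Lpow[of 100] by linarith+
  have DD: "D * D = real d" by (simp add: D_def)
  have RR: "R * R = D" using D0 by (simp add: R_def)
  \<comment> \<open>\<open>B\<^sub>0\<close> = d^(1/4) balances the two terms of the fourth moment,
    d b^2 and sqrt(d) b^4. The length \<open>h\<^sub>0\<close> is shorter than the smallest h
    allowed by about L^2, so that h can be cut into blocks of this length with a negligible
    remainder.\<close>
  define A\<^sub>0 where "A\<^sub>0 = nat \<lceil>L ^ 64\<rceil>"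
  define B\<^sub>0 where "B\<^sub>0 = nat \<lceil>R\<rceil>"
  define h\<^sub>0 where "h\<^sub>0 = nat \<lceil>D / L ^ 17\<rceil>"
  have A0: "L ^ 64 \<le> real A\<^sub>0" "real A\<^sub>0 \<le> 2 * L ^ 64"
    unfolding A\<^sub>0_def using nat_ceiling_bounds[of "L ^ 64"] Lpow by auto
  have B0: "R \<le> real B\<^sub>0" "real B\<^sub>0 \<le> 2 * R"
    unfolding B\<^sub>0_def using nat_ceiling_bounds[of R] RL Lpow[of 100] by auto
  have D17: "D / L ^ 17 \<ge> L ^ 183"
  proof -
    have "L ^ 183 * L ^ 17 \<le> D" using DL by (simp flip: power_add)
    then show ?thesis using L1 by (simp add: pos_le_divide_eq)
  qed
  have h0: "D / L ^ 17 \<le> real h\<^sub>0" "real h\<^sub>0 \<le> 2 * (D / L ^ 17)"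
    unfolding h\<^sub>0_def using nat_ceiling_bounds[of "D / L ^ 17"] D17 Lpow[of 183] by auto
  have pos: "real A\<^sub>0 > 0" "real B\<^sub>0 > 0" "real h\<^sub>0 > 0"
    using A0 B0 h0 D0 D17 Lpow[of 64] Lpow[of 183] by linarith+
  have step: "c * L ^ i \<le> L ^ j" if "i < j" "c \<le> 100" for c i j
  proof -
    have "c * L ^ i \<le> L * L ^ i" using that L L1 by (intro mult_right_mono) auto
    also have "\<dots> = L ^ Suc i" by simp
    also have "\<dots> \<le> L ^ j" using that L1 by (intro power_increasing) auto
    finally show ?thesis .
  qed
  have V0: "\<bar>real_of_int (char_sum S h\<^sub>0 y)\<bar> \<le> real h\<^sub>0 / (4 * L)" for y
  proof -
    have pA: "p > 2 * A\<^sub>0" if "p \<in> S" for p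
    proof -
      have "real (2 * A\<^sub>0) \<le> 4 * L ^ 64" using A0 by simp
      also have "\<dots> \<le> L ^ 400" by (rule step) auto
      also have "\<dots> < real p" using S(3)[OF that] by simp
      finally show ?thesis by linarith
    qed
    have Ah: "real A\<^sub>0 \<le> real h\<^sub>0"
      using A0 h0 D17 step[of 64 183 2] by linarith
    have "real (4 * A\<^sub>0 * h\<^sub>0) \<le> real d"
    proof -
      have "real (4 * A\<^sub>0 * h\<^sub>0) = 4 * (real A\<^sub>0 * real h\<^sub>0)" by simp
      also have "real A\<^sub>0 * real h\<^sub>0 \<le> (2 * L ^ 64) * (2 * (D / L ^ 17))" using A0 h0 pos by (intro mult_mono) auto
      also have "4 * ((2 * L ^ 64) * (2 * (D / L ^ 17))) = 16 * L ^ 47 * D"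
        using L1 by (simp add: field_simps flip: power_add)
      also have "\<dots> \<le> L ^ 200 * D" using D0 step[of 47 200 16] by (intro mult_right_mono) auto
      also have "\<dots> \<le> D * D" using DL D0 by (intro mult_right_mono) auto
      finally show ?thesis using DD by simp
    qed
    then have dd: "4 * A\<^sub>0 * h\<^sub>0 \<le> \<Prod>S" unfolding d_def by (simp only: of_nat_le_iff)
    obtain X where X: "X \<ge> 0" "real A\<^sub>0 * real B\<^sub>0 * \<bar>real_of_int (char_sum S h\<^sub>0 y)\<bar> \<le> X + 4 * (real A\<^sub>0 * real B\<^sub>0) ^ 2"
      "X ^ 4 \<le> (real A\<^sub>0 * real h\<^sub>0) ^ 2 * (7 * real h\<^sub>0 * real A\<^sub>0 * sqrt (real A\<^sub>0)) *
        (3 * real d * real B\<^sub>0 ^ 2 + 32 * 544 ^ card S * D * real B\<^sub>0 ^ 4)"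
      using burgess_inequality[of S A\<^sub>0 h\<^sub>0 B\<^sub>0 y] S p2 pA pos Ah dd unfolding d_def[symmetric] D_def[symmetric] by auto
    define a b g where "a = real A\<^sub>0" and "b = real B\<^sub>0" and "g = real h\<^sub>0"
    have abg: "a > 0" "b > 0" "g > 0" using pos by (auto simp: a_def b_def g_def)
    have br: "3 * real d * b ^ 2 + 32 * 544 ^ card S * D * b ^ 4 \<le> 35 * L ^ 7 * (D * b ^ 4)"
    proof -
      have "R * R \<le> b * b" using B0 D0 unfolding b_def by (intro mult_mono) auto
      then have Db: "D \<le> b ^ 2" using RR by (simp add: power2_eq_square)
      have "3 * real d * b ^ 2 = 3 * (D * b ^ 2 * D)" using DD by simp
      also have "D * b ^ 2 * D \<le> D * b ^ 2 * b ^ 2" using Db D0 by (intro mult_left_mono) auto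
      also have "D * b ^ 2 * b ^ 2 = 1 * (D * b ^ 4)" by (simp add: mult.assoc flip: power_add)
      also have "\<dots> \<le> L ^ 7 * (D * b ^ 4)" using Lpow[of 7] D0 by (intro mult_right_mono) auto
      finally have 1: "3 * real d * b ^ 2 \<le> 3 * (L ^ 7 * (D * b ^ 4))" by simp
      have "32 * 544 ^ card S * D * b ^ 4 = 32 * (544 ^ card S * (D * b ^ 4))" by simp
      also have "544 ^ card S * (D * b ^ 4) \<le> L ^ 7 * (D * b ^ 4)" using c D0 by (intro mult_right_mono) auto
      finally have 2: "32 * 544 ^ card S * D * b ^ 4 \<le> 32 * (L ^ 7 * (D * b ^ 4))" by simp
      show ?thesis using 1 2 by linarith
    qed
    define s where "s = sqrt a"
    have s: "s > 0" "s * s = a" "s \<ge> L ^ 32"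
    proof -
      show "s > 0" "s * s = a" using abg by (auto simp: s_def)
      show "s \<ge> L ^ 32" unfolding s_def a_def by (rule real_le_rsqrt) (use A0 in \<open>simp flip: power_mult\<close>)
    qed
    have Dg: "D \<le> g * L ^ 17" using h0 L1 by (simp add: g_def pos_divide_le_eq)
    have "X ^ 4 \<le> (a * g) ^ 2 * (7 * g * a * s) * (35 * L ^ 7 * (D * b ^ 4))"
      using X(3) unfolding a_def[symmetric] b_def[symmetric] g_def[symmetric] s_def[symmetric]
      by (rule order.trans) (use br abg s in \<open>intro mult_left_mono, auto\<close>)
    also have "\<dots> \<le> (a * g) ^ 2 * (7 * g * a * s) * (35 * L ^ 7 * ((g * L ^ 17) * b ^ 4))"
      using Dg abg s L1 by (intro mult_left_mono mult_right_mono) auto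
    also have "\<dots> = 245 * L ^ 24 * (s * a ^ 3 * g ^ 4 * b ^ 4)"
      by (simp add: power_mult_distrib power2_eq_square power3_eq_cube power4_eq_xxxx flip: power_add)
    finally have X4: "X ^ 4 \<le> 245 * L ^ 24 * (s * a ^ 3 * g ^ 4 * b ^ 4)" .
    \<comment> \<open>Since a^4 = s^2 a^3, the saving over the trivial bound is s = sqrt(a) >= L^32.
      It absorbs L^24, where 24 = 7 + 17 comes from 544^|S| and from sqrt(d) /
      \<open>h\<^sub>0\<close>, the target (8L)^4, and the constant 245 * 8^4 < L^4.\<close>
    have "245 * L ^ 24 * (8 * L) ^ 4 \<le> s"
    proof -
      have "245 * L ^ 24 * (8 * L) ^ 4 = 1003520 * L ^ 28"
        by (simp add: power_mult_distrib flip: power_add)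
      also have "\<dots> \<le> L ^ 4 * L ^ 28"
      proof (intro mult_right_mono)
        have "(100::real) ^ 4 \<le> L ^ 4" using L by (intro power_mono) auto
        then show "1003520 \<le> L ^ 4" by simp
      qed (use L1 in auto)
      also have "\<dots> = L ^ 32" by (simp flip: power_add)
      finally show ?thesis using s by linarith
    qed
    then have "245 * L ^ 24 * (8 * L) ^ 4 * (s * a ^ 3 * g ^ 4 * b ^ 4) \<le> s * (s * a ^ 3 * g ^ 4 * b ^ 4)"
      using abg s by (intro mult_right_mono) auto
    also have "\<dots> = (a * g * b) ^ 4"
    proof -
      have "s * (s * a ^ 3 * g ^ 4 * b ^ 4) = (s * s) * a ^ 3 * g ^ 4 * b ^ 4" by simp
      then show ?thesis unfolding s(2) by (simp add: power_mult_distrib power3_eq_cube power4_eq_xxxx)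
    qed
    finally have F: "245 * L ^ 24 * (8 * L) ^ 4 * (s * a ^ 3 * g ^ 4 * b ^ 4) \<le> (a * g * b) ^ 4" .
    have "(8 * L * X) ^ 4 = (8 * L) ^ 4 * X ^ 4" by (rule power_mult_distrib)
    also have "\<dots> \<le> (8 * L) ^ 4 * (245 * L ^ 24 * (s * a ^ 3 * g ^ 4 * b ^ 4))"
      by (intro mult_left_mono X4) (use L1 in auto)
    also have "\<dots> = 245 * L ^ 24 * (8 * L) ^ 4 * (s * a ^ 3 * g ^ 4 * b ^ 4)" by (simp only: ac_simps)
    also note F
    finally have "(8 * L * X) ^ 4 \<le> (a * g * b) ^ 4" .
    then have X8: "8 * L * X \<le> a * g * b"
      using power_strict_mono[of "a * g * b" "8 * L * X" 4] abg by (cases "8 * L * X \<le> a * g * b") auto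
    have "a * b * \<bar>real_of_int (char_sum S h\<^sub>0 y)\<bar> \<le> a * b * (g / (8 * L) + 4 * (a * b))"
    proof -
      have "X \<le> a * b * (g / (8 * L))" using X8 L1 by (simp add: pos_le_divide_eq mult.commute mult.left_commute)
      moreover have "4 * (a * b) ^ 2 = a * b * (4 * (a * b))" by (simp add: power2_eq_square)
      ultimately show ?thesis using X(2) unfolding a_def[symmetric] b_def[symmetric] by (simp only: distrib_left)
    qed
    then have "\<bar>real_of_int (char_sum S h\<^sub>0 y)\<bar> \<le> g / (8 * L) + 4 * (a * b)" using abg by simp
    also have "4 * (a * b) \<le> g / (8 * L)"
    proof -
      have "a * b \<le> (2 * L ^ 64) * (2 * R)" unfolding a_def b_def using A0 B0 pos by (intro mult_mono) auto
      then have "4 * (a * b) * (8 * L) \<le> 4 * ((2 * L ^ 64) * (2 * R)) * (8 * L)" using L1 by (intro mult_right_mono mult_left_mono) auto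
      also have "\<dots> = 128 * L ^ 65 * R" using power_Suc2[of L 64] by simp
      also have "\<dots> \<le> L ^ 83 * R"
      proof (intro mult_right_mono)
        have "128 * L ^ 65 = 2 * (64 * L ^ 65)" by simp
        also have "\<dots> \<le> 2 * L ^ 66" using step[of 65 66 64] by simp
        also have "\<dots> \<le> L ^ 83" by (rule step) auto
        finally show "128 * L ^ 65 \<le> L ^ 83" .
      qed (use D0 in auto)
      \<comment> \<open>Here the full strength of the lower bound on the primes enters: d >= L^400
        gives R = d^(1/4) >= L^100, and 100 = 83 + 17.\<close>
      also have "\<dots> \<le> g"
      proof -
        have "L ^ 83 * R * L ^ 17 = L ^ 100 * R" by (simp add: mult.commute mult.left_commute flip: power_add)
        also have "\<dots> \<le> R * R" using RL D0 by (intro mult_right_mono) auto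
        finally have "L ^ 83 * R * L ^ 17 \<le> D" using RR by simp
        then have "L ^ 83 * R \<le> D / L ^ 17" using L1 by (simp add: pos_le_divide_eq)
        then show ?thesis using h0 by (simp add: g_def)
      qed
      finally show ?thesis using L1 by (simp add: pos_le_divide_eq)
    qed
    also have "g / (8 * L) + g / (8 * L) = g / (4 * L)" by simp
    finally show ?thesis by (simp add: g_def)
  qed
  define k r where "k = h div h\<^sub>0" and "r = h mod h\<^sub>0"
  have hk: "h = k * h\<^sub>0 + r" by (simp add: k_def r_def)
  have r: "real r < real h\<^sub>0" using pos by (simp add: r_def)
  have "real k * real h\<^sub>0 \<le> real h" using hk by (metis of_nat_mult of_nat_le_iff le_add1)
  then have kh: "real k * (real h\<^sub>0 / (4 * L)) \<le> real h / (4 * L)" using L1 by (simp add: divide_right_mono)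
  have "real h\<^sub>0 \<le> real h / (4 * L)"
  proof -
    have "D \<le> real h * L ^ 15" using h L1 by (simp add: D_def d_def pos_divide_le_eq)
    then have "D * (8 * L) \<le> real h * L ^ 15 * (8 * L)" using L1 by (intro mult_right_mono) auto
    also have "\<dots> = real h * (8 * L ^ 16)" using power_Suc2[of L 15] by simp
    also have "\<dots> \<le> real h * L ^ 17" by (intro mult_left_mono step) auto
    finally have "2 * (D / L ^ 17) \<le> real h / (4 * L)" using L1 by (simp add: divide_simps mult.commute mult.left_commute)
    then show ?thesis using h0 by linarith
  qed
  moreover have "\<bar>real_of_int (char_sum S h x)\<bar> \<le> real k * (real h\<^sub>0 / (4 * L)) + real r"
    unfolding hk by (rule char_sum_blocks[OF V0])
  moreover have "real h / (4 * L) + real h / (4 * L) = real h / (2 * L)" by simp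
  ultimately show ?thesis using kh r by linarith
qed

section \<open>The contribution of long gaps\<close>

lemma sum_inverse_squares_le:
  assumes "K > 1"
  shows "(\<Sum>h\<in>{K..<N}. 1 / real h ^ 2) \<le> 2 / real K"
proof -
  have "(\<Sum>h\<in>{K..<K+n}. 1 / real h ^ 2) \<le> 1 / (real K - 1) - 1 / (real (K + n) - 1)" for n
  proof (induction n)
    case (Suc n)
    let ?x = "real (K + n)"
    have x: "?x \<ge> 2" using assms by simp
    have "1 / ?x ^ 2 \<le> 1 / (?x - 1) - 1 / ?x"
    proof -
      have "1 / (?x - 1) - 1 / ?x = 1 / ((?x - 1) * ?x)" using x by (simp add: divide_simps)
      moreover have "1 / ?x ^ 2 \<le> 1 / ((?x - 1) * ?x)"
        using x by (intro divide_left_mono) (auto simp: power2_eq_square)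
      ultimately show ?thesis by simp
    qed
    moreover have "real (K + Suc n) - 1 = ?x" by simp
    ultimately show ?case using Suc by simp
  qed simp
  from this[of "N - K"] have "(\<Sum>h\<in>{K..<K + (N - K)}. 1 / real h ^ 2) \<le> 1 / (real K - 1)"
  proof (rule order.trans)
    have "1 / (real (K + (N - K)) - 1) \<ge> 0" using assms by simp
    then show "1 / (real K - 1) - 1 / (real (K + (N - K)) - 1) \<le> 1 / (real K - 1)" by linarith
  qed
  moreover have "{K..<N} \<subseteq> {K..<K + (N - K)}" by auto
  then have "(\<Sum>h\<in>{K..<N}. 1 / real h ^ 2) \<le> (\<Sum>h\<in>{K..<K + (N - K)}. 1 / real h ^ 2)"
    by (intro sum_mono2) auto
  moreover have "1 / (real K - 1) \<le> 2 / real K" using assms by (simp add: divide_simps)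
  ultimately show ?thesis by linarith
qed

text \<open>Markov's inequality for the fourth power. The character sum depends only on y modulo d,
  so its moment modulo m is m/d times the one modulo d.\<close>

lemma card_large_char_sum_le:
  fixes S P :: "nat set" and t :: real
  assumes P: "finite P" "\<And>p. p \<in> P \<Longrightarrow> prime p \<and> p > 2" and S: "S \<subseteq> P" and t: "t > 0"
  shows "real (card {y \<in> {0..<int (\<Prod>P)}. t \<le> \<bar>real_of_int (char_sum S h y)\<bar>})
    \<le> real (\<Prod>P) * (3 * real h ^ 2 + 32 * 544 ^ card S * real h ^ 4 / sqrt (real (\<Prod>S))) / t ^ 4"
proof -
  define d where "d = \<Prod>S"
  define e where "e = \<Prod>(P - S)"
  have finS: "finite S" using P S finite_subset by blast
  have Sp: "\<And>p. p \<in> S \<Longrightarrow> prime p \<and> p > 2" using P S by blast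
  have m: "\<Prod>P = d * e" unfolding d_def e_def using prod.subset_diff[OF S P(1), of id] by (simp add: mult.commute)
  have d0: "d > 0" unfolding d_def using prod_primes_pos[of S] Sp by blast
  have e0: "e > 0" unfolding e_def using prod_primes_pos[of "P - S"] P by blast
  have cop: "coprime (int d) (int e)"
  proof -
    have "coprime d e" unfolding d_def e_def
      using P S by (intro prod_coprime_left prod_coprime_right) (metis DiffE primes_coprime subset_iff)
    then show ?thesis by simp
  qed
  define V where "V y = real_of_int (char_sum S h y)" for y
  have Vmod: "V (y mod int d) = V y" for y
  proof -
    have "chi S (y mod int d + j) = chi S (y + j)" for j
      by (rule chi_cong[OF finS]) (simp add: d_def[symmetric] cong_def mod_add_left_eq del: of_nat_prod)
    then show ?thesis by (simp add: V_def char_sum_def)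
  qed
  have "real (card {y \<in> {0..<int (\<Prod>P)}. t \<le> \<bar>V y\<bar>}) = (\<Sum>y\<in>{0..<int d * int e}. of_bool (t \<le> \<bar>V y\<bar>))"
    unfolding m by (simp add: Int_def)
  also have "\<dots> \<le> (\<Sum>y\<in>{0..<int d * int e}. V (y mod int d) ^ 4 / t ^ 4)"
  proof (rule sum_mono)
    fix y
    show "of_bool (t \<le> \<bar>V y\<bar>) \<le> V (y mod int d) ^ 4 / t ^ 4"
    proof (cases "t \<le> \<bar>V y\<bar>")
      case True
      then have "t ^ 4 \<le> \<bar>V y\<bar> ^ 4" using t by (intro power_mono) auto
      also have "\<bar>V y\<bar> ^ 4 = V y ^ 4" by (rule power_even_abs) simp
      finally show ?thesis using t True by (simp add: Vmod)
    qed (use t in \<open>auto simp: Vmod\<close>)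
  qed
  also have "\<dots> = (\<Sum>y\<in>{0..<int d}. \<Sum>z\<in>{0..<int e}. V y ^ 4 / t ^ 4)"
    by (rule crt_sum[OF cop, where F = "\<lambda>y z. V y ^ 4 / t ^ 4"]) (use d0 e0 in auto)
  also have "\<dots> = real e * (\<Sum>y\<in>{0..<int d}. V y ^ 4) / t ^ 4"
    by (simp add: sum_distrib_left sum_divide_distrib)
  also have "\<dots> \<le> real e * (3 * real d * real h ^ 2 + 32 * 544 ^ card S * sqrt (real d) * real h ^ 4) / t ^ 4"
    unfolding V_def d_def using t
    by (intro divide_right_mono mult_left_mono fourth_moment) (use finS Sp in auto)
  also have "\<dots> = real (\<Prod>P) * (3 * real h ^ 2 + 32 * 544 ^ card S * real h ^ 4 / sqrt (real d)) / t ^ 4"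
  proof -
    have "sqrt (real d) = real d / sqrt (real d)" by (rule real_div_sqrt[symmetric]) simp
    then have "32 * 544 ^ card S * sqrt (real d) * real h ^ 4 = real d * (32 * 544 ^ card S * real h ^ 4 / sqrt (real d))"
    proof -
      assume sd: "sqrt (real d) = real d / sqrt (real d)"
      have "real d * (32 * 544 ^ card S * real h ^ 4 / sqrt (real d)) = 32 * 544 ^ card S * real h ^ 4 * (real d / sqrt (real d))"
        by simp
      also have "\<dots> = 32 * 544 ^ card S * real h ^ 4 * sqrt (real d)" by (simp only: sd[symmetric])
      finally show ?thesis by simp
    qed
    moreover have "real (\<Prod>P) = real d * real e" by (simp only: m of_nat_mult)
    ultimately show ?thesis by (simp add: algebra_simps del: of_nat_prod)
  qed
  finally show ?thesis by (simp add: V_def d_def del: of_nat_prod)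
qed

text \<open>Multiples of A are residues modulo A for free. An interval without residues modulo M
  must therefore have its multiples A (y + n) blocked by the primes of m alone, and they correspond
  to consecutive integers y + n.\<close>

definition scaled_blocked :: "nat set \<Rightarrow> nat \<Rightarrow> nat \<Rightarrow> int set" where
  "scaled_blocked P A h = {y \<in> {0..<int (\<Prod>P)}. \<forall>n\<in>{1..int h}. \<exists>p\<in>P. \<not> QuadRes (int p) (int A * (y + n))}"

text \<open>The product over p of 1 + (A(y+n) / p) is nonnegative and vanishes for every n where no
  prime of P divides y + n; the exceptional n are few because the primes are large. Expanding the
  product, the empty set contributes h, so the other at most L sets S have to cancel at least h/2,
  and one of their sums reaches h/(2L).\<close>

lemma scaled_blocked_large_char_sum:
  fixes P :: "nat set" and L :: real
  assumes L: "L \<ge> 100" and P: "finite P" "\<And>p. p \<in> P \<Longrightarrow> prime p \<and> real p > L ^ 400"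
    and w: "2 ^ card P \<le> L" and A: "\<And>p. p \<in> P \<Longrightarrow> \<not> p dvd A"
    and h: "real h \<ge> 4 * L ^ 2" and y: "y \<in> scaled_blocked P A h"
  shows "\<exists>S\<in>Pow P - {{}}. real h / (2 * L) \<le> \<bar>real_of_int (char_sum S h y)\<bar>"
proof (rule ccontr)
  assume "\<not> ?thesis"
  then have small: "\<bar>real_of_int (char_sum S h y)\<bar> < real h / (2 * L)" if "S \<in> Pow P - {{}}" for S
    using that not_le by blast
  have L1: "L \<ge> 1" "L > 0" using L by auto
  have h0: "real h > 0" proof -
    have "4 * L ^ 2 > 0" using L1 by simp
    then show ?thesis using h by linarith
  qed
  have p2: "p > 2" if "p \<in> P" for p
  proof -
    have "L ^ 1 \<le> L ^ 400" using L1 by (intro power_increasing) auto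
    then show ?thesis using P(2)[OF that] L by simp
  qed
  define H where "H = {1..int h}"
  define f where "f n = (\<Prod>p\<in>P. Legendre (int A * (y + n)) (int p) + 1)" for n
  define Z where "Z = {n \<in> H. \<exists>p\<in>P. int p dvd y + n}"
  have f_le: "f n \<le> 2 ^ card P" for n
  proof -
    have "f n \<le> (\<Prod>p\<in>P. 2)"
      unfolding f_def
    proof (intro prod_mono conjI)
      fix p
      show "0 \<le> Legendre (int A * (y + n)) (int p) + 1" "Legendre (int A * (y + n)) (int p) + 1 \<le> 2"
        using abs_Legendre_le_1[of "int A * (y + n)" "int p"] by auto
    qed
    then show ?thesis by simp
  qed
  have f_0: "f n = 0" if n: "n \<in> H - Z" for n
  proof -
    obtain p where p: "p \<in> P" "\<not> QuadRes (int p) (int A * (y + n))"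
      using y n unfolding scaled_blocked_def H_def by blast
    have "prime (int p)" using P p by simp
    moreover have "\<not> int p dvd y + n" using n p by (auto simp: Z_def)
    moreover have "\<not> int p dvd int A" using A p by simp
    ultimately have "\<not> int p dvd int A * (y + n)" by (simp add: prime_dvd_mult_iff)
    then have "Legendre (int A * (y + n)) (int p) = -1" using p by (simp add: Legendre_def cong_0_iff)
    then show ?thesis unfolding f_def using P(1) p by (intro prod_zero bexI[of _ p]) auto
  qed
  have finH: "finite H" by (simp add: H_def)
  have finZ: "finite Z" using finH by (simp add: Z_def)
  have cardZ: "real (card Z) \<le> real (card P) * (real h / L ^ 400 + 1)"
  proof -
    have "Z = (\<Union>p\<in>P. {n \<in> H. int p dvd y + n})" by (auto simp: Z_def)
    then have "card Z \<le> (\<Sum>p\<in>P. card {n \<in> H. int p dvd y + n})" using P(1) by (simp add: card_UN_le)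
    then have "real (card Z) \<le> real (\<Sum>p\<in>P. card {n \<in> H. int p dvd y + n})" by (simp only: of_nat_le_iff)
    also have "\<dots> = (\<Sum>p\<in>P. real (card {n \<in> H. int p dvd y + n}))" by (simp only: of_nat_sum)
    also have "\<dots> \<le> (\<Sum>p\<in>P. real h / L ^ 400 + 1)"
    proof (rule sum_mono)
      fix p assume p: "p \<in> P"
      have "real (card {n \<in> H. int p dvd y + n}) \<le> real h / real_of_int (int p) + 1"
      proof (rule card_residue_class_le)
        show "int p > 0" using p2[OF p] by simp
        show "{n \<in> H. int p dvd y + n} \<subseteq> {1..int h}" by (auto simp: H_def)
        fix a b assume "a \<in> {n \<in> H. int p dvd y + n}" "b \<in> {n \<in> H. int p dvd y + n}"
        then have "int p dvd (y + a) - (y + b)" by (intro dvd_diff) auto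
        then show "int p dvd a - b" by simp
      qed
      also have "real h / real_of_int (int p) \<le> real h / L ^ 400"
        using P(2)[OF p] L1 p2[OF p] by (intro divide_left_mono) auto
      finally show "real (card {n \<in> H. int p dvd y + n}) \<le> real h / L ^ 400 + 1" by simp
    qed
    finally show ?thesis by simp
  qed
  have "(\<Sum>n\<in>H. f n) = (\<Sum>n\<in>Z. f n)"
    using finH f_0 by (intro sum.mono_neutral_right) (auto simp: Z_def)
  also have "\<dots> \<le> (\<Sum>n\<in>Z. 2 ^ card P)" by (intro sum_mono f_le)
  finally have "(\<Sum>n\<in>H. f n) \<le> int (card Z) * 2 ^ card P" by simp
  then have "real_of_int (\<Sum>n\<in>H. f n) \<le> real_of_int (int (card Z) * 2 ^ card P)" by (simp only: of_int_le_iff)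
  then have "real_of_int (\<Sum>n\<in>H. f n) \<le> real (card Z) * 2 ^ card P" by simp
  also have "\<dots> \<le> (L * (real h / L ^ 400 + 1)) * L"
  proof (intro mult_mono w)
    have "real (card P) \<le> L"
    proof -
      have "card P \<le> 2 ^ card P" using less_exp less_imp_le by blast
      then have "real (card P) \<le> real (2 ^ card P)" by (simp only: of_nat_le_iff)
      then show ?thesis using w by (simp only: of_nat_power of_nat_numeral)
    qed
    then have "real (card P) * (real h / L ^ 400 + 1) \<le> L * (real h / L ^ 400 + 1)"
      using L1 by (intro mult_right_mono) auto
    then show "real (card Z) \<le> L * (real h / L ^ 400 + 1)" using cardZ by linarith
    show "0 \<le> L * (real h / L ^ 400 + 1)" using L1 by simp
  qed simp
  also have "\<dots> \<le> real h / 2"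
  proof -
    have "L ^ 2 * (real h / L ^ 400) \<le> real h / 4"
    proof -
      have "4 * L ^ 2 \<le> L * L ^ 2" using L by (intro mult_right_mono) auto
      also have "\<dots> = L ^ 3" by (simp add: power3_eq_cube power2_eq_square)
      also have "\<dots> \<le> L ^ 400" using L1 by (intro power_increasing) auto
      finally have "real h * (4 * L ^ 2) \<le> real h * L ^ 400" by (intro mult_left_mono) auto
      then show ?thesis using L1 by (simp add: divide_simps mult.commute mult.left_commute)
    qed
    moreover have "(L * (real h / L ^ 400 + 1)) * L = L ^ 2 * (real h / L ^ 400) + L ^ 2"
      by (simp add: power2_eq_square algebra_simps)
    ultimately show ?thesis using h by linarith
  qed
  finally have up: "real_of_int (\<Sum>n\<in>H. f n) \<le> real h / 2" .
  have "(\<Sum>n\<in>H. f n) = (\<Sum>n\<in>H. \<Sum>S\<in>Pow P. chi S (int A) * chi S (y + n))"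
  proof (rule sum.cong[OF refl])
    fix n
    have "f n = (\<Sum>S\<in>Pow P. chi S (int A * (y + n)))"
      unfolding f_def chi_def using P(1) by (subst prod_add) auto
    also have "\<dots> = (\<Sum>S\<in>Pow P. chi S (int A) * chi S (y + n))"
      using P p2 by (intro sum.cong refl chi_mult) auto
    finally show "f n = (\<Sum>S\<in>Pow P. chi S (int A) * chi S (y + n))" .
  qed
  also have "\<dots> = (\<Sum>S\<in>Pow P. chi S (int A) * char_sum S h y)"
    unfolding char_sum_def H_def by (subst sum.swap) (simp add: sum_distrib_left)
  also have "\<dots> = int h + (\<Sum>S\<in>Pow P - {{}}. chi S (int A) * char_sum S h y)"
    using P(1) by (subst sum.remove[of _ "{}"]) (auto simp: chi_def char_sum_def)
  finally have "real_of_int (\<Sum>n\<in>H. f n) = real h + (\<Sum>S\<in>Pow P - {{}}. real_of_int (chi S (int A) * char_sum S h y))"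
    by simp
  moreover have "\<bar>\<Sum>S\<in>Pow P - {{}}. real_of_int (chi S (int A) * char_sum S h y)\<bar> < real h / 2"
  proof (cases "Pow P - {{}} = {}")
    case False
    have "\<bar>\<Sum>S\<in>Pow P - {{}}. real_of_int (chi S (int A) * char_sum S h y)\<bar>
        \<le> (\<Sum>S\<in>Pow P - {{}}. \<bar>real_of_int (char_sum S h y)\<bar>)"
    proof (intro order.trans[OF sum_abs] sum_mono)
      fix S
      have "\<bar>chi S (int A) * char_sum S h y\<bar> \<le> 1 * \<bar>char_sum S h y\<bar>"
        unfolding abs_mult by (intro mult_right_mono abs_chi_le_1) auto
      then show "\<bar>real_of_int (chi S (int A) * char_sum S h y)\<bar> \<le> \<bar>real_of_int (char_sum S h y)\<bar>"
        by linarith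
    qed
    also have "\<dots> < (\<Sum>S\<in>Pow P - {{}}. real h / (2 * L))"
      using False P(1) small by (intro sum_strict_mono) auto
    also have "\<dots> \<le> 2 ^ card P * (real h / (2 * L))"
    proof -
      have "card (Pow P - {{}}) \<le> card (Pow P)" using P(1) by (intro card_mono) auto
      then have "real (card (Pow P - {{}})) \<le> real (2 ^ card P)" using P(1) by (simp only: of_nat_le_iff card_Pow)
      then have "real (card (Pow P - {{}})) \<le> 2 ^ card P" by (simp only: of_nat_power of_nat_numeral)
      then have "real (card (Pow P - {{}})) * (real h / (2 * L)) \<le> 2 ^ card P * (real h / (2 * L))"
        using L1 by (intro mult_right_mono) auto
      then show ?thesis by simp
    qed
    also have "\<dots> \<le> L * (real h / (2 * L))" using w L1 by (intro mult_right_mono) auto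
    also have "\<dots> = real h / 2" using L1 by simp
    finally show ?thesis .
  next
    case True
    show ?thesis unfolding True using h0 by simp
  qed
  ultimately show False using up by linarith
qed

text \<open>For each S the bad y exist only for h < sqrt(d) / L^15, by
  \<open>char_sum_small\<close>. Below that, the density of bad y is at most 16 L^4 (3/h^2 + 32 L^7
  / sqrt(d)). Over h >= L^8 both parts sum to a multiple of L^(-8), the second one because 15 = 7 +
  8. The factor L^4 and the at most L sets S leave L^(-3), and 608 = 16 (6 + 32).\<close>

lemma sum_scaled_blocked_le:
  fixes P :: "nat set" and L :: real
  assumes L: "L \<ge> 100" and P: "finite P" "\<And>p. p \<in> P \<Longrightarrow> prime p \<and> real p > L ^ 400"
    and w: "2 ^ card P \<le> L" "544 ^ card P \<le> L ^ 7" and A: "\<And>p. p \<in> P \<Longrightarrow> \<not> p dvd A"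
    and K: "real K \<ge> L ^ 8"
  shows "(\<Sum>h\<in>{K..<N}. real (card (scaled_blocked P A h))) \<le> 608 * real (\<Prod>P) / L ^ 3"
proof -
  have L1: "L \<ge> 1" "L > 0" using L by auto
  define m where "m = real (\<Prod>P)"
  have m0: "m \<ge> 0" unfolding m_def by (rule of_nat_0_le_iff)
  have p2: "p > 2" if "p \<in> P" for p
  proof -
    have "L ^ 1 \<le> L ^ 400" using L1 by (intro power_increasing) auto
    then show ?thesis using P(2)[OF that] L by simp
  qed
  define G where "G S h = {y \<in> {0..<int (\<Prod>P)}. real h / (2 * L) \<le> \<bar>real_of_int (char_sum S h y)\<bar>}" for S h
  have L8: "L \<le> L ^ 8" "4 * L ^ 2 \<le> L ^ 8"
  proof -
    show "L \<le> L ^ 8" using power_increasing[of 1 8 L] L1 by simp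
    have "4 * L ^ 2 \<le> L * L ^ 2" using L by (intro mult_right_mono) auto
    also have "\<dots> = L ^ 3" by (simp add: power3_eq_cube power2_eq_square)
    also have "\<dots> \<le> L ^ 8" using L1 by (intro power_increasing) auto
    finally show "4 * L ^ 2 \<le> L ^ 8" .
  qed
  have sub: "scaled_blocked P A h \<subseteq> (\<Union>S\<in>Pow P - {{}}. G S h)" if h: "h \<ge> K" for h
  proof
    fix y assume y: "y \<in> scaled_blocked P A h"
    have "real h \<ge> 4 * L ^ 2" using h K L8 by linarith
    then obtain S where "S \<in> Pow P - {{}}" "real h / (2 * L) \<le> \<bar>real_of_int (char_sum S h y)\<bar>"
      using scaled_blocked_large_char_sum[OF L P w(1) A _ y] by blast
    then show "y \<in> (\<Union>S\<in>Pow P - {{}}. G S h)" using y by (auto simp: G_def scaled_blocked_def)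
  qed
  have finG: "finite (G S h)" for S h unfolding G_def by (rule finite_subset[of _ "{0..<int (\<Prod>P)}"]) auto
  define D where "D S = sqrt (real (\<Prod>S))" for S :: "nat set"
  have Gb: "real (card (G S h)) \<le> m * (16 * L ^ 4) * (3 * (1 / real h ^ 2) + (if real h < D S / L ^ 15 then 32 * L ^ 7 / D S else 0))"
    if S: "S \<in> Pow P - {{}}" and h: "h \<ge> K" for S h
  proof -
    have h0: "real h > 0" using h K L8 L by linarith
    have SP: "S \<subseteq> P" "S \<noteq> {}" "finite S" using S P(1) finite_subset by auto
    have cS: "(544::real) ^ card S \<le> L ^ 7"
    proof -
      have "(544::real) ^ card S \<le> 544 ^ card P" using SP P(1) by (intro power_increasing card_mono) auto
      then show ?thesis using w by linarith
    qed
    show ?thesis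
    proof (cases "real h < D S / L ^ 15")
      case True
      have D0: "D S \<ge> 0" unfolding D_def by (rule real_sqrt_ge_zero) (rule of_nat_0_le_iff)
      have "real (card (G S h)) \<le> m * (3 * real h ^ 2 + 32 * 544 ^ card S * real h ^ 4 / D S) / (real h / (2 * L)) ^ 4"
        unfolding G_def m_def D_def
        by (rule card_large_char_sum_le[OF P(1) _ SP(1)]) (use P p2 h0 L1 in auto)
      also have "\<dots> \<le> m * (3 * real h ^ 2 + 32 * L ^ 7 * real h ^ 4 / D S) / (real h / (2 * L)) ^ 4"
        using m0 cS h0 L1 D0 by (intro divide_right_mono mult_left_mono add_left_mono mult_right_mono) auto
      also have "\<dots> = m * (16 * L ^ 4) * (3 * (1 / real h ^ 2) + 32 * L ^ 7 / D S)"
      proof -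
        have "(3 * real h ^ 2 + 32 * L ^ 7 * real h ^ 4 / D S) / (real h / (2 * L)) ^ 4
            = 16 * L ^ 4 * ((3 * real h ^ 2 + 32 * L ^ 7 * real h ^ 4 / D S) / real h ^ 4)"
          by (simp add: power_divide power_mult_distrib)
        also have "(3 * real h ^ 2 + 32 * L ^ 7 * real h ^ 4 / D S) / real h ^ 4 = 3 * (1 / real h ^ 2) + 32 * L ^ 7 / D S"
        proof -
          have h4: "real h ^ 4 = real h ^ 2 * real h ^ 2" by (simp flip: power_add)
          have "3 * real h ^ 2 / real h ^ 4 = 3 * (1 / real h ^ 2)"
          proof -
            have "3 * c / (c * c) = 3 * (1 / c)" if "c \<noteq> 0" for c :: real using that by simp
            moreover have "real h ^ 2 \<noteq> 0" using h0 by simp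
            ultimately show ?thesis unfolding h4 .
          qed
          moreover have "32 * L ^ 7 * real h ^ 4 / D S / real h ^ 4 = 32 * L ^ 7 / D S" using h0 by simp
          ultimately show ?thesis by (simp only: add_divide_distrib)
        qed
        finally show ?thesis by (simp only: mult.assoc times_divide_eq_right[symmetric])
      qed
      finally show ?thesis using True by simp
    next
      case False
      then have "real h \<ge> sqrt (real (\<Prod>S)) / L ^ 15" by (simp add: D_def)
      then have "\<bar>real_of_int (char_sum S h y)\<bar> < real h / (2 * L)" for y
        using L SP P cS by (intro char_sum_small) auto
      then have "G S h = {}" unfolding G_def by (auto simp: not_le)
      then show ?thesis using False m0 L1 by simp
    qed
  qed
  have one: "(\<Sum>h\<in>{K..<N}. real (card (G S h))) \<le> m * (16 * L ^ 4) * (38 / L ^ 8)" if S: "S \<in> Pow P - {{}}" for S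
  proof -
    have D0: "D S > 0"
      unfolding D_def using prod_primes_pos[of S] S P by (simp del: of_nat_prod) blast
    have "(\<Sum>h\<in>{K..<N}. real (card (G S h)))
      \<le> (\<Sum>h\<in>{K..<N}. m * (16 * L ^ 4) * (3 * (1 / real h ^ 2) + (if real h < D S / L ^ 15 then 32 * L ^ 7 / D S else 0)))"
      by (intro sum_mono Gb[OF S]) auto
    also have "\<dots> = m * (16 * L ^ 4) * (3 * (\<Sum>h\<in>{K..<N}. 1 / real h ^ 2) + (\<Sum>h\<in>{K..<N}. if real h < D S / L ^ 15 then 32 * L ^ 7 / D S else 0))"
      by (simp only: sum_distrib_left[symmetric] sum.distrib)
    also have "\<dots> \<le> m * (16 * L ^ 4) * (3 * (2 / L ^ 8) + 32 / L ^ 8)"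
    proof (intro mult_left_mono add_mono)
      have K1: "K > 1" using K L8 L by linarith
      have "(\<Sum>h\<in>{K..<N}. 1 / real h ^ 2) \<le> 2 / real K" by (rule sum_inverse_squares_le[OF K1])
      also have "\<dots> \<le> 2 / L ^ 8" using K L1 K1 by (intro divide_left_mono) auto
      finally show "(\<Sum>h\<in>{K..<N}. 1 / real h ^ 2) \<le> 2 / L ^ 8" .
      have "(\<Sum>h\<in>{K..<N}. if real h < D S / L ^ 15 then 32 * L ^ 7 / D S else 0)
          = real (card {h \<in> {K..<N}. real h < D S / L ^ 15}) * (32 * L ^ 7 / D S)"
        by (simp add: sum.inter_filter[symmetric])
      also have "\<dots> \<le> D S / L ^ 15 * (32 * L ^ 7 / D S)"
      proof (rule mult_right_mono)
        have "{h \<in> {K..<N}. real h < D S / L ^ 15} \<subseteq> {1..nat \<lfloor>D S / L ^ 15\<rfloor>}"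
          using K1 by (auto simp: le_nat_iff le_floor_iff less_imp_le)
        then have "card {h \<in> {K..<N}. real h < D S / L ^ 15} \<le> card {1..nat \<lfloor>D S / L ^ 15\<rfloor>}" by (intro card_mono) auto
        then have "card {h \<in> {K..<N}. real h < D S / L ^ 15} \<le> nat \<lfloor>D S / L ^ 15\<rfloor>" by simp
        moreover have "D S / L ^ 15 \<ge> 0" using D0 L1 by simp
        ultimately show "real (card {h \<in> {K..<N}. real h < D S / L ^ 15}) \<le> D S / L ^ 15" by linarith
        show "0 \<le> 32 * L ^ 7 / D S" using D0 L1 by simp
      qed
      also have "D S / L ^ 15 * (32 * L ^ 7 / D S) = 32 / L ^ 8"
      proof -
        have L15: "L ^ 15 = L ^ 7 * L ^ 8" by (simp flip: power_add)
        have "x / (a * b) * (32 * a / x) = 32 / b" if "x \<noteq> 0" "a \<noteq> 0" for a b x :: real using that by simp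
        moreover have "D S \<noteq> 0" "L ^ 7 \<noteq> 0" using D0 L1 by auto
        ultimately show ?thesis unfolding L15 .
      qed
      finally show "(\<Sum>h\<in>{K..<N}. if real h < D S / L ^ 15 then 32 * L ^ 7 / D S else 0) \<le> 32 / L ^ 8" .
    qed (use m0 L1 in auto)
    also have "3 * (2 / L ^ 8) + 32 / L ^ 8 = 38 / L ^ 8" by simp
    finally show ?thesis .
  qed
  have "(\<Sum>h\<in>{K..<N}. real (card (scaled_blocked P A h))) \<le> (\<Sum>h\<in>{K..<N}. \<Sum>S\<in>Pow P - {{}}. real (card (G S h)))"
  proof (rule sum_mono)
    fix h assume "h \<in> {K..<N}"
    then have "card (scaled_blocked P A h) \<le> card (\<Union>S\<in>Pow P - {{}}. G S h)"
      using sub[of h] finG P(1) by (intro card_mono) auto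
    also have "\<dots> \<le> (\<Sum>S\<in>Pow P - {{}}. card (G S h))" using P(1) by (intro card_UN_le) auto
    finally show "real (card (scaled_blocked P A h)) \<le> (\<Sum>S\<in>Pow P - {{}}. real (card (G S h)))"
      by (simp only: of_nat_sum[symmetric] of_nat_le_iff)
  qed
  also have "\<dots> = (\<Sum>S\<in>Pow P - {{}}. \<Sum>h\<in>{K..<N}. real (card (G S h)))" by (rule sum.swap)
  also have "\<dots> \<le> (\<Sum>S\<in>Pow P - {{}}. m * (16 * L ^ 4) * (38 / L ^ 8))" by (intro sum_mono one)
  also have "\<dots> \<le> L * (m * (16 * L ^ 4) * (38 / L ^ 8))"
  proof -
    have "card (Pow P - {{}}) \<le> card (Pow P)" using P(1) by (intro card_mono) auto
    then have "real (card (Pow P - {{}})) \<le> real (2 ^ card P)" using P(1) by (simp only: of_nat_le_iff card_Pow)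
    then have "real (card (Pow P - {{}})) \<le> L" using w(1) by (simp only: of_nat_power of_nat_numeral)
    then have "real (card (Pow P - {{}})) * (m * (16 * L ^ 4) * (38 / L ^ 8)) \<le> L * (m * (16 * L ^ 4) * (38 / L ^ 8))"
      using m0 L1 by (intro mult_right_mono) auto
    then show ?thesis by simp
  qed
  also have "\<dots> = 608 * m / L ^ 3"
  proof -
    have L8': "L ^ 8 = L * L ^ 4 * L ^ 3" by (simp flip: power_add power_Suc)
    have "a * (m * (16 * b) * (38 / (a * b * c))) = 608 * m / c" if "a \<noteq> 0" "b \<noteq> 0" for a b c :: real
      using that by simp
    moreover have "L \<noteq> 0" "L ^ 4 \<noteq> 0" using L1 by auto
    ultimately show ?thesis unfolding L8' .
  qed
  finally show ?thesis by (simp only: m_def)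
qed

section \<open>Gaps and free intervals\<close>

lemma sum_consecutive_intervals:
  fixes w :: "nat \<Rightarrow> int" and F :: "int \<Rightarrow> 'a::comm_monoid_add"
  assumes "\<And>i. i < k \<Longrightarrow> w i \<le> w (Suc i)"
  shows "(\<Sum>i<k. \<Sum>x\<in>{w i..<w (Suc i)}. F x) = (\<Sum>x\<in>{w 0..<w k}. F x)"
  using assms
proof (induction k)
  case (Suc k)
  have le: "w 0 \<le> w k"
  proof -
    have "w 0 \<le> w j" if "j \<le> k" for j
      using that by (induction j) (auto intro!: order.trans[OF _ Suc.prems])
    then show ?thesis by simp
  qed
  have "{w 0..<w (Suc k)} = {w 0..<w k} \<union> {w k..<w (Suc k)}" using le Suc.prems[of k] by auto
  moreover have "{w 0..<w k} \<inter> {w k..<w (Suc k)} = {}" by auto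
  ultimately have "(\<Sum>x\<in>{w 0..<w (Suc k)}. F x) = (\<Sum>x\<in>{w 0..<w k}. F x) + (\<Sum>x\<in>{w k..<w (Suc k)}. F x)"
    by (simp add: sum.union_disjoint)
  then show ?case using Suc by simp
qed simp

lemma sum_distance_to_end: "2 * (\<Sum>x\<in>{b - int s..<b}. b - x) = int s * (int s + 1)"
proof (induction s)
  case (Suc s)
  have "{b - int (Suc s)..<b} = insert (b - int s - 1) {b - int s..<b}" by auto
  then have "(\<Sum>x\<in>{b - int (Suc s)..<b}. b - x) = (int s + 1) + (\<Sum>x\<in>{b - int s..<b}. b - x)" by simp
  then show ?case using Suc by (simp add: algebra_simps)
qed simp

text \<open>An interval of length \<open>h\<close> following \<open>x\<close> misses the set exactly when \<open>h\<close> is smaller than the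
  distance from \<open>x\<close> to the next element; a gap \<open>s\<close> therefore contributes \<open>s(s+1)/2\<close> pairs \<open>(x, h)\<close>.\<close>

lemma gap_square_sum_eq_free_counts:
  fixes n :: nat and B :: "int \<Rightarrow> bool"
  assumes per: "\<And>y. B (y mod int n) \<longleftrightarrow> B y" and U: "U = {y. y < n \<and> B (int y)}" and ne: "U \<noteq> {}"
  shows "gap_square_sum n U
    = 2 * (\<Sum>h<n. int (card {x \<in> {0..<int n}. \<forall>j\<in>{1..int h}. \<not> B (x + j)})) - int n"
proof -
  have fin: "finite U" using U by auto
  define u where "u = sorted_list_of_set U"
  define k where "k = card U"
  have k0: "k > 0" using fin ne by (simp add: k_def card_gt_0_iff)
  have len: "length u = k" by (simp add: u_def k_def)
  have set_u: "set u = U" using fin by (simp add: u_def)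
  have srt: "u ! i < u ! j" if "i < j" "j < k" for i j
    using that len unfolding u_def
    by (intro sorted_wrt_nth_less[of "(<)"]) (auto simp: strict_sorted_list_of_set)
  have n0: "n > 0" using ne U by auto
  have un: "u ! i < n" "B (int (u ! i))" if "i < k" for i
    using that len set_u U nth_mem[of i u] by auto
  have inU: "\<exists>i<k. y = u ! i" if "y \<in> U" for y using that set_u len by (metis in_set_conv_nth)
  \<comment> \<open>Appending the first element shifted by n makes every cyclic gap, the wrapped one
    included, a difference of consecutive values.\<close>
  define w where "w i = (if i < k then int (u ! i) else int (u ! 0) + int n)" for i
  have wlt: "w i < w (Suc i)" if "i < k" for i
    using that srt[of i "Suc i"] un[of i] by (auto simp: w_def)
  have gap: "cyclic_gap n U i = w (Suc i) - w i" if "i < k" for i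
    using that by (auto simp: cyclic_gap_def w_def u_def[symmetric] k_def[symmetric] Let_def)
  \<comment> \<open>Gaps have length at most n, with equality for a single element; this is why the
    lengths h < n see all free intervals.\<close>
  have w_le: "w (Suc i) \<le> w i + int n" if "i < k" for i
  proof (cases "Suc i < k")
    case True
    then show ?thesis using un[of "Suc i"] that by (simp add: w_def)
  next
    case False
    then have "i = 0 \<or> u ! 0 < u ! i" using that srt[of 0 i] by auto
    then show ?thesis using False that by (auto simp: w_def)
  qed
  have Bw: "B (w (Suc i))" if "i < k" for i
  proof (cases "Suc i < k")
    case True
    then show ?thesis using un[of "Suc i"] by (simp add: w_def)
  next
    case False
    have "B ((int (u ! 0) + int n) mod int n)" using un[of 0] k0 by simp
    then have "B (int (u ! 0) + int n)" by (simp only: per)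
    then show ?thesis using False by (simp add: w_def)
  qed
  have nB: "\<not> B y" if i: "i < k" and y: "w i < y" "y < w (Suc i)" for i y
  proof
    assume By: "B y"
    have y0: "y \<ge> 0" using y i by (simp add: w_def)
    show False
    proof (cases "y < int n")
      case True
      then have "nat y \<in> U" using By y0 by (simp add: U)
      then obtain l where l: "l < k" "nat y = u ! l" using inU by blast
      have "i < l"
      proof (rule ccontr)
        assume "\<not> i < l"
        then have "u ! l \<le> u ! i" using srt[of l i] i by (cases "l = i") auto
        then show False using y(1) l i y0 by (simp add: w_def)
      qed
      then have "w (Suc i) \<le> int (u ! l)" using l srt[of "Suc i" l] by (cases "l = Suc i") (auto simp: w_def)
      then show False using y l y0 by simp
    next
      case False
      then have last: "\<not> Suc i < k" using y un[of "Suc i"] by (auto simp: w_def)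
      then have "y - int n < int (u ! 0)" using y by (simp add: w_def)
      moreover have "B (y - int n)" using By per[of y] per[of "y - int n"] by (simp add: mod_diff_right_eq)
      moreover have "y - int n < int n" using \<open>y - int n < int (u ! 0)\<close> un[of 0] k0 by simp
      ultimately have "nat (y - int n) \<in> U" using False by (simp add: U)
      then obtain l where l: "l < k" "nat (y - int n) = u ! l" using inU by blast
      have "u ! 0 \<le> u ! l" using srt[of 0 l] l by (cases "l = 0") auto
      then show False using l \<open>y - int n < int (u ! 0)\<close> False by simp
    qed
  qed
  define Q where "Q x h = (\<forall>j\<in>{1..int h}. \<not> B (x + j))" for x h
  have Q_iff: "Q x h \<longleftrightarrow> int h < w (Suc i) - x" if i: "i < k" and x: "x \<in> {w i..<w (Suc i)}" for i x h
  proof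
    assume q: "Q x h"
    show "int h < w (Suc i) - x"
    proof (rule ccontr)
      assume "\<not> ?thesis"
      then have "w (Suc i) - x \<in> {1..int h}" using x by auto
      then have "\<not> B (x + (w (Suc i) - x))" using q unfolding Q_def by blast
      then show False using Bw[OF i] by simp
    qed
  next
    assume "int h < w (Suc i) - x"
    then show "Q x h" unfolding Q_def using nB[OF i] x by auto
  qed
  \<comment> \<open>This will be the distance from x to the next element of the set, which is x + n
    at the latest when x itself belongs to it.\<close>
  define t where "t x = (\<Sum>h<n. of_bool (Q x h) :: int)" for x
  have t_val: "t x = w (Suc i) - x" if i: "i < k" and x: "x \<in> {w i..<w (Suc i)}" for i x
  proof -
    have "t x = int (card {h \<in> {..<n}. Q x h})" unfolding t_def by (simp add: Int_def)
    also have "{h \<in> {..<n}. Q x h} = {..<nat (w (Suc i) - x)}"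
    proof (rule Set.set_eqI)
      fix h
      have "w (Suc i) - x \<le> int n" using w_le[OF i] x by simp
      then show "h \<in> {h \<in> {..<n}. Q x h} \<longleftrightarrow> h \<in> {..<nat (w (Suc i) - x)}"
        unfolding mem_Collect_eq lessThan_iff Q_iff[OF i x] by linarith
    qed
    finally show ?thesis using x by simp
  qed
  have t_per: "t (x mod int n) = t x" for x
  proof -
    have "B (x mod int n + j) = B (x + j)" for j
      using per[of "x mod int n + j"] per[of "x + j"] by (simp add: mod_add_left_eq)
    then show ?thesis by (simp add: t_def Q_def)
  qed
  have "(\<Sum>h<n. int (card {x \<in> {0..<int n}. Q x h})) = (\<Sum>h<n. \<Sum>x\<in>{0..<int n}. of_bool (Q x h))"
    by (intro sum.cong refl) (simp add: Int_def)
  also have "\<dots> = (\<Sum>x\<in>{0..<int n}. t x)" unfolding t_def by (rule sum.swap)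
  \<comment> \<open>The period is made to start at the first element, so that it splits exactly into
    gaps.\<close>
  also have "\<dots> = (\<Sum>x\<in>{0..<int n}. t (x + w 0))"
    by (rule sum_periodic_shift[symmetric]) (use n0 t_per in auto)
  also have "\<dots> = (\<Sum>x\<in>{w 0..<w k}. t x)"
    by (rule sum.reindex_bij_witness[of _ "\<lambda>x. x - w 0" "\<lambda>x. x + w 0"]) (use k0 in \<open>auto simp: w_def\<close>)
  also have "\<dots> = (\<Sum>i<k. \<Sum>x\<in>{w i..<w (Suc i)}. t x)"
    by (rule sum_consecutive_intervals[symmetric]) (use wlt in \<open>auto intro: less_imp_le\<close>)
  also have "\<dots> = (\<Sum>i<k. \<Sum>x\<in>{w i..<w (Suc i)}. w (Suc i) - x)"
    using t_val by (intro sum.cong refl) auto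
  finally have "2 * (\<Sum>h<n. int (card {x \<in> {0..<int n}. Q x h})) = (\<Sum>i<k. 2 * (\<Sum>x\<in>{w i..<w (Suc i)}. w (Suc i) - x))"
    by (simp add: sum_distrib_left)
  also have "\<dots> = (\<Sum>i<k. (w (Suc i) - w i)\<^sup>2 + (w (Suc i) - w i))"
  proof (intro sum.cong refl)
    fix i assume "i \<in> {..<k}"
    then obtain s where s: "w (Suc i) = w i + int s" using wlt[of i] by (metis lessThan_iff less_imp_le zle_iff_zadd)
    then have s': "w (Suc i) - int s = w i" "w (Suc i) - w i = int s" by simp_all
    have "2 * (\<Sum>x\<in>{w i..<w (Suc i)}. w (Suc i) - x) = int s * (int s + 1)"
      using sum_distance_to_end[of "w (Suc i)" s] unfolding s'(1) .
    then show "2 * (\<Sum>x\<in>{w i..<w (Suc i)}. w (Suc i) - x) = (w (Suc i) - w i)\<^sup>2 + (w (Suc i) - w i)"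
      unfolding s'(2) by (simp only: power2_eq_square distrib_left mult_1_right)
  qed
  also have "\<dots> = gap_square_sum n U + (\<Sum>i<k. w (Suc i) - w i)"
    by (simp add: sum.distrib gap_square_sum_def k_def[symmetric] gap)
  also have "(\<Sum>i<k. w (Suc i) - w i) = int n"
    using sum_lessThan_telescope[of w k] k0 by (simp add: w_def)
  finally show ?thesis unfolding Q_def by simp
qed

section \<open>The main term\<close>

lemma card_periodic_full:
  fixes A :: nat and B :: "int \<Rightarrow> bool"
  assumes "A > 0" "\<And>y. B (y mod int A) \<longleftrightarrow> B y"
  shows "card {j \<in> {1..int A}. B (y + j)} = card {y \<in> {0..<int A}. B y}"
proof -
  have "card {j \<in> {1..int A}. B (y + j)} = (\<Sum>j\<in>{1..int A}. of_bool (B (y + j)))" by (simp add: Int_def)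
  also have "\<dots> = (\<Sum>x\<in>{0..<int A}. of_bool (B (x + (y + 1))))"
    by (rule sum.reindex_bij_witness[of _ "\<lambda>x. x + 1" "\<lambda>x. x - 1"]) (auto simp: algebra_simps)
  also have "\<dots> = (\<Sum>x\<in>{0..<int A}. of_bool (B x))"
    by (rule sum_periodic_shift) (use assms in auto)
  also have "\<dots> = card {y \<in> {0..<int A}. B y}" by (simp add: Int_def)
  finally show ?thesis .
qed

lemma card_window_add:
  fixes B :: "int \<Rightarrow> bool"
  shows "card {j \<in> {1..int (h + k)}. B (y + j)} = card {j \<in> {1..int h}. B (y + j)} + card {j \<in> {1..int k}. B (y + int h + j)}"
proof -
  have "{j \<in> {1..int (h + k)}. B (y + j)} = {j \<in> {1..int h}. B (y + j)} \<union> (\<lambda>j. j + int h) ` {j \<in> {1..int k}. B (y + int h + j)}"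
  proof (intro equalityI subsetI)
    fix j assume j: "j \<in> {j \<in> {1..int (h + k)}. B (y + j)}"
    show "j \<in> {j \<in> {1..int h}. B (y + j)} \<union> (\<lambda>j. j + int h) ` {j \<in> {1..int k}. B (y + int h + j)}"
    proof (cases "j \<le> int h")
      case False
      then have "j - int h \<in> {j \<in> {1..int k}. B (y + int h + j)}" using j by (auto simp: algebra_simps)
      then show ?thesis by (auto intro: image_eqI[where x = "j - int h"])
    qed (use j in auto)
  qed (auto simp: algebra_simps)
  moreover have "{j \<in> {1..int h}. B (y + j)} \<inter> (\<lambda>j. j + int h) ` {j \<in> {1..int k}. B (y + int h + j)} = {}" by auto
  moreover have "card ((\<lambda>j. j + int h) ` {j \<in> {1..int k}. B (y + int h + j)}) = card {j \<in> {1..int k}. B (y + int h + j)}"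
    by (rule card_image) (auto intro: inj_onI)
  moreover have "finite {j \<in> {1..int h}. B (y + j)}" "finite {j \<in> {1..int k}. B (y + int h + j)}"
    by (auto intro: finite_subset[of _ "{1..int h}"] finite_subset[of _ "{1..int k}"])
  ultimately show ?thesis by (simp add: card_Un_disjoint)
qed

text \<open>J grows by rho over a full period, so the sum over h < A K is a geometric series. Within
  one period, J(y + h, A - h) = rho - J(y, h): up to the ends h = 0 and h = A, the terms theta^J and
  theta^(rho - J) have the same total. The product of such a pair is theta^rho, which confines its
  sum to a narrow range; thus T is nearly determined by rho, however the residues modulo A are
  distributed.\<close>

lemma window_power_sum:
  fixes A :: nat and B :: "int \<Rightarrow> bool" and \<theta> :: real
  assumes A: "A > 0" and per: "\<And>y. B (y mod int A) \<longleftrightarrow> B y" and th: "0 < \<theta>" "\<theta> < 1"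
  defines "J \<equiv> \<lambda>y h. card {j \<in> {1..int h}. B (y + j)}" and "\<rho> \<equiv> card {y \<in> {0..<int A}. B y}"
  assumes \<rho>: "\<rho> > 0"
  defines "T \<equiv> (\<Sum>y\<in>{0..<int A}. \<Sum>h<A. \<theta> ^ J y h)"
  shows "(\<Sum>y\<in>{0..<int A}. \<Sum>h<A*K. \<theta> ^ J y h) = T * (1 - \<theta> ^ (\<rho> * K)) / (1 - \<theta> ^ \<rho>)"
    and "real A ^ 2 * sqrt (\<theta> ^ \<rho>) \<le> T - real A * (1 - \<theta> ^ \<rho>) / 2"
    and "T - real A * (1 - \<theta> ^ \<rho>) / 2 \<le> real A ^ 2 * (1 + \<theta> ^ \<rho>) / 2"
proof -
  have JA: "J y A = \<rho>" for y unfolding J_def \<rho>_def by (rule card_periodic_full[where B = B]) (use A per in auto)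
  have Jadd: "J y (h + k) = J y h + J (y + int h) k" for y h k unfolding J_def by (rule card_window_add)
  have J0: "J y 0 = 0" for y unfolding J_def by (auto simp: card_eq_0_iff)
  have Jper: "J (y mod int A) h = J y h" for y h
  proof -
    have "B (y mod int A + j) = B (y + j)" for j
      using per[of "y mod int A + j"] per[of "y + j"] by (simp add: mod_add_left_eq)
    then show ?thesis by (simp add: J_def)
  qed
  have th1: "\<theta> ^ \<rho> < 1" using th \<rho> by (simp add: power_less_one_iff)
  have JkA: "J y (A * k + h) = \<rho> * k + J y h" for y k h
  proof -
    have "J y (A * k) = \<rho> * k" for y
    proof (induction k arbitrary: y)
      case (Suc k)
      have "J y (A * Suc k) = J y A + J (y + int A) (A * k)" using Jadd[of y A "A * k"] by simp
      then show ?case using Suc JA by simp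
    qed (simp add: J0)
    moreover have "J (y + int (A * k)) h = J y h" using Jper[of "y + int (A * k)" h] Jper[of y h] by simp
    ultimately show ?thesis by (simp add: Jadd)
  qed
  show "(\<Sum>y\<in>{0..<int A}. \<Sum>h<A*K. \<theta> ^ J y h) = T * (1 - \<theta> ^ (\<rho> * K)) / (1 - \<theta> ^ \<rho>)"
  proof -
    have "(\<Sum>h<A*K. \<theta> ^ J y h) = (\<Sum>k<K. (\<theta> ^ \<rho>) ^ k) * (\<Sum>h<A. \<theta> ^ J y h)" for y
    proof (induction K)
      case (Suc K)
      have "(\<Sum>h<A * Suc K. \<theta> ^ J y h) = (\<Sum>h<A*K. \<theta> ^ J y h) + (\<Sum>h\<in>{A*K..<A*K+A}. \<theta> ^ J y h)"
        using sum.union_disjoint[of "{..<A*K}" "{A*K..<A*K+A}" "\<lambda>h. \<theta> ^ J y h"]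
        by (simp add: ivl_disj_un ivl_disj_int add.commute)
      also have "(\<Sum>h\<in>{A*K..<A*K+A}. \<theta> ^ J y h) = (\<Sum>h<A. \<theta> ^ J y (A * K + h))"
        by (rule sum.reindex_bij_witness[of _ "\<lambda>h. A * K + h" "\<lambda>h. h - A * K"]) auto
      also have "\<dots> = (\<theta> ^ \<rho>) ^ K * (\<Sum>h<A. \<theta> ^ J y h)"
        by (simp add: JkA power_add power_mult sum_distrib_left)
      finally show ?case using Suc by (simp add: distrib_right)
    qed simp
    then have "(\<Sum>y\<in>{0..<int A}. \<Sum>h<A*K. \<theta> ^ J y h) = (\<Sum>k<K. (\<theta> ^ \<rho>) ^ k) * T"
      by (simp add: T_def sum_distrib_left)
    also have "(\<Sum>k<K. (\<theta> ^ \<rho>) ^ k) = (1 - (\<theta> ^ \<rho>) ^ K) / (1 - \<theta> ^ \<rho>)"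
      using th1 by (subst sum_gp_strict) auto
    finally show ?thesis by (simp add: power_mult mult.commute[of T])
  qed
  define f where "f h = (\<Sum>y\<in>{0..<int A}. \<theta> ^ J y h)" for h
  have Jle: "J y h \<le> \<rho>" if "h \<le> A" for y h using Jadd[of y h "A - h"] JA[of y] that by simp
  have reflect: "(\<Sum>y\<in>{0..<int A}. \<theta> ^ (\<rho> - J y h)) = f (A - h)" if "h \<le> A" for h
  proof -
    have "\<rho> - J y h = J (y + int h) (A - h)" for y using Jadd[of y h "A - h"] JA[of y] that by simp
    then have "(\<Sum>y\<in>{0..<int A}. \<theta> ^ (\<rho> - J y h)) = (\<Sum>y\<in>{0..<int A}. \<theta> ^ J (y + int h) (A - h))" by simp
    also have "\<dots> = f (A - h)" unfolding f_def by (rule sum_periodic_shift) (use A Jper in auto)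
    finally show ?thesis .
  qed
  define W where "W = (\<Sum>y\<in>{0..<int A}. \<Sum>h<A. \<theta> ^ J y h + \<theta> ^ (\<rho> - J y h))"
  have Tf: "T = (\<Sum>h<A. f h)" unfolding T_def f_def by (rule sum.swap)
  have "W = (\<Sum>h<A. f h + f (A - h))"
  proof -
    have "W = (\<Sum>h<A. \<Sum>y\<in>{0..<int A}. \<theta> ^ J y h + \<theta> ^ (\<rho> - J y h))" unfolding W_def by (rule sum.swap)
    also have "\<dots> = (\<Sum>h<A. f h + f (A - h))"
      by (intro sum.cong refl) (simp add: sum.distrib reflect f_def[symmetric])
    finally show ?thesis .
  qed
  \<comment> \<open>The reflection sends h = 0, ..., A - 1 to A, ..., 1. The exchange of
    \<open>f 0\<close> for \<open>f A\<close> is the correction A (1 - theta^rho) / 2 in the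
    statement.\<close>
  also have "\<dots> = T + (\<Sum>h<A. f (A - h))" by (simp add: sum.distrib Tf)
  also have "(\<Sum>h<A. f (A - h)) = (\<Sum>h<A. f (Suc h))"
    by (rule sum.reindex_bij_witness[of _ "\<lambda>h. A - Suc h" "\<lambda>h. A - Suc h"]) (auto simp: Suc_diff_Suc)
  also have "\<dots> = T + f A - f 0" using sum.lessThan_Suc_shift[of f A] by (simp add: Tf)
  also have "f A = real A * \<theta> ^ \<rho>" by (simp add: f_def JA)
  also have "f 0 = real A" by (simp add: f_def J0)
  finally have W: "T - real A * (1 - \<theta> ^ \<rho>) / 2 = W / 2" by (simp add: field_simps)
  \<comment> \<open>Arithmetic-geometric mean for the pair; the bound \<open>hi\<close> is (1 - x)(1
    - y) >= 0 with x y = theta^rho.\<close>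
  have lo: "2 * sqrt (\<theta> ^ \<rho>) \<le> \<theta> ^ J y h + \<theta> ^ (\<rho> - J y h)" if "h < A" for y h
  proof -
    have "\<theta> ^ \<rho> = \<theta> ^ J y h * \<theta> ^ (\<rho> - J y h)" using Jle[of h y] that by (simp add: power_add[symmetric])
    then show ?thesis using arith_geo_mean_sqrt[of "\<theta> ^ J y h" "\<theta> ^ (\<rho> - J y h)"] th by simp
  qed
  have hi: "\<theta> ^ J y h + \<theta> ^ (\<rho> - J y h) \<le> 1 + \<theta> ^ \<rho>" if "h < A" for y h
  proof -
    have "\<theta> ^ \<rho> = \<theta> ^ J y h * \<theta> ^ (\<rho> - J y h)" using Jle[of h y] that by (simp add: power_add[symmetric])
    moreover have "0 \<le> (1 - \<theta> ^ J y h) * (1 - \<theta> ^ (\<rho> - J y h))"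
      using th by (intro mult_nonneg_nonneg) (auto simp: power_le_one)
    ultimately show ?thesis by (simp add: algebra_simps)
  qed
  have "(\<Sum>y\<in>{0..<int A}. \<Sum>h<A. 2 * sqrt (\<theta> ^ \<rho>)) \<le> W" unfolding W_def by (intro sum_mono lo) auto
  then show "real A ^ 2 * sqrt (\<theta> ^ \<rho>) \<le> T - real A * (1 - \<theta> ^ \<rho>) / 2"
    unfolding W by (simp add: power2_eq_square)
  have "W \<le> (\<Sum>y\<in>{0..<int A}. \<Sum>h<A. 1 + \<theta> ^ \<rho>)" unfolding W_def by (intro sum_mono hi) auto
  then show "T - real A * (1 - \<theta> ^ \<rho>) / 2 \<le> real A ^ 2 * (1 + \<theta> ^ \<rho>) / 2"
    unfolding W by (simp add: power2_eq_square)
qed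

section \<open>Expansions of exp and ln and the evaluation of the main term\<close>

lemma exp_minus_bounds:
  fixes z :: real
  assumes "0 \<le> z"
  shows "1 - z + z^2/2 - z^3/6 \<le> exp (- z)" "exp (- z) \<le> 1 - z + z^2/2" "1 - z \<le> exp (- z)"
proof -
  have 1: "1 - x \<le> exp (- x)" for x :: real using exp_ge_add_one_self[of "- x"] by simp
  then show "1 - z \<le> exp (- z)" .
  have 2: "exp (- x) \<le> 1 - x + x^2/2" if "x \<ge> 0" for x :: real
  proof -
    have "(\<lambda>x. 1 - x + x^2/2 - exp (- x)) 0 \<le> (\<lambda>x. 1 - x + x^2/2 - exp (- x)) x"
      by (rule DERIV_nonneg_imp_nondecreasing[OF that])
        (use 1 in \<open>auto intro!: exI derivative_eq_intros simp: algebra_simps\<close>)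
    then show ?thesis by simp
  qed
  then show "exp (- z) \<le> 1 - z + z^2/2" using assms .
  have "(\<lambda>x. exp (- x) - (1 - x + x^2/2 - x^3/6)) 0 \<le> (\<lambda>x. exp (- x) - (1 - x + x^2/2 - x^3/6)) z"
  proof (rule DERIV_nonneg_imp_nondecreasing[OF assms])
    fix x :: real assume x: "0 \<le> x"
    have "((\<lambda>x. exp (- x) - (1 - x + x^2/2 - x^3/6)) has_real_derivative (1 - x + x^2/2 - exp (- x))) (at x)"
      by (auto intro!: derivative_eq_intros simp: power2_eq_square algebra_simps)
    then show "\<exists>y. ((\<lambda>x. exp (- x) - (1 - x + x^2/2 - x^3/6)) has_real_derivative y) (at x) \<and> 0 \<le> y"
      using 2[OF x] by (intro exI conjI) auto
  qed
  then show "1 - z + z^2/2 - z^3/6 \<le> exp (- z)" by simp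
qed

text \<open>The two expressions are coth(z/2) / 2 and 1 / (2 sinh(z/2)). With theta^rho = exp(-z)
  they are the upper and the lower bound from the reflection, and both are 1/z + O(z).\<close>

lemma coth_bounds:
  fixes z :: real
  assumes z: "0 < z" "z \<le> 1"
  shows "(1 + exp (- z)) / (2 * (1 - exp (- z))) \<le> 1 / z + z"
    and "1 / z - z \<le> exp (- z / 2) / (1 - exp (- z))"
proof -
  define E where "E = exp (- z)"
  note b = exp_minus_bounds[of z, folded E_def]
  have E1: "E < 1" using z by (simp add: E_def)
  have "z * (1 + E) \<le> (2 + 2 * z^2) * (1 - E)"
  proof -
    have "z * (1 + E) \<le> z * (2 - z + z^2/2)" using b z by (intro mult_left_mono) auto
    also have "\<dots> \<le> (2 + 2 * z^2) * (z - z^2/2)"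
    proof -
      have "(2 + 2 * z^2) * (z - z^2/2) - z * (2 - z + z^2/2) = z^3 * (3/2 - z)"
        by (simp add: power2_eq_square power3_eq_cube algebra_simps)
      moreover have "z^3 * (3/2 - z) \<ge> 0" using z by (intro mult_nonneg_nonneg) auto
      ultimately show ?thesis by linarith
    qed
    also have "\<dots> \<le> (2 + 2 * z^2) * (1 - E)" using b z by (intro mult_left_mono) auto
    finally show ?thesis .
  qed
  then show "(1 + exp (- z)) / (2 * (1 - exp (- z))) \<le> 1 / z + z"
    using z E1 unfolding E_def[symmetric] by (simp add: divide_simps power2_eq_square algebra_simps)
  have "(1 - z^2) * (1 - E) \<le> z * exp (- z / 2)"
  proof -
    have "(1 - z^2) * (1 - E) \<le> (1 - z^2) * (z - z^2/2 + z^3/6)"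
      using b z by (intro mult_left_mono) (auto simp: power2_eq_square mult_le_one)
    also have "\<dots> \<le> z * (1 - z / 2)"
    proof -
      have "z * (1 - z / 2) - (1 - z^2) * (z - z^2/2 + z^3/6) = z^3 * (5/6 - z/2 + z^2/6)"
        by (simp add: power2_eq_square power3_eq_cube field_simps)
      moreover have "z^3 * (5/6 - z/2 + z^2/6) \<ge> 0"
        using z by (intro mult_nonneg_nonneg) (auto intro!: add_nonneg_nonneg)
      ultimately show ?thesis by linarith
    qed
    also have "\<dots> \<le> z * exp (- z / 2)" using exp_minus_bounds(3)[of "z / 2"] z by (intro mult_left_mono) auto
    finally show ?thesis .
  qed
  then show "1 / z - z \<le> exp (- z / 2) / (1 - exp (- z))"
    using z E1 unfolding E_def[symmetric] by (simp add: divide_simps power2_eq_square algebra_simps)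
qed

text \<open>The quadratic term has to be exact: it gives 1/kappa = 1/q - 1/2 + O(q) for kappa =
  -ln(1 - q), and the -1/2 produces the secondary term of the asymptotic formula.\<close>

lemma neg_ln_one_minus_bounds:
  fixes q :: real
  assumes q: "0 < q" "q \<le> 1/2"
  shows "q + q^2/2 \<le> - ln (1 - q)" "- ln (1 - q) \<le> q + q^2/2 + q^3"
proof -
  define g where "g x = - ln (1 - x) - x - x^2/2" for x :: real
  have dg: "(g has_real_derivative x^2 / (1 - x)) (at x)" if "0 \<le> x" "x \<le> q" for x
    unfolding g_def using that q
    by (auto intro!: derivative_eq_intros simp: field_simps power2_eq_square)
  have "g 0 \<le> g q"
  proof (rule DERIV_nonneg_imp_nondecreasing[of 0 q])
    fix x assume x: "0 \<le> x" "x \<le> q"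
    then show "\<exists>y. (g has_real_derivative y) (at x) \<and> 0 \<le> y"
      using dg[OF x] q by (intro exI[of _ "x^2 / (1 - x)"]) auto
  qed (use q in auto)
  then show "q + q^2/2 \<le> - ln (1 - q)" by (simp add: g_def)
  have "(\<lambda>x. x^3 - g x) 0 \<le> (\<lambda>x. x^3 - g x) q"
  proof (rule DERIV_nonneg_imp_nondecreasing[of 0 q])
    fix x assume x: "0 \<le> x" "x \<le> q"
    have "((\<lambda>x. x^3 - g x) has_real_derivative (3 * x^2 - x^2 / (1 - x))) (at x)"
      using dg[OF x] by (auto intro!: derivative_eq_intros)
    moreover have "x^2 / (1 - x) \<le> x^2 / (1/2)" using x q by (intro divide_left_mono) auto
    then have "x^2 / (1 - x) \<le> 2 * x^2" by simp
    then have "0 \<le> 3 * x^2 - x^2 / (1 - x)" using zero_le_power2[of x] by linarith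
    ultimately show "\<exists>y. ((\<lambda>x. x^3 - g x) has_real_derivative y) (at x) \<and> 0 \<le> y" by blast
  qed (use q in auto)
  then show "- ln (1 - q) \<le> q + q^2/2 + q^3" by (simp add: g_def)
qed

text \<open>With z = -rho ln(1 - q) the quotient is A/2 + A^2/z + O(A^2 z), and 1/z is close to (1/q
  - 1/2)/rho. Of the constant 3, two come from z <= 2 q rho and one from the expansion of
  1/z.\<close>

lemma window_main_term:
  fixes A \<rho> :: nat and q T :: real
  assumes q: "0 < q" "q \<le> 1/2" and \<rho>: "\<rho> > 0" "q * real \<rho> \<le> 1/2"
    and lo: "real A ^ 2 * sqrt ((1 - q) ^ \<rho>) \<le> T - real A * (1 - (1 - q) ^ \<rho>) / 2"
    and hi: "T - real A * (1 - (1 - q) ^ \<rho>) / 2 \<le> real A ^ 2 * (1 + (1 - q) ^ \<rho>) / 2"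
  shows "\<bar>T / (1 - (1 - q) ^ \<rho>) - (real A / 2 + real A ^ 2 / (q * real \<rho>) - real A ^ 2 / (2 * real \<rho>))\<bar>
    \<le> 3 * real A ^ 2 * q * real \<rho>"
proof -
  define \<kappa> where "\<kappa> = - ln (1 - q)"
  note kb = neg_ln_one_minus_bounds[OF q, folded \<kappa>_def]
  have q2: "q^2 \<le> q / 2" "q^3 \<le> q / 4"
  proof -
    show q2: "q^2 \<le> q / 2" using mult_left_mono[OF q(2), of q] q by (simp add: power2_eq_square)
    have "q^3 = q * q^2" by (simp add: power2_eq_square power3_eq_cube)
    also have "\<dots> \<le> (1/2) * (q / 2)" using q q2 by (intro mult_mono) auto
    finally show "q^3 \<le> q / 4" by simp
  qed
  have k0: "q \<le> \<kappa>" "\<kappa> \<le> 2 * q" using kb q2 q by (auto intro: order.trans[rotated])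
  define z where "z = \<kappa> * real \<rho>"
  have z: "0 < z" "z \<le> 1" "z \<le> 2 * q * real \<rho>"
  proof -
    show "0 < z" using k0 q \<rho> by (simp add: z_def)
    show "z \<le> 2 * q * real \<rho>" unfolding z_def using k0 by (intro mult_right_mono) auto
    then show "z \<le> 1" using \<rho> by linarith
  qed
  have E: "(1 - q) ^ \<rho> = exp (- z)"
  proof -
    have "exp (- z) = exp (ln (1 - q)) ^ \<rho>" by (simp add: z_def \<kappa>_def exp_of_nat_mult[symmetric] mult.commute)
    then show ?thesis using q by simp
  qed
  have sE: "sqrt (exp (- z)) = exp (- z / 2)"
  proof -
    have "exp (- z) = exp (- z / 2) ^ 2" by (simp add: exp_double[symmetric])
    then show ?thesis by simp
  qed
  define Y where "Y = T / (1 - exp (- z)) - real A / 2"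
  have E1: "1 - exp (- z) > 0" using z by simp
  have YT: "T - real A * (1 - exp (- z)) / 2 = Y * (1 - exp (- z))"
    using E1 by (simp add: Y_def field_simps)
  have a2: "real A ^ 2 \<ge> 0" by simp
  have "Y \<le> real A ^ 2 * ((1 + exp (- z)) / (2 * (1 - exp (- z))))"
    using hi E1 unfolding E YT by (simp add: field_simps)
  also have "\<dots> \<le> real A ^ 2 * (1 / z + z)" by (intro mult_left_mono coth_bounds z a2)
  finally have Y1: "Y \<le> real A ^ 2 * (1 / z + z)" .
  have "real A ^ 2 * (1 / z - z) \<le> real A ^ 2 * (exp (- z / 2) / (1 - exp (- z)))"
    by (intro mult_left_mono coth_bounds z a2)
  also have "\<dots> \<le> Y" using lo E1 unfolding E YT sE by (simp add: field_simps)
  finally have Y2: "real A ^ 2 * (1 / z - z) \<le> Y" .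
  have ik: "\<bar>1 / \<kappa> - (1 / q - 1 / 2)\<bar> \<le> q"
  proof -
    have "1 / \<kappa> \<le> 1 / (q + q^2/2)" using kb q k0 by (intro divide_left_mono) (auto intro!: mult_pos_pos add_pos_nonneg)
    also have "\<dots> \<le> 1 / q - 1/2 + q"
    proof -
      have "(1 / q - 1/2 + q) * (q + q^2/2) = 1 + q^2 * (3/4 + q/2)"
        using q by (simp add: field_simps power2_eq_square)
      then have "1 \<le> (1 / q - 1/2 + q) * (q + q^2/2)" using q by simp
      then show ?thesis using q by (simp add: pos_divide_le_eq add_pos_nonneg)
    qed
    finally have 1: "1 / \<kappa> \<le> 1 / q - 1/2 + q" .
    have "1 / q - 1/2 - q \<le> 1 / (q + q^2/2 + q^3)"
    proof -
      have "(1 / q - 1/2 - q) * (q + q^2/2 + q^3) = 1 - q^2 * (1/4 + q + q^2)"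
        using q by (simp add: field_simps power2_eq_square power3_eq_cube)
      moreover have "q^2 * (1/4 + q + q^2) \<ge> 0" using q by simp
      ultimately have "(1 / q - 1/2 - q) * (q + q^2/2 + q^3) \<le> 1"
        by (simp only: diff_le_eq le_add_same_cancel1)
      then show ?thesis using q by (simp add: pos_le_divide_eq add_pos_nonneg)
    qed
    also have "\<dots> \<le> 1 / \<kappa>" using kb k0 q by (intro divide_left_mono) (auto intro!: mult_pos_pos add_pos_nonneg)
    finally show ?thesis using 1 by linarith
  qed
  have "\<bar>1 / z - (1 / (q * real \<rho>) - 1 / (2 * real \<rho>))\<bar> = \<bar>1 / \<kappa> - (1 / q - 1 / 2)\<bar> / real \<rho>"
  proof -
    have "1 / z - (1 / (q * real \<rho>) - 1 / (2 * real \<rho>)) = (1 / \<kappa> - (1 / q - 1 / 2)) / real \<rho>"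
      by (simp add: z_def diff_divide_distrib)
    then show ?thesis by (simp add: abs_divide)
  qed
  also have "\<dots> \<le> q / real \<rho>" using ik by (intro divide_right_mono) auto
  also have "\<dots> \<le> q * real \<rho>"
  proof -
    have "q / real \<rho> \<le> q / 1" using \<rho> q by (intro divide_left_mono) auto
    also have "q / 1 \<le> q * real \<rho>" using \<rho> q by simp
    finally show ?thesis .
  qed
  finally have zz: "\<bar>1 / z - (1 / (q * real \<rho>) - 1 / (2 * real \<rho>))\<bar> \<le> q * real \<rho>" .
  define c where "c = 1 / (q * real \<rho>) - 1 / (2 * real \<rho>)"
  have "Y - real A ^ 2 * c \<le> real A ^ 2 * (1 / z + z - c)" using Y1 by (simp add: algebra_simps)
  also have "\<dots> \<le> real A ^ 2 * (3 * q * real \<rho>)"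
    using zz z unfolding c_def[symmetric] by (intro mult_left_mono a2) linarith
  finally have 1: "Y - real A ^ 2 * c \<le> real A ^ 2 * (3 * q * real \<rho>)" .
  have "real A ^ 2 * c - Y \<le> real A ^ 2 * (c - (1 / z - z))" using Y2 by (simp add: algebra_simps)
  also have "\<dots> \<le> real A ^ 2 * (3 * q * real \<rho>)"
    using zz z unfolding c_def[symmetric] by (intro mult_left_mono a2) linarith
  finally have 2: "real A ^ 2 * c - Y \<le> real A ^ 2 * (3 * q * real \<rho>)" .
  have "T / (1 - (1 - q) ^ \<rho>) - (real A / 2 + real A ^ 2 / (q * real \<rho>) - real A ^ 2 / (2 * real \<rho>)) = Y - real A ^ 2 * c"
    by (simp add: Y_def c_def E right_diff_distrib)
  then show ?thesis using 1 2 by (simp add: abs_le_iff mult.assoc mult.left_commute)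
qed

section \<open>Counting quadratic residues\<close>

lemma quad_residues_eq:
  assumes "N > 0"
  shows "quad_residues N = {y. y < N \<and> QuadRes (int N) (int y)}"
proof (intro equalityI subsetI)
  fix y assume "y \<in> quad_residues N"
  then obtain a where a: "y = a\<^sup>2 mod N" by (auto simp: quad_residues_def)
  have "[(int a)\<^sup>2 = int y] (mod int N)" unfolding a by (simp add: cong_def of_nat_mod)
  then have "QuadRes (int N) (int y)" unfolding QuadRes_def by blast
  then show "y \<in> {y. y < N \<and> QuadRes (int N) (int y)}" using a assms by simp
next
  fix y assume y: "y \<in> {y. y < N \<and> QuadRes (int N) (int y)}"
  then obtain z where z: "[z\<^sup>2 = int y] (mod int N)" by (auto simp: QuadRes_def)
  define a where "a = nat (z mod int N)"
  have a: "int a = z mod int N" using assms by (simp add: a_def)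
  have "int (a\<^sup>2 mod N) = (z mod int N)\<^sup>2 mod int N" by (simp add: of_nat_mod a[symmetric])
  also have "\<dots> = int y mod int N" using z by (simp add: cong_def power_mod)
  finally have "a\<^sup>2 mod N = y" using y by (metis mem_Collect_eq mod_less of_nat_eq_iff of_nat_mod)
  moreover have "a \<in> {0..<N}" using a assms by (simp add: a_def nat_less_iff)
  ultimately show "y \<in> quad_residues N" unfolding quad_residues_def by blast
qed

lemma QuadRes_mult_iff:
  assumes "coprime a b"
  shows "QuadRes (a * b) n \<longleftrightarrow> QuadRes a n \<and> QuadRes b n"
proof
  assume "QuadRes (a * b) n"
  then obtain y where "[y\<^sup>2 = n] (mod a * b)" by (auto simp: QuadRes_def)
  then show "QuadRes a n \<and> QuadRes b n"
    unfolding QuadRes_def using cong_dvd_modulus by (metis dvd_triv_left dvd_triv_right)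
next
  assume "QuadRes a n \<and> QuadRes b n"
  then obtain y z where y: "[y\<^sup>2 = n] (mod a)" and z: "[z\<^sup>2 = n] (mod b)" by (auto simp: QuadRes_def)
  obtain x where x: "[x = y] (mod a)" "[x = z] (mod b)"
    using binary_chinese_remainder_int[OF assms] by blast
  have "[x\<^sup>2 = n] (mod a)" "[x\<^sup>2 = n] (mod b)"
    using x y z by (meson cong_pow cong_trans)+
  then have "[x\<^sup>2 = n] (mod a * b)" using assms by (rule coprime_cong_mult)
  then show "QuadRes (a * b) n" by (auto simp: QuadRes_def)
qed

lemma QuadRes_prod_primes_iff:
  fixes P :: "nat set"
  assumes "finite P" "\<And>p. p \<in> P \<Longrightarrow> prime p"
  shows "QuadRes (int (\<Prod>P)) n \<longleftrightarrow> (\<forall>p\<in>P. QuadRes (int p) n)"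
  using assms
proof (induction P rule: finite_induct)
  case empty
  show ?case by (auto simp: QuadRes_def)
next
  case (insert p P)
  have "coprime (int p) (int (\<Prod>P))" using insert by (intro coprime_prod_primes) auto
  then have "QuadRes (int p * int (\<Prod>P)) n \<longleftrightarrow> QuadRes (int p) n \<and> QuadRes (int (\<Prod>P)) n"
    by (rule QuadRes_mult_iff)
  then show ?case using insert by simp
qed

lemma card_quad_residues_eq:
  assumes "N > 0"
  shows "card (quad_residues N) = card {y \<in> {0..<int N}. QuadRes (int N) y}"
proof (rule bij_betw_same_card[of int])
  show "bij_betw int (quad_residues N) {y \<in> {0..<int N}. QuadRes (int N) y}"
    unfolding quad_residues_eq[OF assms]
    by (rule bij_betwI[where g = nat]) auto
qed

lemma card_quad_residues_mult:
  assumes "coprime a b" "a > 0" "b > 0"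
  shows "card (quad_residues (a * b)) = card (quad_residues a) * card (quad_residues b)"
proof -
  have cop: "coprime (int a) (int b)" using assms by simp
  define F where "F y z = (of_bool (QuadRes (int a) y) * of_bool (QuadRes (int b) z) :: nat)" for y z
  have "card (quad_residues (a * b)) = (\<Sum>x\<in>{0..<int a * int b}. of_bool (QuadRes (int a * int b) x))"
    using assms by (subst card_quad_residues_eq) (auto simp: Int_def)
  also have "\<dots> = (\<Sum>x\<in>{0..<int a * int b}. F (x mod int a) (x mod int b))"
  proof (rule sum.cong[OF refl])
    fix x
    have "QuadRes (int a) (x mod int a) = QuadRes (int a) x" "QuadRes (int b) (x mod int b) = QuadRes (int b) x"
      by (rule QuadRes_cong; simp add: cong_def)+
    then show "of_bool (QuadRes (int a * int b) x) = F (x mod int a) (x mod int b)"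
      by (simp add: F_def QuadRes_mult_iff[OF cop])
  qed
  also have "\<dots> = (\<Sum>y\<in>{0..<int a}. \<Sum>z\<in>{0..<int b}. F y z)"
    using assms cop by (intro crt_sum) auto
  also have "\<dots> = (\<Sum>y\<in>{0..<int a}. of_bool (QuadRes (int a) y)) * (\<Sum>z\<in>{0..<int b}. of_bool (QuadRes (int b) z))"
    by (simp only: F_def sum_product)
  also have "\<dots> = card (quad_residues a) * card (quad_residues b)"
    using assms by (simp add: card_quad_residues_eq Int_def)
  finally show ?thesis .
qed

lemma card_quad_residues_pos: "N > 0 \<Longrightarrow> card (quad_residues N) > 0"
proof -
  assume N: "N > 0"
  have "0 \<in> quad_residues N" unfolding quad_residues_eq[OF N] using N by (auto simp: QuadRes_def intro!: exI[of _ 0])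
  moreover have "finite (quad_residues N)" unfolding quad_residues_eq[OF N] by auto
  ultimately show ?thesis by (auto simp: card_gt_0_iff)
qed

lemma card_quad_residues_le: "N > 0 \<Longrightarrow> card (quad_residues N) \<le> N"
proof -
  assume N: "N > 0"
  have "card (quad_residues N) \<le> card {..<N}" unfolding quad_residues_eq[OF N] by (intro card_mono) auto
  then show ?thesis by simp
qed

lemma card_quad_residues_prime:
  assumes p: "prime p" "p > 2"
  shows "2 * card (quad_residues p) = p + 1"
proof -
  have odd: "odd p" using p prime_odd_nat by simp
  define k where "k = (p - 1) div 2"
  have pk: "p = 2 * k + 1" using odd p by (auto simp: k_def elim!: oddE)
  define f where "f y = y\<^sup>2 mod int p" for y
  have inj: "inj_on f {0..int k}"
  proof (rule inj_onI)
    fix y z assume yz: "y \<in> {0..int k}" "z \<in> {0..int k}" "f y = f z"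
    then have "int p dvd y\<^sup>2 - z\<^sup>2" by (simp add: f_def mod_eq_dvd_iff)
    then have "int p dvd (y - z) * (y + z)" by (simp add: power2_eq_square algebra_simps)
    then have "int p dvd y - z \<or> int p dvd y + z" using p by (simp add: prime_dvd_mult_iff)
    then show "y = z"
    proof
      assume "int p dvd y - z"
      then show ?thesis using dvd_imp_le_int[of "y - z" "int p"] yz pk by (cases "y = z") auto
    next
      assume "int p dvd y + z"
      then have "y + z = 0" using zdvd_not_zless[of "y + z" "int p"] yz pk by (cases "y + z = 0") auto
      then show ?thesis using yz by auto
    qed
  qed
  have "f ` {0..int k} = {y \<in> {0..<int p}. QuadRes (int p) y}"
  proof (intro equalityI subsetI)
    fix n assume "n \<in> f ` {0..int k}"
    then obtain y where "n = y\<^sup>2 mod int p" by (auto simp: f_def)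
    then show "n \<in> {y \<in> {0..<int p}. QuadRes (int p) y}"
      using p by (auto simp: QuadRes_def cong_def intro!: exI[of _ y])
  next
    fix n assume n: "n \<in> {y \<in> {0..<int p}. QuadRes (int p) y}"
    then obtain z where z: "[z\<^sup>2 = n] (mod int p)" by (auto simp: QuadRes_def)
    define y where "y = z mod int p"
    have y: "0 \<le> y" "y < int p" "y\<^sup>2 mod int p = n" using z n p by (auto simp: y_def cong_def power_mod)
    show "n \<in> f ` {0..int k}"
    proof (cases "y \<le> int k")
      case True
      then show ?thesis using y by (intro image_eqI[of _ _ y]) (auto simp: f_def)
    next
      case False
      have "(int p - y)\<^sup>2 mod int p = y\<^sup>2 mod int p"
        by (subst mod_eq_dvd_iff) (simp add: power2_eq_square algebra_simps)
      then show ?thesis using False y pk by (intro image_eqI[of _ _ "int p - y"]) (auto simp: f_def)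
    qed
  qed
  then have "card (quad_residues p) = card (f ` {0..int k})" using p by (simp add: card_quad_residues_eq)
  also have "\<dots> = k + 1" using card_image[OF inj] by (simp add: nat_add_distrib)
  finally show ?thesis using pk by simp
qed

lemma card_quad_residues_prod_primes:
  fixes P :: "nat set"
  assumes "finite P" "\<And>p. p \<in> P \<Longrightarrow> prime p"
  shows "card (quad_residues (\<Prod>P)) = (\<Prod>p\<in>P. card (quad_residues p))"
  using assms
proof (induction P rule: finite_induct)
  case empty
  show ?case using card_quad_residues_pos[of 1] card_quad_residues_le[of 1] by simp
next
  case (insert p P)
  have "coprime p (\<Prod>P)" using coprime_prod_primes[of P p] insert by (simp del: of_nat_prod)
  moreover have "\<Prod>P > 0" using prod_primes_pos[of P] insert by auto
  ultimately show ?case using insert card_quad_residues_mult[of p "\<Prod>P"] prime_gt_0_nat[of p] by simp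
qed

text \<open>For a prime p >= 5, twice the number of residues is p + 1 <= (6/5) p <= p^1.2. The
  primes 2 and 3 violate this by a factor of at most 2 each, hence the 4. The exponent 1.2 is as
  large as the final exponent -0.4 permits.\<close>

lemma two_power_card_quad_residues_le:
  fixes P :: "nat set"
  assumes "finite P" "\<And>p. p \<in> P \<Longrightarrow> prime p"
  shows "2 ^ card P * real (card (quad_residues (\<Prod>P))) \<le> 4 * real (\<Prod>P) powr 1.2"
proof -
  define c where "c p = (if p = 2 \<or> p = 3 then 2 else 1 :: real)" for p :: nat
  have one: "2 * real (card (quad_residues p)) \<le> c p * real p powr 1.2" if "prime p" for p
  proof -
    have p1: "real p \<le> real p powr 1.2"
      using powr_mono[of 1 "1.2" "real p"] prime_ge_1_nat[OF that] by simp
    have p2: "p \<ge> 2" using that prime_ge_2_nat by blast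
    have "p = 2 \<or> p = 3 \<or> p \<ge> 5"
    proof -
      have "p \<noteq> 4"
      proof
        assume "p = 4"
        then have "2 dvd p" by simp
        then show False using \<open>p = 4\<close> that primes_dvd_imp_eq[of 2 p] two_is_prime_nat by simp
      qed
      then show ?thesis using p2 by linarith
    qed
    then consider "p = 2" | "p = 3" | "p \<ge> 5" by blast
    then show ?thesis
    proof cases
      case 1
      then show ?thesis using card_quad_residues_le[of 2] p1 by (simp add: c_def)
    next
      case 2
      then show ?thesis using card_quad_residues_prime[of 3] that p1 by (simp add: c_def)
    next
      case 3
      have "(6 / 5) ^ 5 \<le> (5::real)" by (simp add: power_divide)
      then have "6 / 5 \<le> real p powr (1/5)"
      proof -
        have "(6 / 5 :: real) = (6 / 5) powr (5 * (1/5))" by simp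
        also have "\<dots> = ((6 / 5) powr 5) powr (1/5)" by (rule powr_powr[symmetric])
        also have "(6 / 5 :: real) powr 5 = (6 / 5) ^ 5" by (rule powr_numeral) simp
        also have "((6 / 5 :: real) ^ 5) powr (1/5) \<le> real p powr (1/5)" using 3 \<open>(6 / 5) ^ 5 \<le> (5::real)\<close> by (intro powr_mono2) auto
        finally show ?thesis .
      qed
      then have "real p * (6 / 5) \<le> real p * real p powr (1/5)" by (intro mult_left_mono) auto
      also have "\<dots> = real p powr 1.2"
        using p2 powr_add[of "real p" 1 "1/5"] by simp
      finally have "real p * (6 / 5) \<le> real p powr 1.2" .
      moreover have "2 * real (card (quad_residues p)) = real p + 1"
        using card_quad_residues_prime[of p] that 3 by linarith
      ultimately show ?thesis using 3 by (simp add: c_def)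
    qed
  qed
  have "2 ^ card P * real (card (quad_residues (\<Prod>P))) = (\<Prod>p\<in>P. 2 * real (card (quad_residues p)))"
    using assms by (simp add: card_quad_residues_prod_primes prod.distrib)
  also have "\<dots> \<le> (\<Prod>p\<in>P. c p * real p powr 1.2)" using assms one by (intro prod_mono) auto
  also have "\<dots> = (\<Prod>p\<in>P. c p) * real (\<Prod>P) powr 1.2"
  proof -
    have "real (\<Prod>P) powr 1.2 = (\<Prod>p\<in>P. real p powr 1.2)"
      using assms(1) by (induction P rule: finite_induct) (auto simp: powr_mult prod_nonneg)
    then show ?thesis by (simp add: prod.distrib)
  qed
  also have "(\<Prod>p\<in>P. c p) \<le> 4"
  proof -
    have "(\<Prod>p\<in>P. c p) = (\<Prod>p\<in>P \<inter> {2, 3}. 2)"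
      unfolding c_def using assms(1) by (subst prod.inter_restrict) (auto intro!: prod.cong)
    also have "\<dots> = 2 ^ card (P \<inter> {2, 3})" by simp
    also have "\<dots> \<le> (2::real) ^ 2"
    proof (rule power_increasing)
      have "card (P \<inter> {2, 3}) \<le> card {2, 3::nat}" by (intro card_mono) auto
      then show "card (P \<inter> {2, 3}) \<le> 2" by simp
    qed simp
    finally show ?thesis by simp
  qed
  finally show ?thesis by (simp add: mult_right_mono)
qed

section \<open>The asymptotic formula for the gap sum\<close>

text \<open>Write x = A y + r with 0 <= r < A. The multiples A (y + n) with 1 <= n <= h div A lie at
  distance A n - r, between 1 and h, from x, so a free x forces y to be blocked; each y arises from
  at most A values of x.\<close>

lemma card_free_le_scaled_blocked:
  fixes A h :: nat and P :: "nat set"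
  assumes P: "finite P" "\<And>p. p \<in> P \<Longrightarrow> prime p" and A: "A > 0" and cop: "coprime A (\<Prod>P)"
  shows "card {x \<in> {0..<int (A * \<Prod>P)}. \<forall>j\<in>{1..int h}. \<not> QuadRes (int (A * \<Prod>P)) (x + j)}
    \<le> A * card (scaled_blocked P A (h div A))"
proof -
  define X where "X = {x \<in> {0..<int (A * \<Prod>P)}. \<forall>j\<in>{1..int h}. \<not> QuadRes (int (A * \<Prod>P)) (x + j)}"
  define Y where "Y = scaled_blocked P A (h div A)"
  have finY: "finite Y" unfolding Y_def scaled_blocked_def by (rule finite_subset[of _ "{0..<int (\<Prod>P)}"]) auto
  have "X \<subseteq> (\<Union>y\<in>Y. {int A * y..<int A * y + int A})"
  proof
    fix x assume x: "x \<in> X"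
    define y where "y = x div int A"
    have xy: "x = int A * y + x mod int A" by (simp add: y_def)
    have r: "0 \<le> x mod int A" "x mod int A < int A" using A by auto
    have x0: "0 \<le> x" "x < int A * int (\<Prod>P)" using x by (auto simp: X_def)
    have y0: "0 \<le> y" using x0 A by (simp add: y_def pos_imp_zdiv_nonneg_iff)
    have y1: "y < int (\<Prod>P)"
    proof -
      have "int A * y \<le> x" using xy r by linarith
      then have "int A * y < int A * int (\<Prod>P)" using x0 by linarith
      then show ?thesis using A by (simp add: mult_less_cancel_left)
    qed
    have "\<exists>p\<in>P. \<not> QuadRes (int p) (int A * (y + n))" if n: "n \<in> {1..int (h div A)}" for n
    proof -
      define j where "j = int A * n - x mod int A"
      have "int A * 1 \<le> int A * n" using n by (intro mult_left_mono) auto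
      then have j1: "1 \<le> j" unfolding j_def using r by linarith
      have "int A * n \<le> int A * int (h div A)" using n by (intro mult_left_mono) auto
      also have "\<dots> \<le> int h" by (metis of_nat_le_iff of_nat_mult times_div_less_eq_dividend)
      finally have "j \<le> int h" unfolding j_def using r by linarith
      then have nq: "\<not> QuadRes (int (A * \<Prod>P)) (x + j)" using x j1 by (auto simp: X_def)
      have xj: "x + j = int A * (y + n)" using xy by (simp add: j_def algebra_simps)
      have "QuadRes (int A) (int A * (y + n))" unfolding QuadRes_def by (rule exI[of _ 0]) (simp add: cong_def)
      moreover have "coprime (int A) (int (\<Prod>P))" using cop by (simp del: of_nat_prod)
      ultimately have "\<not> QuadRes (int (\<Prod>P)) (int A * (y + n))"
        using nq QuadRes_mult_iff[of "int A" "int (\<Prod>P)"] unfolding xj of_nat_mult by blast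
      then show ?thesis using QuadRes_prod_primes_iff[OF P] by blast
    qed
    moreover have "y \<in> {0..<int (\<Prod>P)}" using y0 y1 by (simp only: atLeastLessThan_iff)
    ultimately have "y \<in> Y" unfolding Y_def scaled_blocked_def by blast
    then show "x \<in> (\<Union>y\<in>Y. {int A * y..<int A * y + int A})" using xy r by (intro UN_I[of y]) auto
  qed
  then have "card X \<le> card (\<Union>y\<in>Y. {int A * y..<int A * y + int A})" using finY by (intro card_mono) auto
  also have "\<dots> \<le> (\<Sum>y\<in>Y. card {int A * y..<int A * y + int A})" using finY by (rule card_UN_le)
  also have "\<dots> = A * card Y" by simp
  finally show ?thesis unfolding X_def Y_def .
qed

lemma sum_div_blocks:
  fixes g :: "nat \<Rightarrow> real"
  assumes "A > 0"
  shows "(\<Sum>h\<in>{A*K..<A*(K+n)}. g (h div A)) = real A * (\<Sum>h\<in>{K..<K+n}. g h)"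
proof (induction n)
  case (Suc n)
  have "{A*K..<A*(K+Suc n)} = {A*K..<A*(K+n)} \<union> {A*(K+n)..<A*(K+n)+A}" by (auto simp: algebra_simps)
  moreover have "{A*K..<A*(K+n)} \<inter> {A*(K+n)..<A*(K+n)+A} = {}" by auto
  ultimately have "(\<Sum>h\<in>{A*K..<A*(K+Suc n)}. g (h div A))
      = (\<Sum>h\<in>{A*K..<A*(K+n)}. g (h div A)) + (\<Sum>h\<in>{A*(K+n)..<A*(K+n)+A}. g (h div A))"
    by (simp add: sum.union_disjoint)
  also have "(\<Sum>h\<in>{A*(K+n)..<A*(K+n)+A}. g (h div A)) = (\<Sum>h\<in>{A*(K+n)..<A*(K+n)+A}. g (K + n))"
  proof (intro sum.cong refl)
    fix h assume h: "h \<in> {A*(K+n)..<A*(K+n)+A}"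
    have "h div A = K + n" by (rule div_nat_eqI) (use h assms in \<open>auto simp: algebra_simps\<close>)
    then show "g (h div A) = g (K + n)" by simp
  qed
  finally show ?case using Suc by (simp add: distrib_left)
qed simp

text \<open>For an odd prime, p / |R_p| = 2p/(p + 1) = 2 (1 - 1/(p + 1)); the product of the last
  factors is bounded below as in Bernoulli's inequality. So m / |R_m| may be exchanged for
  2^omega(m).\<close>

lemma inverse_density_bounds:
  fixes P :: "nat set" and B :: real
  assumes P: "finite P" "\<And>p. p \<in> P \<Longrightarrow> prime p \<and> p > 2 \<and> real p \<ge> B" and B: "B > 0"
  shows "real (\<Prod>P) / real (card (quad_residues (\<Prod>P))) \<le> 2 ^ card P"
    and "2 ^ card P * (1 - real (card P) / B) \<le> real (\<Prod>P) / real (card (quad_residues (\<Prod>P)))"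
proof -
  define f where "f p = 1 - 1 / (real p + 1)" for p :: nat
  have one: "real p / real (card (quad_residues p)) = 2 * f p" if "p \<in> P" for p
  proof -
    have "2 * card (quad_residues p) = p + 1" using card_quad_residues_prime[of p] P(2)[OF that] by blast
    then have "real (2 * card (quad_residues p)) = real (p + 1)" by (simp only:)
    then have c: "real (card (quad_residues p)) = (real p + 1) / 2" by simp
    show ?thesis unfolding c f_def by (simp add: divide_simps)
  qed
  have eq: "real (\<Prod>P) / real (card (quad_residues (\<Prod>P))) = 2 ^ card P * (\<Prod>p\<in>P. f p)"
  proof -
    have "real (\<Prod>P) / real (card (quad_residues (\<Prod>P))) = (\<Prod>p\<in>P. real p / real (card (quad_residues p)))"
      using P by (simp add: card_quad_residues_prod_primes prod_dividef)
    also have "\<dots> = (\<Prod>p\<in>P. 2 * f p)" using one by (intro prod.cong) auto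
    finally show ?thesis by (simp add: prod.distrib)
  qed
  have f01: "0 \<le> f p" "f p \<le> 1" for p by (auto simp: f_def divide_simps)
  have "(\<Prod>p\<in>P. f p) \<le> 1" using f01 by (intro prod_le_1) auto
  then show "real (\<Prod>P) / real (card (quad_residues (\<Prod>P))) \<le> 2 ^ card P"
    unfolding eq using mult_left_mono[of "\<Prod>p\<in>P. f p" 1 "2 ^ card P"] by simp
  have "1 - real (card P) / B \<le> (\<Prod>p\<in>P. f p)"
    using P
  proof (induction P rule: finite_induct)
    case (insert p P)
    have IH: "1 - real (card P) / B \<le> (\<Prod>p\<in>P. f p)" using insert by auto
    have fp: "1 - 1 / B \<le> f p"
    proof -
      have "1 / (real p + 1) \<le> 1 / B" using insert.prems[of p] B by (intro divide_left_mono) auto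
      then show ?thesis by (simp add: f_def)
    qed
    have Pr1: "(\<Prod>p\<in>P. f p) \<le> 1" using f01 by (intro prod_le_1) auto
    have "0 \<le> (1 - f p) * (1 - (\<Prod>p\<in>P. f p))" using f01 Pr1 by (intro mult_nonneg_nonneg) auto
    then have "f p + (\<Prod>p\<in>P. f p) - 1 \<le> f p * (\<Prod>p\<in>P. f p)" by (simp add: algebra_simps)
    moreover have "1 - real (card (insert p P)) / B = (1 - 1 / B) + (1 - real (card P) / B) - 1"
      using insert.hyps by (simp add: add_divide_distrib)
    ultimately have "1 - real (card (insert p P)) / B \<le> f p * (\<Prod>p\<in>P. f p)" using fp IH by linarith
    then show ?case using insert.hyps by simp
  qed simp
  then show "2 ^ card P * (1 - real (card P) / B) \<le> real (\<Prod>P) / real (card (quad_residues (\<Prod>P)))"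
    unfolding eq by (intro mult_left_mono) auto
qed

text \<open>For h < A K every prime of P exceeds h, so distinct shifts stay distinct modulo p and
  \<open>blocked_count\<close> applies. Its error is a large negative power of L and survives
  summation over y and h. The length K = L^8 is long enough for the geometric series to be complete
  up to a negligible tail.\<close>

lemma main_part_estimate:
  fixes P :: "nat set" and A K :: nat and L :: real
  assumes L: "L \<ge> 100" and P: "finite P" "\<And>p. p \<in> P \<Longrightarrow> prime p \<and> real p > L ^ 400"
    and w: "2 ^ card P \<le> L" and A: "A > 0" "real A \<le> L" and cop: "coprime A (\<Prod>P)"
    and K: "real K \<ge> L ^ 8" "real K \<le> 2 * L ^ 8"
    and q: "(1/2) ^ card P * real (card (quad_residues A)) \<le> 1/2"
  defines "N \<equiv> \<lambda>h. card {x \<in> {0..<int (A * \<Prod>P)}. \<forall>j\<in>{1..int h}. \<not> QuadRes (int (A * \<Prod>P)) (x + j)}"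
  shows "\<bar>(\<Sum>h<A*K. real (N h)) - real (\<Prod>P) * (real A / 2 + real A ^ 2 * 2 ^ card P / real (card (quad_residues A))
      - real A ^ 2 / (2 * real (card (quad_residues A))))\<bar>
    \<le> real (\<Prod>P) * (3 * real A ^ 2 * ((1/2) ^ card P * real (card (quad_residues A))) + 1 / L)"
proof -
  define m where "m = real (\<Prod>P)"
  have m0: "m > 0" unfolding m_def using prod_primes_pos[of P] P by (auto simp del: of_nat_prod)
  define q where "q = (1/2 :: real) ^ card P"
  define \<theta> where "\<theta> = 1 - q"
  define \<rho> where "\<rho> = card {y \<in> {0..<int A}. QuadRes (int A) y}"
  have \<rho>R: "card (quad_residues A) = \<rho>" unfolding \<rho>_def by (rule card_quad_residues_eq[OF A(1)])
  have \<rho>0: "\<rho> > 0" using card_quad_residues_pos[OF A(1)] \<rho>R by simp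
  have L1: "L \<ge> 1" "L > 0" using L by auto
  have q\<rho>: "q * real \<rho> \<le> 1/2" using q by (simp add: q_def \<rho>R)
  have q0: "q > 0" by (simp add: q_def)
  have q2: "q \<le> 1/2"
  proof -
    have "q * 1 \<le> q * real \<rho>" using \<rho>0 q0 by (intro mult_left_mono) auto
    then show ?thesis using q\<rho> by linarith
  qed
  have qL: "1 / L \<le> q"
  proof -
    have "q = 1 / 2 ^ card P" by (simp add: q_def power_one_over)
    then show ?thesis using w L1 by (simp add: divide_left_mono)
  qed
  have iq: "1 / q = 2 ^ card P" by (simp add: q_def power_one_over)
  have th: "0 < \<theta>" "\<theta> < 1" using q0 q2 by (auto simp: \<theta>_def)
  define J where "J y h = card {j \<in> {1..int h}. QuadRes (int A) (y + j)}" for y h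
  have p2: "p > 2" if "p \<in> P" for p
  proof -
    have "L ^ 1 \<le> L ^ 400" using L1 by (intro power_increasing) auto
    then show ?thesis using P(2)[OF that] L by simp
  qed
  have AK: "real (A * K) \<le> 2 * L ^ 9"
  proof -
    have "real (A * K) \<le> L * (2 * L ^ 8)" unfolding of_nat_mult using A K L1 by (intro mult_mono) auto
    then show ?thesis using power_Suc[of L 8] by simp
  qed
  have AK2: "real (A * K) < L ^ 400"
  proof -
    have "2 * L ^ 9 < L * L ^ 9" using L L1 by (intro mult_strict_right_mono) auto
    also have "\<dots> = L ^ 10" using power_Suc[of L 9] by simp
    also have "\<dots> \<le> L ^ 400" using L1 by (intro power_increasing) auto
    finally show ?thesis using AK by linarith
  qed
  have Nh: "\<bar>real (N h) / m - (\<Sum>y\<in>{0..<int A}. \<theta> ^ J y h)\<bar> \<le> real A * (36 / L ^ 190)" if h: "h < A * K" for h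
  proof -
    have iff: "QuadRes (int (A * \<Prod>P)) z \<longleftrightarrow> QuadRes (int A) z \<and> (\<forall>p\<in>P. QuadRes (int p) z)" for z
    proof -
      have "coprime (int A) (int (\<Prod>P))" using cop by (simp del: of_nat_prod)
      from QuadRes_mult_iff[OF this, of z] QuadRes_prod_primes_iff[of P z] P
      show ?thesis unfolding of_nat_mult by blast
    qed
    have Neq: "N h = (\<Sum>y\<in>{0..<int A}. card (blocked P {j \<in> {1..int h}. QuadRes (int A) (y + j)}))"
      unfolding N_def iff using P A cop by (intro card_blocked_crt) auto
    have b: "\<bar>real (card (blocked P {j \<in> {1..int h}. QuadRes (int A) (y + j)})) / m - \<theta> ^ J y h\<bar> \<le> 36 / L ^ 190" for y
    proof -
      define JJ where "JJ = {j \<in> {1..int h}. QuadRes (int A) (y + j)}"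
      have finJ: "finite JJ" unfolding JJ_def by (rule finite_subset[of _ "{1..int h}"]) auto
      have cJ: "real (card JJ) \<le> 2 * L ^ 9"
      proof -
        have "card JJ \<le> card {1..int h}" unfolding JJ_def by (intro card_mono) auto
        then have "card JJ \<le> A * K" using h by simp
        then have "real (card JJ) \<le> real (A * K)" by (simp only: of_nat_le_iff)
        then show ?thesis using AK by linarith
      qed
      have "\<bar>real (card (blocked P JJ)) / m - (1 - (1/2) ^ card P) ^ card JJ\<bar> \<le> (\<Sum>p\<in>P. 18 * real (card JJ) / sqrt (real p))"
        unfolding m_def
      proof (rule blocked_count[OF P(1) _ finJ])
        show "prime p \<and> p > 2" if "p \<in> P" for p using P p2 that by blast
        fix p u v assume u: "p \<in> P" "u \<in> JJ" "v \<in> JJ" "int p dvd u - v"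
        have "int h < int p" using P(2)[OF u(1)] AK2 h by linarith
        then have "\<bar>u - v\<bar> < int p" using u by (auto simp: JJ_def)
        then show "u = v" using dvd_imp_le_int[of "u - v" "int p"] u(4) by (cases "u = v") auto
      qed
      also have "\<dots> \<le> (\<Sum>p\<in>P. 18 * (2 * L ^ 9) / L ^ 200)"
      proof (rule sum_mono)
        fix p assume p: "p \<in> P"
        have "L ^ 200 \<le> sqrt (real p)"
          by (rule real_le_rsqrt) (use P(2)[OF p] in \<open>simp flip: power_mult\<close>)
        then show "18 * real (card JJ) / sqrt (real p) \<le> 18 * (2 * L ^ 9) / L ^ 200"
          using cJ L1 by (intro frac_le) auto
      qed
      also have "\<dots> = real (card P) * (18 * (2 * L ^ 9) / L ^ 200)" by simp
      also have "\<dots> \<le> L * (18 * (2 * L ^ 9) / L ^ 200)"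
      proof (rule mult_right_mono)
        have "card P \<le> 2 ^ card P" using less_exp less_imp_le by blast
        then have "real (card P) \<le> real (2 ^ card P)" by (simp only: of_nat_le_iff)
        then show "real (card P) \<le> L" using w by (simp only: of_nat_power of_nat_numeral)
      qed (use L1 in auto)
      also have "\<dots> = 36 / L ^ 190"
      proof -
        have e: "L ^ 200 = L * L ^ 9 * L ^ 190" by (simp flip: power_add power_Suc)
        have "a * (18 * (2 * b) / (a * b * c)) = 36 / c" if "a \<noteq> 0" "b \<noteq> 0" for a b c :: real using that by simp
        moreover have "L \<noteq> 0" "L ^ 9 \<noteq> 0" using L1 by auto
        ultimately show ?thesis unfolding e .
      qed
      finally show ?thesis by (simp add: JJ_def J_def \<theta>_def q_def)
    qed
    have "\<bar>real (N h) / m - (\<Sum>y\<in>{0..<int A}. \<theta> ^ J y h)\<bar>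
        = \<bar>\<Sum>y\<in>{0..<int A}. real (card (blocked P {j \<in> {1..int h}. QuadRes (int A) (y + j)})) / m - \<theta> ^ J y h\<bar>"
      unfolding Neq by (simp add: sum_divide_distrib sum_subtractf)
    also have "\<dots> \<le> (\<Sum>y\<in>{0..<int A}. 36 / L ^ 190)" by (intro order.trans[OF sum_abs] sum_mono b)
    finally show ?thesis by simp
  qed
  define T where "T = (\<Sum>y\<in>{0..<int A}. \<Sum>h<A. \<theta> ^ J y h)"
  define Tq where "Tq = T / (1 - \<theta> ^ \<rho>)"
  define c where "c = real A / 2 + real A ^ 2 / (q * real \<rho>) - real A ^ 2 / (2 * real \<rho>)"
  have per: "QuadRes (int A) (y mod int A) \<longleftrightarrow> QuadRes (int A) y" for y
    by (rule QuadRes_cong) (simp add: cong_def)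
  note win = window_power_sum[where B = "QuadRes (int A)", OF A(1) per th, folded \<rho>_def, OF \<rho>0, folded J_def, folded T_def]
  have sumT: "(\<Sum>y\<in>{0..<int A}. \<Sum>h<A*K. \<theta> ^ J y h) = Tq * (1 - \<theta> ^ (\<rho> * K))"
    using win(1)[of K] by (simp add: Tq_def)
  have Tc: "\<bar>Tq - c\<bar> \<le> 3 * real A ^ 2 * q * real \<rho>"
    unfolding Tq_def c_def \<theta>_def
    by (rule window_main_term[OF q0 q2 \<rho>0 q\<rho>]) (use win(2,3) in \<open>simp_all add: \<theta>_def\<close>)
  have A2: "real A ^ 2 \<le> L ^ 2" using A by (intro power_mono) auto
  have LL: "L ^ 2 \<le> L ^ 3" "L \<le> L ^ 3" using power_increasing[of 2 3 L] power_increasing[of 1 3 L] L1 by auto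
  have Tbound: "\<bar>Tq\<bar> \<le> 5 * L ^ 3"
  proof -
    have r1: "real \<rho> \<ge> 1" using \<rho>0 by simp
    have "real A ^ 2 / (q * real \<rho>) = real A ^ 2 * (1 / q) / real \<rho>" by simp
    also have "\<dots> \<le> real A ^ 2 * (1 / q)" using r1 q0 by (simp add: divide_le_eq mult_le_cancel_left1)
    also have "\<dots> \<le> L ^ 2 * L" using A2 w iq L1 q0 by (intro mult_mono) auto
    also have "\<dots> = L ^ 3" by (simp add: power3_eq_cube power2_eq_square)
    finally have 1: "real A ^ 2 / (q * real \<rho>) \<le> L ^ 3" .
    have 2: "real A ^ 2 / (2 * real \<rho>) \<le> L ^ 3"
    proof -
      have "real A ^ 2 / (2 * real \<rho>) \<le> real A ^ 2 / 1" using r1 by (intro divide_left_mono) auto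
      then show ?thesis using A2 LL by simp
    qed
    have 3: "3 * real A ^ 2 * q * real \<rho> \<le> 2 * L ^ 3"
    proof -
      have "3 * real A ^ 2 * q * real \<rho> = 3 * real A ^ 2 * (q * real \<rho>)" by simp
      also have "\<dots> \<le> 3 * real A ^ 2 * (1/2)" by (intro mult_left_mono q\<rho>) auto
      finally show ?thesis using A2 LL L1 by linarith
    qed
    have pos: "real A ^ 2 / (q * real \<rho>) \<ge> 0" "real A ^ 2 / (2 * real \<rho>) \<ge> 0" using q0 by auto
    have "\<bar>c\<bar> \<le> 3 * L ^ 3"
      unfolding c_def using 1 2 pos A(2) LL by (simp only: abs_le_iff) linarith
    then show ?thesis using Tc 3 by linarith
  qed
  \<comment> \<open>The decay sets in at length 1/q <= L, and K q >= L^7.\<close>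
  have small: "\<theta> ^ (\<rho> * K) \<le> 1 / L ^ 7"
  proof -
    have "\<theta> ^ (\<rho> * K) \<le> \<theta> ^ K" using th \<rho>0 by (intro power_decreasing) auto
    also have "\<dots> \<le> exp (- q) ^ K" using exp_ge_add_one_self[of "- q"] th by (intro power_mono) (auto simp: \<theta>_def)
    also have "\<dots> = exp (- (real K * q))" by (simp add: exp_of_nat_mult[symmetric])
    also have "\<dots> \<le> exp (- (L ^ 7))"
    proof -
      have "L ^ 8 * (1 / L) \<le> real K * q" using K qL L1 by (intro mult_mono) auto
      moreover have "L ^ 8 * (1 / L) = L ^ 7"
      proof -
        have "L ^ 8 = L ^ 7 * L" using power_Suc2[of L 7] by simp
        then show ?thesis using L1 by simp
      qed
      ultimately show ?thesis by simp
    qed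
    also have "\<dots> = 1 / exp (L ^ 7)" by (simp add: exp_minus field_simps)
    also have "\<dots> \<le> 1 / L ^ 7"
    proof (rule divide_left_mono)
      show "L ^ 7 \<le> exp (L ^ 7)" using exp_ge_add_one_self[of "L ^ 7"] by linarith
    qed (use L1 in auto)
    finally show ?thesis .
  qed
  have e1: "\<bar>(\<Sum>h<A*K. real (N h) / m) - Tq * (1 - \<theta> ^ (\<rho> * K))\<bar> \<le> 2 * L ^ 9 * (L * (36 / L ^ 190))"
  proof -
    have "Tq * (1 - \<theta> ^ (\<rho> * K)) = (\<Sum>h<A*K. \<Sum>y\<in>{0..<int A}. \<theta> ^ J y h)"
      unfolding sumT[symmetric] by (rule sum.swap)
    then have "\<bar>(\<Sum>h<A*K. real (N h) / m) - Tq * (1 - \<theta> ^ (\<rho> * K))\<bar>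
        = \<bar>\<Sum>h<A*K. real (N h) / m - (\<Sum>y\<in>{0..<int A}. \<theta> ^ J y h)\<bar>" by (simp add: sum_subtractf)
    also have "\<dots> \<le> (\<Sum>h<A*K. real A * (36 / L ^ 190))" using Nh by (intro order.trans[OF sum_abs] sum_mono) auto
    also have "\<dots> = real (A * K) * (real A * (36 / L ^ 190))" by simp
    also have "\<dots> \<le> 2 * L ^ 9 * (L * (36 / L ^ 190))"
      using AK A L1 by (intro mult_mono) auto
    finally show ?thesis .
  qed
  have e2: "\<bar>Tq * (1 - \<theta> ^ (\<rho> * K)) - Tq\<bar> \<le> 5 * L ^ 3 * (1 / L ^ 7)"
  proof -
    have "\<bar>Tq * (1 - \<theta> ^ (\<rho> * K)) - Tq\<bar> = \<bar>Tq\<bar> * \<theta> ^ (\<rho> * K)"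
      using th by (simp add: algebra_simps abs_mult)
    also have "\<dots> \<le> 5 * L ^ 3 * (1 / L ^ 7)" using Tbound small th L1 by (intro mult_mono) auto
    finally show ?thesis .
  qed
  have n1: "2 * L ^ 9 * (L * (36 / L ^ 190)) + 5 * L ^ 3 * (1 / L ^ 7) \<le> 1 / L"
  proof -
    have L180: "L ^ 190 = L ^ 9 * L * L * L ^ 179" and L7: "L ^ 7 = L ^ 3 * L * L ^ 3"
      by (simp_all flip: power_add power_Suc power_Suc2)
    have "2 * L ^ 9 * (L * (36 / L ^ 190)) = 72 / (L * L ^ 179)"
      unfolding L180 using L1 by simp
    also have "\<dots> \<le> 72 / (L * 100)"
    proof (intro divide_left_mono mult_left_mono)
      have "L ^ 1 \<le> L ^ 179" using L1 by (intro power_increasing) auto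
      then show "100 \<le> L ^ 179" using L by simp
    qed (use L1 in auto)
    finally have 1: "2 * L ^ 9 * (L * (36 / L ^ 190)) \<le> 72 / 100 * (1 / L)" by simp
    have "5 * L ^ 3 * (1 / L ^ 7) = 5 / (L * L ^ 3)" unfolding L7 using L1 by simp
    also have "\<dots> \<le> 5 / (L * 100)"
      using L LL(2) L1 by (intro divide_left_mono mult_left_mono) auto
    finally have 2: "5 * L ^ 3 * (1 / L ^ 7) \<le> 5 / 100 * (1 / L)" by simp
    have "1 / L \<ge> 0" using L1 by simp
    then show ?thesis using 1 2 by linarith
  qed
  have tot: "\<bar>(\<Sum>h<A*K. real (N h) / m) - c\<bar> \<le> 3 * real A ^ 2 * q * real \<rho> + 1 / L"
    using e1 e2 Tc n1 by linarith
  have "(\<Sum>h<A*K. real (N h)) - m * c = m * ((\<Sum>h<A*K. real (N h) / m) - c)"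
    using m0 by (simp add: sum_divide_distrib[symmetric] right_diff_distrib)
  then have "\<bar>(\<Sum>h<A*K. real (N h)) - m * c\<bar> = m * \<bar>(\<Sum>h<A*K. real (N h) / m) - c\<bar>"
    using m0 by (simp add: abs_mult)
  also have "\<dots> \<le> m * (3 * real A ^ 2 * q * real \<rho> + 1 / L)" using tot m0 by (intro mult_left_mono) auto
  finally have fin: "\<bar>(\<Sum>h<A*K. real (N h)) - m * c\<bar> \<le> m * (3 * real A ^ 2 * q * real \<rho> + 1 / L)" .
  have c_eq: "c = real A / 2 + real A ^ 2 * 2 ^ card P / real \<rho> - real A ^ 2 / (2 * real \<rho>)"
    unfolding c_def iq[symmetric] by simp
  show ?thesis using fin unfolding c_eq m_def q_def \<rho>R by (simp only: mult.assoc)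
qed

section \<open>Numerical constants, squarefree moduli and the final estimate\<close>

text \<open>Eighth powers of exp at small arguments, where the Taylor bounds are sharp. The
  precision serves three inequalities: 0.9 * 0.69 >= 0.62, 1.1 * 0.695 <= 1 for 2^w <= L, and 1.1 *
  9.1 * 0.695 <= 7 for 544^w <= L^7.\<close>

lemma ln_2_bounds: "0.69 \<le> ln (2::real)" "ln (2::real) \<le> 0.695"
proof -
  have "9173/10000 \<le> 1 - 69/800 + (69/800)^2/2 - (69/800)^3/(6::real)" by (simp add: power2_eq_square power3_eq_cube)
  also have "\<dots> \<le> exp (- (69/800))" by (rule exp_minus_bounds) simp
  finally have "(9173/10000) ^ 8 \<le> exp (- (69/800 :: real)) ^ 8" by (rule power_mono) simp
  also have "\<dots> = exp (- 0.69)" by (simp flip: exp_of_nat_mult)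
  finally have "1/2 \<le> exp (- 0.69 :: real)" by (simp add: power_divide)
  then have "exp (0.69 :: real) \<le> 2" by (simp add: exp_minus divide_simps)
  then have "ln (exp (0.69 :: real)) \<le> ln 2" by (subst ln_le_cancel_iff) auto
  then show "0.69 \<le> ln (2::real)" by simp
  have "exp (- (695/8000 :: real)) \<le> 1 - 695/8000 + (695/8000)^2/2" by (rule exp_minus_bounds) simp
  also have "\<dots> \<le> 9169/10000" by (simp add: power2_eq_square)
  finally have "exp (- (695/8000 :: real)) ^ 8 \<le> (9169/10000) ^ 8" by (rule power_mono) simp
  moreover have "exp (- (695/8000 :: real)) ^ 8 = exp (- 0.695)" by (simp flip: exp_of_nat_mult)
  ultimately have "exp (- 0.695 :: real) \<le> 1/2" by (simp add: power_divide)
  then have "2 \<le> exp (0.695 :: real)" by (simp add: exp_minus divide_simps)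
  then have "ln 2 \<le> ln (exp (0.695 :: real))" by (subst ln_le_cancel_iff) auto
  then show "ln (2::real) \<le> 0.695" by simp
qed

lemma prod_prime_factors_squarefree:
  fixes n :: nat
  assumes "squarefree n" "n > 0"
  shows "\<Prod>(prime_factors n) = n"
proof -
  have "n = (\<Prod>p\<in>prime_factors n. p ^ multiplicity p n)" using prime_factorization_nat[OF assms(2)] .
  also have "\<dots> = (\<Prod>p\<in>prime_factors n. p)"
    using squarefree_factorial_semiring'[of n] assms by (intro prod.cong) auto
  finally show ?thesis by simp
qed

lemma squarefree_mult_imp_coprime:
  fixes a b :: nat
  assumes "squarefree (a * b)"
  shows "coprime a b"
proof (rule coprimeI)
  fix c assume "c dvd a" "c dvd b"
  then have "c ^ 2 dvd a * b" by (simp add: power2_eq_square mult_dvd_mono)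
  then show "c dvd 1" using assms squarefreeD by blast
qed

lemma powr_le_self:
  fixes L a :: real
  assumes "L \<ge> 1" "a \<le> 1"
  shows "L powr a \<le> L"
  using powr_mono[of a 1 L] assms by simp

text \<open>Only the error of the reflection argument, of order M A q rho with q = 2^(-w) and w the
  number of primes of m, has size M L^(-0.4); the sieve error, the long gaps and the exchange of 2^w
  for m / |R_m| are all O(M / L).\<close>

lemma gap_sum_estimate:
  fixes M A m :: nat
  defines "L \<equiv> ln (real M)"
  assumes L: "L \<ge> 10 ^ 5" and sf: "squarefree M" and M0: "M > 0"
    and om: "0.9 * ln L < real (omega M)" "real (omega M) < 1.1 * ln L"
    and rep: "admissible_rep 400 M A m"
  shows "\<bar>real_of_int (gap_square_sum M (quad_residues M))
      - (2 * (real M)\<^sup>2 / real (card (quad_residues M)) - real M * real A / real (card (quad_residues A)))\<bar>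
    \<le> 2000 * (real M * L powr (- 0.4))"
proof -
  have M: "M = A * m" and A3: "A \<ge> 3" and AL: "real A \<le> L powr 0.1"
    and lp: "real (least_prime_divisor m) > L powr 400"
    using rep by (auto simp: admissible_rep_def L_def)
  have L1: "L \<ge> 1" "L > 0" "L \<ge> 100" using L by auto
  have L400: "L powr 400 = L ^ 400" using L1 by (simp add: powr_numeral)
  have A0: "A > 0" and m0: "m > 0" using M0 M by auto
  have cop: "coprime A m" using sf M squarefree_mult_imp_coprime by blast
  have sfA: "squarefree A" and sfm: "squarefree m" using sf unfolding M by (auto dest: squarefree_multD)
  define P where "P = prime_factors m"
  have finP: "finite P" by (simp add: P_def)
  have prodP: "\<Prod>P = m" unfolding P_def by (rule prod_prime_factors_squarefree[OF sfm m0])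
  have Pp: "prime p \<and> real p > L ^ 400" if "p \<in> P" for p
  proof -
    have "least_prime_divisor m \<le> p" unfolding least_prime_divisor_def using that by (auto simp: P_def)
    then show ?thesis using lp L400 that by (auto simp: P_def in_prime_factors_iff)
  qed
  have p2: "p > 2" if "p \<in> P" for p
  proof -
    have "L ^ 1 \<le> L ^ 400" using L1 by (intro power_increasing) auto
    then show ?thesis using Pp[OF that] L1 by simp
  qed
  define w where "w = card P"
  define wA where "wA = card (prime_factors A)"
  have omw: "omega M = wA + w"
  proof -
    have "prime_factors M = prime_factors A \<union> prime_factors m"
      unfolding M using A0 m0 by (intro prime_factors_product) auto
    moreover have "prime_factors A \<inter> prime_factors m = {}"
    proof (rule ccontr)
      assume "prime_factors A \<inter> prime_factors m \<noteq> {}"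
      then obtain p where p: "prime p" "p dvd A" "p dvd m" by (auto simp: in_prime_factors_iff)
      then have "is_unit p" using cop coprime_common_divisor by blast
      then show False using p by simp
    qed
    ultimately show ?thesis by (simp add: omega_def wA_def w_def P_def card_Un_disjoint)
  qed
  have lnL: "ln L \<ge> 0" using L1 by simp
  have wle: "real w \<le> 1.1 * ln L" using om(2) omw by simp
  have pow_bound: "x ^ w \<le> L ^ k" if x: "x > 1" "1.1 * ln x \<le> real k" for x :: real and k
  proof -
    have "x ^ w = exp (real w * ln x)" using x by (simp add: exp_of_nat_mult)
    also have "real w * ln x \<le> (1.1 * ln L) * ln x" using wle x by (intro mult_right_mono) auto
    also have "\<dots> = ln L * (1.1 * ln x)" by simp
    also have "\<dots> \<le> ln L * real k" using x lnL by (intro mult_left_mono) auto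
    also have "exp (ln L * real k) = L ^ k" using L1 by (simp add: mult.commute exp_of_nat_mult)
    finally show ?thesis by simp
  qed
  have w2: "2 ^ w \<le> L" using pow_bound[of 2 1] ln_2_bounds by simp
  have w544: "544 ^ w \<le> L ^ 7"
  proof (rule pow_bound)
    have "10 * ln (544::real) = ln (544 ^ 10)" by (subst ln_realpow) auto
    also have "\<dots> \<le> ln (2 ^ 91)" by (subst ln_le_cancel_iff) auto
    also have "\<dots> = 91 * ln 2" by (subst ln_realpow) auto
    finally show "1.1 * ln (544::real) \<le> real 7" using ln_2_bounds by simp
  qed simp
  define E where "E = L powr (- 0.4)"
  have E0: "E > 0" using L1 by (simp add: E_def)
  have EL: "1 / L \<le> E"
  proof -
    have "L powr (-1) \<le> L powr (- 0.4)" using L1 by (intro powr_mono) auto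
    then show ?thesis using L1 by (simp add: E_def powr_minus_divide)
  qed
  \<comment> \<open>The threshold 10^5 for L is chosen so that L^0.4 >= 100.\<close>
  have E100: "E \<le> 1 / 100"
  proof -
    have "(100::real) = (10 powr 5) powr 0.4" by (simp add: powr_powr)
    also have "(10::real) powr 5 = 10 ^ 5" by (simp add: powr_numeral)
    also have "((10::real) ^ 5) powr 0.4 \<le> L powr 0.4" using L by (intro powr_mono2) auto
    finally show ?thesis using L1 by (simp add: E_def powr_minus_divide divide_simps)
  qed
  have A_le_L: "real A \<le> L" using AL powr_le_self[of L "0.1"] L1 by linarith
  define \<rho> where "\<rho> = card (quad_residues A)"
  have \<rho>0: "\<rho> > 0" unfolding \<rho>_def by (rule card_quad_residues_pos[OF A0])
  define q where "q = (1/2 :: real) ^ w"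
  have q0: "q > 0" by (simp add: q_def)
  \<comment> \<open>The origin of the exponent: as q = 2^(-omega(M)) 2^omega(A), the quantity is at
    most 4 A^2.2 2^(-omega(M)), and A^2.2 <= L^0.22 while the lower bound on omega(M) gives
    2^(-omega(M)) <= L^(-0.62).\<close>
  have Aq\<rho>: "real A * (q * real \<rho>) \<le> 4 * E"
  proof -
    have prodA: "\<Prod>(prime_factors A) = A" by (rule prod_prime_factors_squarefree[OF sfA A0])
    have R: "2 ^ wA * real \<rho> \<le> 4 * real A powr 1.2"
      using two_power_card_quad_residues_le[of "prime_factors A"] unfolding prodA wA_def \<rho>_def by auto
    have qe: "q = (1/2) ^ omega M * 2 ^ wA" unfolding q_def omw by (simp add: power_add power_one_over)
    have half: "(1/2 :: real) ^ omega M \<le> L powr (- 0.62)"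
    proof -
      have "(1/2 :: real) ^ omega M = exp (- (real (omega M) * ln 2))"
        by (simp add: exp_minus exp_of_nat_mult power_one_over inverse_eq_divide)
      also have "\<dots> \<le> exp (- (0.62 * ln L))"
      proof -
        have "0.62 * ln L \<le> (0.9 * ln L) * 0.69" using lnL by simp
        also have "\<dots> \<le> real (omega M) * ln 2" using om(1) ln_2_bounds lnL by (intro mult_mono) auto
        finally show ?thesis by simp
      qed
      also have "\<dots> = L powr (- 0.62)" using L1 by (simp add: powr_def)
      finally show ?thesis .
    qed
    have "real A * (q * real \<rho>) = real A * (1/2) ^ omega M * (2 ^ wA * real \<rho>)" unfolding qe by simp
    also have "\<dots> \<le> real A * (1/2) ^ omega M * (4 * real A powr 1.2)" using R by (intro mult_left_mono) auto
    also have "\<dots> = 4 * ((real A powr 1 * real A powr 1.2) * (1/2) ^ omega M)" using A0 by simp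
    also have "real A powr 1 * real A powr 1.2 = real A powr 2.2" using powr_add[of "real A" 1 "1.2"] by simp
    also have "real A powr 2.2 * (1/2) ^ omega M \<le> L powr 0.22 * L powr (- 0.62)"
    proof (intro mult_mono half)
      have "real A powr 2.2 \<le> (L powr 0.1) powr 2.2" using AL by (intro powr_mono2) auto
      then show "real A powr 2.2 \<le> L powr 0.22" by (simp add: powr_powr)
    qed auto
    also have "L powr 0.22 * L powr (- 0.62) = E" by (simp add: E_def flip: powr_add)
    finally show ?thesis by simp
  qed
  have q\<rho>: "q * real \<rho> \<le> 1/2"
  proof -
    have "1 * (q * real \<rho>) \<le> real A * (q * real \<rho>)" using A0 q0 by (intro mult_right_mono) auto
    then show ?thesis using Aq\<rho> E100 by linarith
  qed
  \<comment> \<open>If m had no prime factor, q would be 1, contradicting q rho <= 1/2. A prime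
    factor above L^400 then makes m larger than K.\<close>
  have w1: "P \<noteq> {}"
  proof
    assume "P = {}"
    then have "real \<rho> \<le> 1/2" using q\<rho> by (simp add: q_def w_def)
    then show False using \<rho>0 by simp
  qed
  define K where "K = nat \<lceil>L ^ 8\<rceil>"
  have K: "L ^ 8 \<le> real K" "real K \<le> 2 * L ^ 8"
    unfolding K_def using nat_ceiling_bounds[of "L ^ 8"] L1 by auto
  have Km: "K \<le> m"
  proof -
    obtain p where p: "p \<in> P" using w1 by auto
    have "p \<le> m" using prod_ge_member[of P p] finP Pp p unfolding prodP by blast
    moreover have "2 * L ^ 8 \<le> L ^ 400"
    proof -
      have "2 * L ^ 8 \<le> L * L ^ 8" using L1 by (intro mult_right_mono) auto
      also have "\<dots> = L ^ 9" using power_Suc[of L 8] by simp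
      also have "\<dots> \<le> L ^ 400" using L1 by (intro power_increasing) auto
      finally show ?thesis .
    qed
    ultimately show ?thesis using Pp[OF p] K by linarith
  qed
  define N where "N h = card {x \<in> {0..<int M}. \<forall>j\<in>{1..int h}. \<not> QuadRes (int M) (x + j)}" for h
  have S: "real_of_int (gap_square_sum M (quad_residues M)) = 2 * (\<Sum>h<M. real (N h)) - real M"
  proof -
    have "gap_square_sum M (quad_residues M) = 2 * (\<Sum>h<M. int (N h)) - int M"
      unfolding N_def
    proof (rule gap_square_sum_eq_free_counts)
      show "QuadRes (int M) (y mod int M) = QuadRes (int M) y" for y
        by (rule QuadRes_cong) (simp add: cong_def)
      show "quad_residues M = {y. y < M \<and> QuadRes (int M) (int y)}" by (rule quad_residues_eq[OF M0])
      show "quad_residues M \<noteq> {}" using card_quad_residues_pos[OF M0] by auto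
    qed
    then show ?thesis by simp
  qed
  have split: "(\<Sum>h<M. real (N h)) = (\<Sum>h<A*K. real (N h)) + (\<Sum>h\<in>{A*K..<M}. real (N h))"
  proof -
    have "A * K \<le> M" unfolding M using Km by simp
    then have "{..<M} = {..<A*K} \<union> {A*K..<M}" by auto
    moreover have "{..<A*K} \<inter> {A*K..<M} = {}" by auto
    ultimately show ?thesis by (simp add: sum.union_disjoint)
  qed
  define c where "c = real A / 2 + real A ^ 2 * 2 ^ w / real \<rho> - real A ^ 2 / (2 * real \<rho>)"
  have main: "\<bar>(\<Sum>h<A*K. real (N h)) - real m * c\<bar> \<le> real m * (3 * real A ^ 2 * (q * real \<rho>) + 1 / L)"
    using main_part_estimate[of L P A K] L1 finP Pp w2 A0 A_le_L cop K q\<rho>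
    unfolding prodP c_def N_def M q_def w_def \<rho>_def by blast
  \<comment> \<open>One factor A counts the starting points x belonging to the same y, the other the
    lengths h with the same h div A; the second one is absorbed by L^3.\<close>
  have tail: "(\<Sum>h\<in>{A*K..<M}. real (N h)) \<le> 608 * real M / L ^ 2"
  proof -
    have AP: "\<not> p dvd A" if "p \<in> P" for p
    proof
      assume "p dvd A"
      moreover have "p dvd m" "prime p" using that by (auto simp: P_def in_prime_factors_iff)
      ultimately have "is_unit p" using cop coprime_common_divisor by blast
      then show False using \<open>prime p\<close> by simp
    qed
    have "(\<Sum>h\<in>{A*K..<M}. real (N h)) \<le> (\<Sum>h\<in>{A*K..<M}. real A * real (card (scaled_blocked P A (h div A))))"
    proof (rule sum_mono)
      fix h
      have "N h \<le> A * card (scaled_blocked P A (h div A))"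
        using card_free_le_scaled_blocked[of P A h] finP Pp A0 cop unfolding prodP N_def M by blast
      then have "real (N h) \<le> real (A * card (scaled_blocked P A (h div A)))" by (simp only: of_nat_le_iff)
      then show "real (N h) \<le> real A * real (card (scaled_blocked P A (h div A)))" by simp
    qed
    also have "\<dots> = real A * (\<Sum>h\<in>{A*K..<M}. real (card (scaled_blocked P A (h div A))))"
      by (simp add: sum_distrib_left)
    also have "(\<Sum>h\<in>{A*K..<M}. real (card (scaled_blocked P A (h div A)))) = real A * (\<Sum>h\<in>{K..<m}. real (card (scaled_blocked P A h)))"
      using sum_div_blocks[OF A0, of "\<lambda>h. real (card (scaled_blocked P A h))" K "m - K"] Km by (simp add: M)
    also have "(\<Sum>h\<in>{K..<m}. real (card (scaled_blocked P A h))) \<le> 608 * real m / L ^ 3"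
      using sum_scaled_blocked_le[of L P A K m] L1 finP Pp w2 w544 AP K unfolding w_def prodP by blast
    finally have "(\<Sum>h\<in>{A*K..<M}. real (N h)) \<le> real A * (real A * (608 * real m / L ^ 3))"
      by (simp add: mult_left_mono)
    also have "\<dots> = 608 * real M * (real A / L ^ 3)" by (simp add: M)
    also have "real A / L ^ 3 \<le> L / L ^ 3" using A_le_L L1 by (intro divide_right_mono) auto
    also have "L / L ^ 3 = 1 / L ^ 2" using L1 by (simp add: power3_eq_cube power2_eq_square)
    finally show ?thesis by (simp add: mult_left_mono)
  qed
  have tail0: "0 \<le> (\<Sum>h\<in>{A*K..<M}. real (N h))" by (intro sum_nonneg) auto
  have "m \<le> M" using A0 unfolding M by simp
  then have mM: "real m \<le> real M" by (simp only: of_nat_le_iff)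
  have e1: "2 * (real m * (3 * real A ^ 2 * (q * real \<rho>) + 1 / L)) \<le> real M * (24 * E + 2 * (1 / L))"
  proof -
    have "2 * (real m * (3 * real A ^ 2 * (q * real \<rho>) + 1 / L))
        = 6 * (real M * (real A * (q * real \<rho>))) + 2 * (real m * (1 / L))"
      by (simp add: M power2_eq_square algebra_simps)
    moreover have "real M * (real A * (q * real \<rho>)) \<le> real M * (4 * E)" by (intro mult_left_mono Aq\<rho>) auto
    moreover have "real m * (1 / L) \<le> real M * (1 / L)" using mM L1 by (intro mult_right_mono) auto
    moreover have "real M * (24 * E + 2 * (1 / L)) = 24 * (real M * E) + 2 * (real M * (1 / L))"
      and "real M * (4 * E) = 4 * (real M * E)" by (simp_all add: algebra_simps)
    ultimately show ?thesis by linarith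
  qed
  have e2: "2 * (608 * real M / L ^ 2) \<le> real M * (1216 * (1 / L))"
  proof -
    have "1 / L ^ 2 \<le> 1 / L" using power_increasing[of 1 2 L] L1 by (intro divide_left_mono) auto
    then have "1216 * real M * (1 / L ^ 2) \<le> 1216 * real M * (1 / L)" by (intro mult_left_mono) auto
    then show ?thesis by (simp add: mult.commute)
  qed
  define D where "D = real m / real (card (quad_residues m))"
  have RM: "(real M)\<^sup>2 / real (card (quad_residues M)) = real M * (real A / real \<rho>) * D"
    unfolding D_def \<rho>_def M card_quad_residues_mult[OF cop A0 m0] by (simp add: power2_eq_square)
  have Dlo: "2 ^ w * (1 - real w / L ^ 400) \<le> D" and Dhi: "D \<le> 2 ^ w"
    using inverse_density_bounds[of P "L ^ 400"] finP Pp p2 L1 unfolding prodP D_def w_def by force+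
  have e3: "\<bar>2 * real M * (real A / real \<rho>) * 2 ^ w - 2 * (real M)\<^sup>2 / real (card (quad_residues M))\<bar> \<le> real M * (2 * (1 / L))"
  proof -
    have "2 * (real M)\<^sup>2 / real (card (quad_residues M)) = 2 * real M * (real A / real \<rho>) * D" using RM by simp
    then have "2 * real M * (real A / real \<rho>) * 2 ^ w - 2 * (real M)\<^sup>2 / real (card (quad_residues M))
      = 2 * real M * (real A / real \<rho>) * (2 ^ w - D)" by (simp add: right_diff_distrib)
    moreover have "0 \<le> 2 * real M * (real A / real \<rho>) * (2 ^ w - D)" using Dhi by simp
    moreover have "2 * real M * (real A / real \<rho>) * (2 ^ w - D) \<le> 2 * real M * L * (L * L / L ^ 400)"
    proof (intro mult_mono mult_left_mono)
      have "real A / real \<rho> \<le> real A / 1" using \<rho>0 by (intro divide_left_mono) auto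
      then show "real A / real \<rho> \<le> L" using A_le_L by simp
      have "w \<le> 2 ^ w" using less_exp less_imp_le by blast
      then have "real w \<le> real (2 ^ w)" by (simp only: of_nat_le_iff)
      then have wL: "real w \<le> L" using w2 by (simp only: of_nat_power of_nat_numeral)
      have "2 ^ w - D \<le> 2 ^ w * real w / L ^ 400" using Dlo by (simp add: right_diff_distrib)
      also have "\<dots> \<le> L * L / L ^ 400" using w2 wL L1 by (intro divide_right_mono mult_mono) auto
      finally show "2 ^ w - D \<le> L * L / L ^ 400" .
    qed (use Dhi L1 in auto)
    moreover have "2 * real M * L * (L * L / L ^ 400) \<le> real M * (2 * (1 / L))"
    proof -
      have "L * (L * L / L ^ 400) \<le> 1 / L"
      proof -
        have "L * (L * L) * L = L ^ 4" by (simp add: power4_eq_xxxx)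
        also have "\<dots> \<le> L ^ 400" using L1 by (intro power_increasing) auto
        finally show ?thesis using L1 by (simp add: divide_simps mult.assoc)
      qed
      then have "2 * real M * (L * (L * L / L ^ 400)) \<le> 2 * real M * (1 / L)" by (intro mult_left_mono) auto
      then show ?thesis by (simp only: mult.assoc mult.left_commute mult.commute)
    qed
    ultimately show ?thesis by linarith
  qed
  \<comment> \<open>The term A/2 of c contributes 2 m A/2 = M, which cancels the -M of the gap
    identity; -A^2 / (2 rho) becomes the secondary term of the formula.\<close>
  have mc: "2 * (real m * c) - real M = 2 * real M * (real A / real \<rho>) * 2 ^ w - real M * real A / real \<rho>"
    unfolding c_def M by (simp add: power2_eq_square algebra_simps)
  have "\<bar>real_of_int (gap_square_sum M (quad_residues M))
      - (2 * (real M)\<^sup>2 / real (card (quad_residues M)) - real M * real A / real \<rho>)\<bar>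
    \<le> real M * (24 * E + 2 * (1 / L)) + real M * (1216 * (1 / L)) + real M * (2 * (1 / L))"
  proof -
    have "\<bar>s - (r - t)\<bar> \<le> y1 + y2 + y3"
      if "s = 2 * n - u" "n = a + b" "\<bar>a - v\<bar> \<le> x" "b \<le> y" "0 \<le> b" "2 * x \<le> y1" "2 * y \<le> y2"
        "\<bar>z - r\<bar> \<le> y3" "2 * v - u = z - t" for s r t y1 y2 y3 n u a b v x y z :: real
      using that by linarith
    from this[OF S split main tail tail0 e1 e2 e3 mc] show ?thesis .
  qed
  also have "\<dots> = real M * (24 * E + 1220 * (1 / L))" by (simp add: algebra_simps)
  also have "\<dots> \<le> real M * (2000 * E)"
    using EL E0 by (intro mult_left_mono) auto
  finally show ?thesis by (simp add: \<rho>_def E_def)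
qed

text \<open>Prime factors of A are at most L^0.1 and those of m' exceed L^400, so A is coprime to m'
  and divides A'; by symmetry A' divides A.\<close>

lemma admissible_rep_unique:
  assumes L: "ln (real M) \<ge> 1" and M0: "M > 0"
    and r: "admissible_rep 400 M A m" "admissible_rep 400 M A' m'"
  shows "A = A' \<and> m = m'"
proof -
  have key: "B dvd B'" if r: "admissible_rep 400 M B n" "admissible_rep 400 M B' n'" for B n B' n'
  proof -
    have B: "M = B * n" "real B \<le> ln (real M) powr 0.1" and B': "M = B' * n'"
      and lp: "real (least_prime_divisor n') > ln (real M) powr 400"
      using r unfolding admissible_rep_def by blast+
    have "B \<noteq> 0" using M0 B(1) by (intro notI) simp
    moreover have "n' \<noteq> 0" using M0 B' by (intro notI) simp
    ultimately have pos: "B > 0" "n' > 0" by simp_all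
    have "coprime B n'"
    proof (rule ccontr)
      assume "\<not> coprime B n'"
      then have "gcd B n' \<noteq> 1" using coprime_iff_gcd_eq_1 by blast
      then obtain p where p: "prime p" "p dvd gcd B n'" using prime_factor_nat by blast
      then have "p \<in> prime_factors n'" using pos by (auto simp: in_prime_factors_iff)
      then have "least_prime_divisor n' \<le> p" unfolding least_prime_divisor_def by (intro Min_le) auto
      moreover have "p \<le> B" using p pos by (auto intro: dvd_imp_le)
      moreover have "ln (real M) powr 0.1 \<le> ln (real M) powr 400" using L by (intro powr_mono) auto
      ultimately show False using B lp by linarith
    qed
    moreover have "B dvd B' * n'" using B B' by (metis dvd_triv_left)
    ultimately show ?thesis by (simp add: coprime_dvd_mult_left_iff)
  qed
  have "A = A'" using key[OF r] key[OF r(2) r(1)] by (rule dvd_antisym)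
  moreover have "A * m = A' * m'" "A > 0" using r M0 by (auto simp: admissible_rep_def)
  ultimately show ?thesis by simp
qed

theorem theorem1p5:
  shows "\<exists>C\<^sub>0::real. C\<^sub>0 > 2 \<and>
    (\<exists>(M\<^sub>0::nat) (K::real). \<forall>M \<in> Omega_set C\<^sub>0 M\<^sub>0.
      (\<exists>!p. admissible_rep C\<^sub>0 M (fst p) (snd p)) \<and>
      (\<forall>A m. admissible_rep C\<^sub>0 M A m \<longrightarrow>
        \<bar>real_of_int (gap_square_sum M (quad_residues M))
           - (2 * (real M)\<^sup>2 / real (card (quad_residues M))
              - real M * real A / real (card (quad_residues A)))\<bar>
        \<le> K * (real M * ln (real M) powr (- 0.4))))"
proof (rule exI[of _ 400], rule conjI, simp, rule exI[of _ "nat \<lceil>exp (10 ^ 5 :: real)\<rceil>"],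
    rule exI[of _ 2000], intro ballI conjI)
  fix M assume M: "M \<in> Omega_set 400 (nat \<lceil>exp (10 ^ 5 :: real)\<rceil>)"
  have M0: "M > 0" and sf: "squarefree M"
    and om: "0.9 * ln (ln (real M)) < real (omega M)" "real (omega M) < 1.1 * ln (ln (real M))"
    using M by (auto simp: Omega_set_def)
  obtain A m where Am: "admissible_rep 400 M A m" using M by (auto simp: Omega_set_def)
  have "exp (10 ^ 5) \<le> real M"
  proof -
    have "nat \<lceil>exp (10 ^ 5 :: real)\<rceil> \<le> M" using M by (simp only: Omega_set_def mem_Collect_eq)
    then show ?thesis by linarith
  qed
  then have L: "ln (real M) \<ge> 10 ^ 5" using M0 by (simp only: ln_ge_iff of_nat_0_less_iff)
  have "p = (A, m)" if "admissible_rep 400 M (fst p) (snd p)" for p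
    using admissible_rep_unique[OF _ M0 that Am] L by (cases p) simp
  then show "\<exists>!p. admissible_rep 400 M (fst p) (snd p)" using Am by (intro ex1I[of _ "(A, m)"]) auto
  show "\<forall>A m. admissible_rep 400 M A m \<longrightarrow>
      \<bar>real_of_int (gap_square_sum M (quad_residues M))
         - (2 * (real M)\<^sup>2 / real (card (quad_residues M)) - real M * real A / real (card (quad_residues A)))\<bar>
      \<le> 2000 * (real M * ln (real M) powr (- 0.4))"
    using gap_sum_estimate[OF L sf M0 om] by blast
qed

end
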